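(* For all integers $n\ge 3$ and $l\ge 0$, $$K_{n-2}^{l+1}=K_n^l-n\,l\,K_n^{l-1},$$ where for $l=0$ the term $n\,l\,K_n^{l-1}$ is read as $0$.
   Context: For integers $n\ge 1$, $l\ge 0$ consider pairs $(p,b)$, where $p(x)=x^n+\lambda_2x^{n-2}+\cdots+\lambda_{n-1}x$ is a real polynomial (so $p(x)=x$ if $n=1$ and $p(x)=x^2$ if $n=2$) and $b=(b_1,\dots,b_l)\in\mathbb{R}^l$ is an ordered (enumerated) list of $l$ real numbers, called boundary points. The space of such pairs is identified with the Euclidean space of parameters $(\lambda_2,\dots,\lambda_{n-1},b_1,\dots,b_l)$, with its usual topology. A pair $(p,b)$ is called a very nice M-morsification of the multiboundary singularity $B_n^l$ if all $n-1$ complex critical points of $p$ (counted with multiplicity) are real, and the $n-1$ critical values of $p$ (counted with multiplicity, so that in particular all critical points are nondegenerate) together with the $l$ boundary values $p(b_1),\dots,p(b_l)$ are $n-1+l$ pairwise distinct real numbers. $K_n^l$ denotes the number of connected components of the space of very nice M-morsifications of $B_n^l$, regarded as an open subset of the parameter space. The boundary points are labelled; one does not quotient by permutations of them. *)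

theory Defs
  imports "HOL-Analysis.Analysis" "HOL-Computational_Algebra.Computational_Algebra"
begin

text \<open>A parameter is a pair \<open>(lam, b)\<close> with \<open>lam = (\<lambda>\<^sub>2, \<dots>, \<lambda>\<^sub>n\<^sub>-\<^sub>1)\<close> and
  \<open>b = (b\<^sub>1, \<dots>, b\<^sub>l)\<close>. Both are extensional functions on finite index sets, so for
  \<open>n \<le> 2\<close> (resp. \<open>l = 0\<close>) the first (resp. second) factor is a one-point space.\<close>

type_synonym param = "(nat \<Rightarrow> real) \<times> (nat \<Rightarrow> real)"

definition param_space :: "nat \<Rightarrow> nat \<Rightarrow> param topology" where
  "param_space n l =
     prod_topology (product_topology (\<lambda>_. euclideanreal) {2..<n})
                   (product_topology (\<lambda>_. euclideanreal) {1..l})"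

definition morsif_poly :: "nat \<Rightarrow> (nat \<Rightarrow> real) \<Rightarrow> real poly" where
  "morsif_poly n lam = monom 1 n + (\<Sum>i\<in>{2..<n}. monom (lam i) (n - i))"

definition complex_critical_points :: "real poly \<Rightarrow> complex multiset" where
  "complex_critical_points p = proots (pderiv (map_poly complex_of_real p))"

definition critical_values :: "real poly \<Rightarrow> complex multiset" where
  "critical_values p =
     image_mset (poly (map_poly complex_of_real p)) (complex_critical_points p)"

definition boundary_values :: "nat \<Rightarrow> real poly \<Rightarrow> (nat \<Rightarrow> real) \<Rightarrow> complex multiset" where
  "boundary_values l p b = image_mset (\<lambda>j. complex_of_real (poly p (b j))) (mset_set {1..l})"

text \<open>In \<open>very_nice\<close>, the critical values are values of the real polynomial \<open>p\<close> at real points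
  and hence real, and having all multiplicities at most one says that the critical values
  (counted with multiplicity) and the boundary values are pairwise distinct.\<close>

definition very_nice :: "nat \<Rightarrow> nat \<Rightarrow> param \<Rightarrow> bool" where
  "very_nice n l = (\<lambda>(lam, b). let p = morsif_poly n lam in
     set_mset (complex_critical_points p) \<subseteq> \<real> \<and>
     (\<forall>v. count (critical_values p + boundary_values l p b) v \<le> 1))"

definition very_nice_space :: "nat \<Rightarrow> nat \<Rightarrow> param topology" where
  "very_nice_space n l = subtopology (param_space n l) {x. very_nice n l x}"

definition K :: "nat \<Rightarrow> nat \<Rightarrow> nat" where
  "K n l = card (connected_components_of (very_nice_space n l))"

end

theory Submission
  imports "HOL-Homology.Invariance_of_Domain" Defs
begin

text \<open>A real polynomial with real simple critical points is determined, up to translation and an additive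
  constant, by the alternating sequence of its critical values, and every such sequence occurs: the map
  from gaps between critical points to differences of critical values is a proper local injection of an
  open orthant, hence a covering by invariance of domain, and the Chebyshev value sequence has a single
  preimage. So the components of the space of very nice morsifications correspond to the combinatorial
  types: the branches carrying the boundary points, and the order of all \<open>n - 1 + l\<close> values.

  In a type consider the word that records, from the lowest value to the highest, whether the value is that of
  a local maximum. Its rises exceed its falls by one, unless a boundary point is on top.
  Summed over all types, rises and falls that can be exchanged cancel. What remains are adjacent critical
  points with consecutive values, which cancel to a new boundary point of a polynomial of degree \<open>n - 2\<close>, and
  boundary points immediately below the top of their branch, which give \<open>l\<close> choices of the point,
  \<open>n\<close> choices of the branch, and an arbitrary type with \<open>l - 1\<close> points.\<close>

subsection \<open>Polynomials with real simple critical points\<close>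

text \<open>Invariance of domain stands in for a Jacobian: local injectivity of the map from gaps to
  height differences needs only root counting, and properness only two elementary estimates.
  Properness gives a covering; its number of sheets is read off one fibre, where the alternation
  argument of best approximation applies. The cancellation works because only neighbours on the
  graph have a prescribed comparison. Exchanging consecutive values keeps a type valid unless their
  bearers are neighbours. A local maximum lies above its neighbours, so a fall is always
  exchangeable, and the surplus consists of the rises between neighbours. Giving each branch that is
  unbounded above a fictitious top beyond all ranks turns a highest boundary point into one more
  point immediately below the top of its branch. All n branches then contribute alike, whence the
  factor n. Throughout, \<open>m = n - 1\<close> counts critical points. For n \<ge> 3 every
  critical point has a neighbouring one, so the lowest value is never a maximum and the highest
  never a minimum.\<close>

definition lin_prod :: "nat \<Rightarrow> (nat \<Rightarrow> real) \<Rightarrow> real poly" where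
  "lin_prod m x = (\<Prod>i<m. [:- x i, 1:])"

text \<open>The factor \<open>Suc m\<close> makes \<open>p\<close> monic of degree
  \<open>m + 1\<close>. The additive constant stays free, so that vertical shifts preserve
  \<open>crit\<close>.\<close>

definition crit :: "nat \<Rightarrow> (nat \<Rightarrow> real) \<Rightarrow> real poly \<Rightarrow> bool" where
  "crit m x p \<longleftrightarrow> (\<forall>i j. i < j \<longrightarrow> j < m \<longrightarrow> x i < x j) \<and>
     pderiv p = smult (real (Suc m)) (lin_prod m x)"

lemma poly_lin_prod: "poly (lin_prod m x) t = (\<Prod>i<m. t - x i)"
  by (simp add: lin_prod_def poly_prod)

lemma degree_lin_prod: "degree (lin_prod m x) = m"
  by (simp add: lin_prod_def degree_prod_eq_sum_degree)

lemma lead_coeff_lin_prod: "coeff (lin_prod m x) m = 1"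
proof -
  have "lead_coeff (lin_prod m x) = 1" by (simp add: lin_prod_def lead_coeff_prod)
  then show ?thesis by (simp add: degree_lin_prod)
qed

lemma crit_less: "crit m x p \<Longrightarrow> i < j \<Longrightarrow> j < m \<Longrightarrow> x i < x j"
  by (simp add: crit_def)

lemma crit_le: "crit m x p \<Longrightarrow> i \<le> j \<Longrightarrow> j < m \<Longrightarrow> x i \<le> x j"
  by (cases "i = j") (auto dest: crit_less[of m x p i j])

text \<open>Exactly \<open>m - k\<close> factors are negative; the exponent \<open>m + k\<close> has
  the same parity and avoids truncated subtraction.\<close>

lemma sign_prod:
  fixes x :: "nat \<Rightarrow> real"
  assumes "k \<le> m" "\<And>i. i < k \<Longrightarrow> x i < t" "\<And>i. k \<le> i \<Longrightarrow> i < m \<Longrightarrow> t < x i"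
  shows "0 < (-1) ^ (m + k) * (\<Prod>i<m. t - x i)"
  using assms
proof (induction m)
  case 0 then show ?case by simp
next
  case (Suc m)
  show ?case
  proof (cases "k = Suc m")
    case True
    have "0 < (\<Prod>i<Suc m. t - x i)"
      by (rule prod_pos) (use Suc.prems True in auto)
    then show ?thesis using True by (metis mult_1 power_minus1_even mult_2)
  next
    case False
    then have "k \<le> m" using Suc.prems by simp
    then have "0 < (-1) ^ (m + k) * (\<Prod>i<m. t - x i)" using Suc by auto
    moreover have "t - x m < 0" using Suc.prems \<open>k \<le> m\<close> by auto
    ultimately have "(t - x m) * ((-1) ^ (m + k) * (\<Prod>i<m. t - x i)) < 0"
      by (rule mult_neg_pos[rotated])
    then show ?thesis by (simp add: mult.commute mult.left_commute)
  qed
qed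

text \<open>On branch \<open>k\<close> the derivative has the constant sign given by
  \<open>sign_prod\<close>, so the mean value theorem applies up to the ends of the branch. The
  guards \<open>k > 0\<close> and \<open>k < m\<close> drop the missing end of an outer
  branch.\<close>

lemma branch_mono:
  assumes c: "crit m x p" and "k \<le> m" "a < b"
    and lo: "k > 0 \<Longrightarrow> x (k - 1) \<le> a" and hi: "k < m \<Longrightarrow> b \<le> x k"
  shows "0 < (-1) ^ (m + k) * (poly p b - poly p a)"
proof -
  obtain s where s: "a < s" "s < b" "poly p b - poly p a = (b - a) * poly (pderiv p) s"
    using poly_MVT[OF \<open>a < b\<close>] by blast
  have "0 < (-1) ^ (m + k) * (\<Prod>i<m. s - x i)"
  proof (rule sign_prod[OF \<open>k \<le> m\<close>])
    fix i assume "i < k"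
    then have "x i \<le> x (k - 1)" using crit_le[OF c, of i "k - 1"] \<open>k \<le> m\<close> by auto
    then show "x i < s" using lo s \<open>i < k\<close> by force
  next
    fix i assume "k \<le> i" "i < m"
    then show "s < x i" using crit_le[OF c, of k i] hi s by force
  qed
  then have "0 < (b - a) * real (Suc m) * ((-1) ^ (m + k) * (\<Prod>i<m. s - x i))"
    using \<open>a < b\<close> by simp
  also have "\<dots> = (-1) ^ (m + k) * (poly p b - poly p a)"
  proof -
    have "poly p b - poly p a = (b - a) * (real (Suc m) * (\<Prod>i<m. s - x i))"
      using c s(3) by (simp add: crit_def poly_lin_prod)
    then show ?thesis by (simp only: mult_ac)
  qed
  finally show ?thesis .
qed

lemma local_extremum:
  assumes c: "crit m x p" and "i < m"
    and lo: "i > 0 \<Longrightarrow> x (i - 1) \<le> t" and hi: "Suc i < m \<Longrightarrow> t \<le> x (Suc i)"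
  shows "0 \<le> (-1) ^ (m + i) * (poly p (x i) - poly p t)"
proof (cases t "x i" rule: linorder_cases)
  case less
  then show ?thesis using branch_mono[OF c, of i t "x i"] assms by auto
next
  case greater
  then have "0 < (-1) ^ (m + Suc i) * (poly p t - poly p (x i))"
    using branch_mono[OF c, of "Suc i" "x i" t] assms by auto
  then show ?thesis by (simp add: algebra_simps)
qed simp

lemma crit_unique:
  assumes "crit m x p" "crit m y p" "i < m"
  shows "x i = y i"
proof -
  have *: "map z [0..<m] = sorted_list_of_set {t. poly (pderiv p) t = 0}" if "crit m z p" for z
  proof (rule sorted_distinct_set_unique)
    have sm: "i < j \<Longrightarrow> j < m \<Longrightarrow> z i < z j" for i j using that by (simp add: crit_def)
    have roots: "{t. poly (pderiv p) t = 0} = z ` {..<m}"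
      using that by (auto simp: crit_def poly_lin_prod)
    show "sorted (map z [0..<m])"
      unfolding sorted_iff_nth_mono using sm by (auto simp: less_imp_le dest: le_neq_implies_less)
    show "distinct (map z [0..<m])"
      using sm by (auto simp: distinct_map inj_on_def) (metis less_irrefl nat_neq_iff)
    show "set (map z [0..<m]) = set (sorted_list_of_set {t. poly (pderiv p) t = 0})"
      by (simp add: roots atLeast0LessThan)
  qed simp_all
  have "map x [0..<m] = map y [0..<m]" using * assms by metis
  then show ?thesis using \<open>i < m\<close> by (simp add: map_eq_conv)
qed

text \<open>At \<open>x i\<close> the difference \<open>p - q\<close> equals
  \<open>q (y i) - q (x i)\<close>, at \<open>y i\<close> it equals
  \<open>p (y i) - p (x i)\<close>; as both points are extrema of the same kind, the two differences
  have opposite weak signs and a zero lies between. The interlacing hypotheses keep these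
  \<open>m\<close> zeros distinct, too many for the degree.\<close>

lemma close_crit_eq:
  assumes c: "crit m x p" and d: "crit m y q" and deg: "degree (p - q) < m"
    and xy: "\<And>i. Suc i < m \<Longrightarrow> x i < y (Suc i)" "\<And>i. Suc i < m \<Longrightarrow> y i < x (Suc i)"
    and val: "\<And>i. i < m \<Longrightarrow> poly p (x i) = poly q (y i)"
  shows "p = q"
proof (rule ccontr)
  assume "p \<noteq> q"
  have "\<exists>z. min (x i) (y i) \<le> z \<and> z \<le> max (x i) (y i) \<and> poly (p - q) z = 0" if i: "i < m" for i
  proof -
    have 1: "0 \<le> (-1) ^ (m + i) * (poly p (x i) - poly p (y i))"
      by (rule local_extremum[OF c i])
        (use xy(1)[of "i - 1"] i in simp, use xy(2)[of i] i in simp)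
    have 2: "0 \<le> (-1) ^ (m + i) * (poly q (y i) - poly q (x i))"
      by (rule local_extremum[OF d i])
        (use xy(2)[of "i - 1"] i in simp, use xy(1)[of i] i in simp)
    have e: "poly q (y i) = poly p (x i)" using val i by simp
    define s where "s = ((-1) ^ (m + i) :: real)"
    have s: "s = 1 \<or> s = -1" unfolding s_def using neg_one_even_power neg_one_odd_power by blast
    have A: "0 \<le> s * poly (p - q) (x i)" using 2 e by (simp add: s_def)
    have B: "s * poly (p - q) (y i) \<le> 0" using 1 e by (simp add: s_def algebra_simps)
    have cont: "continuous_on S (poly (p - q))" for S by (rule continuous_on_poly) (rule continuous_on_id)
    show ?thesis
    proof (cases "x i \<le> y i")
      case True
      then show ?thesis using s A B IVT2'[of "poly (p-q)" "y i" 0 "x i"] IVT'[of "poly (p-q)" "x i" 0 "y i"] cont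
        by auto
    next
      case False
      then show ?thesis using s A B IVT2'[of "poly (p-q)" "x i" 0 "y i"] IVT'[of "poly (p-q)" "y i" 0 "x i"] cont
        by auto
    qed
  qed
  then obtain z where z: "\<And>i. i < m \<Longrightarrow> min (x i) (y i) \<le> z i \<and> z i \<le> max (x i) (y i) \<and> poly (p - q) (z i) = 0"
    by metis
  have lt: "z i < z j" if "i < j" "j < m" for i j
  proof -
    have "max (x i) (y i) < min (x (Suc i)) (y (Suc i))"
      using xy[of i] crit_less[OF c, of i "Suc i"] crit_less[OF d, of i "Suc i"] that by auto
    also have "\<dots> \<le> min (x j) (y j)"
      using crit_le[OF c, of "Suc i" j] crit_le[OF d, of "Suc i" j] that by auto
    finally show ?thesis using z[of i] z[of j] that by auto
  qed
  have inj: "inj_on z {..<m}"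
    by (rule linorder_inj_onI) (use lt in \<open>fastforce simp: less_le\<close>)+
  have "z ` {..<m} \<subseteq> {t. poly (p - q) t = 0}" using z by auto
  moreover have "finite {t. poly (p - q) t = 0}" using \<open>p \<noteq> q\<close> by (intro poly_roots_finite) simp
  ultimately have "m \<le> card {t. poly (p - q) t = 0}"
    using card_mono card_image[OF inj] by (metis card_lessThan)
  also have "\<dots> \<le> degree (p - q)" using \<open>p \<noteq> q\<close> by (intro card_poly_roots_bound) simp
  finally show False using deg by simp
qed

subsection \<open>The polynomial with prescribed critical points\<close>

text \<open>Antidifferentiation term by term with zero constant term, the normalisation built into
  \<open>morsif_poly\<close>.\<close>

definition crit_poly :: "nat \<Rightarrow> (nat \<Rightarrow> real) \<Rightarrow> real poly" where
  "crit_poly m x = (\<Sum>j\<le>m. monom (real (Suc m) * coeff (lin_prod m x) j / real (Suc j)) (Suc j))"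

lemma coeff_crit_poly:
  "coeff (crit_poly m x) j = (if 1 \<le> j \<and> j \<le> Suc m then real (Suc m) * coeff (lin_prod m x) (j - 1) / real j else 0)"
proof (cases j)
  case 0 then show ?thesis by (simp add: crit_poly_def coeff_sum)
next
  case (Suc i)
  then have "coeff (crit_poly m x) j = (\<Sum>j\<le>m. if j = i then real (Suc m) * coeff (lin_prod m x) j / real (Suc j) else 0)"
    by (auto simp add: crit_poly_def coeff_sum intro!: sum.cong)
  then show ?thesis using Suc by auto
qed

lemma pderiv_crit_poly: "pderiv (crit_poly m x) = smult (real (Suc m)) (lin_prod m x)"
  by (rule poly_eqI) (auto simp add: coeff_pderiv coeff_crit_poly coeff_eq_0 degree_lin_prod)

lemma crit_crit_poly:
  "(\<And>i j. i < j \<Longrightarrow> j < m \<Longrightarrow> x i < x j) \<Longrightarrow> crit m x (crit_poly m x)"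
  by (simp add: crit_def pderiv_crit_poly)

text \<open>Vieta's formula. It turns the absence of the second highest term in
  \<open>morsif_poly\<close> into the condition that the critical points have sum zero.\<close>

lemma coeff_lin_prod_second: "coeff (lin_prod (Suc m) x) m = - (\<Sum>i<Suc m. x i)"
proof (induction m)
  case 0 show ?case by (simp add: lin_prod_def)
next
  case (Suc m)
  have "lin_prod (Suc (Suc m)) x = lin_prod (Suc m) x * [:- x (Suc m), 1:]"
    by (simp add: lin_prod_def)
  also have "\<dots> = smult (- x (Suc m)) (lin_prod (Suc m) x) + pCons 0 (lin_prod (Suc m) x)"
    by (simp add: mult.commute)
  finally show ?case using Suc lead_coeff_lin_prod[of "Suc m" x] by (simp add: coeff_pCons)
qed

lemma coeff_morsif_poly:
  "coeff (morsif_poly (Suc m) lam) j =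
    (if j = Suc m then 1 else if 1 \<le> j \<and> j < m then lam (Suc m - j) else 0)"
proof -
  have "coeff (morsif_poly (Suc m) lam) j
     = (if Suc m = j then 1 else 0) + (\<Sum>i\<in>{2..<Suc m}. if Suc m - i = j then lam i else 0)"
    by (simp add: morsif_poly_def coeff_sum)
  also have "(\<Sum>i\<in>{2..<Suc m}. if Suc m - i = j then lam i else 0)
     = (\<Sum>i\<in>{2..<Suc m}. if i = Suc m - j then (if 1 \<le> j \<and> j < m then lam i else 0) else 0)"
    by (rule sum.cong) auto
  also have "\<dots> = (if 1 \<le> j \<and> j < m then lam (Suc m - j) else 0)"
    by (subst sum.delta) auto
  finally show ?thesis by auto
qed

definition lam_of :: "nat \<Rightarrow> (nat \<Rightarrow> real) \<Rightarrow> nat \<Rightarrow> real" where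
  "lam_of m x = (\<lambda>i\<in>{2..<Suc m}. coeff (crit_poly m x) (Suc m - i))"

lemma morsif_lam_of:
  assumes "(\<Sum>i<m. x i) = 0"
  shows "morsif_poly (Suc m) (lam_of m x) = crit_poly m x"
proof (rule poly_eqI)
  fix j
  show "coeff (morsif_poly (Suc m) (lam_of m x)) j = coeff (crit_poly m x) j"
  proof (cases "j = m \<and> m > 0")
    case True
    then obtain k where "m = Suc k" using gr0_implies_Suc by blast
    then show ?thesis using assms True coeff_lin_prod_second[of k x]
      by (simp add: coeff_morsif_poly coeff_crit_poly)
  next
    case False
    then show ?thesis
      by (auto simp add: coeff_morsif_poly lam_of_def)
         (auto simp add: coeff_crit_poly lead_coeff_lin_prod)
  qed
qed

text \<open>Both polynomials have the same derivative and no constant term. Together with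
  \<open>morsif_lam_of\<close> this makes the centred increasing tuples coordinates on the
  polynomials with real simple critical points.\<close>

lemma crit_morsif:
  assumes "crit m x (morsif_poly (Suc m) lam)" "lam \<in> extensional {2..<Suc m}"
  shows "(\<Sum>i<m. x i) = 0" "lam = lam_of m x"
proof -
  have "pderiv (morsif_poly (Suc m) lam - crit_poly m x) = 0"
    using assms by (simp add: pderiv_diff pderiv_crit_poly crit_def)
  then obtain h where h: "morsif_poly (Suc m) lam - crit_poly m x = [:h:]"
    using pderiv_iszero by blast
  have "coeff (morsif_poly (Suc m) lam - crit_poly m x) 0 = 0"
    by (simp add: coeff_morsif_poly coeff_crit_poly)
  then have eq: "morsif_poly (Suc m) lam = crit_poly m x" using h by simp
  show "(\<Sum>i<m. x i) = 0"
  proof (cases m)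
    case (Suc k)
    have "coeff (crit_poly m x) m = 0" unfolding eq[symmetric] by (simp add: coeff_morsif_poly)
    then show ?thesis using coeff_lin_prod_second[of k x] Suc by (simp add: coeff_crit_poly)
  qed simp
  show "lam = lam_of m x"
  proof (rule extensionalityI[OF assms(2)])
    fix i assume "i \<in> {2..<Suc m}"
    then show "lam i = lam_of m x i"
      unfolding lam_of_def eq[symmetric] by (auto simp: coeff_morsif_poly)
  qed (simp add: lam_of_def)
qed

text \<open>The leading terms cancel and centring kills the next coefficients, so two degrees are
  lost. This is the degree bound required by \<open>close_crit_eq\<close>.\<close>

lemma degree_crit_poly_diff:
  assumes "m > 0" "(\<Sum>i<m. x i) = 0" "(\<Sum>i<m. y i) = 0"
  shows "degree (crit_poly m x - crit_poly m y + [:h:]) < m"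
proof -
  have "coeff (crit_poly m x - crit_poly m y + [:h:]) j = 0" if "j \<ge> m" for j
    using that assms by (auto simp add: morsif_lam_of[symmetric] coeff_morsif_poly coeff_pCons split: nat.split)
  then show ?thesis using \<open>m > 0\<close> by (metis leI leading_coeff_0_iff degree_0)
qed

lemma continuous_coeff_lin_prod:
  assumes "\<And>i. i < m \<Longrightarrow> continuous_on S (\<lambda>s. x s i)"
  shows "continuous_on S (\<lambda>s. coeff (lin_prod m (x s)) j)"
  using assms
proof (induction m arbitrary: j)
  case 0 then show ?case by (simp add: lin_prod_def)
next
  case (Suc m)
  have eq: "lin_prod (Suc m) z = smult (- z m) (lin_prod m z) + pCons 0 (lin_prod m z)" for z
    by (simp add: lin_prod_def mult.commute)
  show ?case
    unfolding eq using Suc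
    by (cases j) (auto intro!: continuous_intros)
qed

lemma continuous_coeff_crit_poly:
  assumes "\<And>i. i < m \<Longrightarrow> continuous_on S (\<lambda>s. x s i)"
  shows "continuous_on S (\<lambda>s. coeff (crit_poly m (x s)) j)"
  unfolding coeff_crit_poly
  by (cases "1 \<le> j \<and> j \<le> Suc m") (auto intro!: continuous_intros continuous_coeff_lin_prod assms)

lemma continuous_poly_crit_poly:
  assumes "\<And>i. i < m \<Longrightarrow> continuous_on S (\<lambda>s. x s i)" "continuous_on S t"
  shows "continuous_on S (\<lambda>s. poly (crit_poly m (x s)) (t s))"
  unfolding crit_poly_def poly_sum poly_monom
  by (auto intro!: continuous_intros continuous_coeff_lin_prod assms)

lemma neg_one_cases: "((-1) ^ k :: real) = 1 \<or> ((-1) ^ k :: real) = -1"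
  using neg_one_even_power neg_one_odd_power by blast

text \<open>At distance at least 1 from all critical points every factor of the derivative has
  absolute value at least 1. This is the quantitative form of the unboundedness of the outer
  branches.\<close>

lemma branch_growth:
  assumes c: "crit m x p" and "k \<le> m" "a \<le> b"
    and lo: "\<And>i. i < k \<Longrightarrow> x i + 1 \<le> a" and hi: "\<And>i. k \<le> i \<Longrightarrow> i < m \<Longrightarrow> b \<le> x i - 1"
  shows "b - a \<le> (-1) ^ (m + k) * (poly p b - poly p a)"
proof (cases "a = b")
  case False
  then have "a < b" using assms by simp
  obtain s where s: "a < s" "s < b" "poly p b - poly p a = (b - a) * poly (pderiv p) s"
    using poly_MVT[OF \<open>a < b\<close>] by blast
  have pos: "0 < (-1) ^ (m + k) * (\<Prod>i<m. s - x i)"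
    by (rule sign_prod[OF \<open>k \<le> m\<close>]) (use lo hi s in force)+
  have "1 \<le> (\<Prod>i<m. \<bar>s - x i\<bar>)"
  proof (rule prod_ge_1)
    fix i assume "i \<in> {..<m}"
    then show "1 \<le> \<bar>s - x i\<bar>" using lo[of i] hi[of i] s by (cases "i < k") auto
  qed
  also have "\<dots> = \<bar>(-1) ^ (m + k) * (\<Prod>i<m. s - x i)\<bar>"
    by (simp add: abs_mult power_abs abs_prod)
  finally have "1 \<le> (-1) ^ (m + k) * (\<Prod>i<m. s - x i)" using pos by simp
  then have "1 * 1 \<le> real (Suc m) * ((-1) ^ (m + k) * (\<Prod>i<m. s - x i))"
    by (intro mult_mono) auto
  then have "(b - a) * 1 \<le> (b - a) * (real (Suc m) * ((-1) ^ (m + k) * (\<Prod>i<m. s - x i)))"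
    using \<open>a < b\<close> by (intro mult_left_mono) auto
  also have "\<dots> = (-1) ^ (m + k) * (poly p b - poly p a)"
  proof -
    have "poly p b - poly p a = (b - a) * (real (Suc m) * (\<Prod>i<m. s - x i))"
      using c s(3) by (simp add: crit_def poly_lin_prod)
    then show ?thesis by (simp only: mult_ac)
  qed
  finally show ?thesis by simp
qed simp

text \<open>The intermediate value theorem between the ends of the branch; where an end is missing,
  \<open>branch_growth\<close> supplies a point whose value lies beyond \<open>v\<close>.\<close>

lemma branch_surj:
  assumes c: "crit m x p" and "k \<le> m"
    and lo: "k > 0 \<Longrightarrow> 0 < (-1) ^ (m + k) * (v - poly p (x (k - 1)))"
    and hi: "k < m \<Longrightarrow> 0 < (-1) ^ (m + k) * (poly p (x k) - v)"
  shows "\<exists>t. (k > 0 \<longrightarrow> x (k - 1) < t) \<and> (k < m \<longrightarrow> t < x k) \<and> poly p t = v"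
proof -
  define s where "s = ((-1) ^ (m + k) :: real)"
  have s: "s = 1 \<or> s = -1" unfolding s_def by (rule neg_one_cases)
  define B where "B = (if k < m then x k - 1 else 0)"
  obtain a where a: "k > 0 \<longrightarrow> x (k - 1) = a" "k = 0 \<longrightarrow> a < B" "0 < s * (v - poly p a)"
  proof (cases "k > 0")
    case True then show thesis using that[of "x (k-1)"] lo by (auto simp: s_def)
  next
    case False
    \<comment> \<open>With slope at least 1 in absolute value, this distance from \<open>B\<close>
      is enough for the value to pass \<open>v\<close>.\<close>
    define a where "a = B - \<bar>poly p B - v\<bar> - 1"
    have "B - a \<le> s * (poly p B - poly p a)"
      unfolding s_def
      by (rule branch_growth[OF c \<open>k \<le> m\<close>])
        (use False crit_le[OF c, of 0] in \<open>force simp: a_def B_def\<close>)+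
    then have "0 < s * (v - poly p a)" using s by (auto simp: a_def abs_if split: if_splits)
    then show thesis using that[of a] False by (auto simp: a_def)
  qed
  define A where "A = (if k > 0 then x (k - 1) + 1 else 0)"
  obtain b where b: "k < m \<longrightarrow> x k = b" "k = m \<longrightarrow> A < b" "0 < s * (poly p b - v)"
  proof (cases "k < m")
    case True then show thesis using that[of "x k"] hi by (auto simp: s_def)
  next
    case False
    define b where "b = A + \<bar>poly p A - v\<bar> + 1"
    have "x i \<le> x (k - 1)" if "i < k" for i using that crit_le[OF c, of i "k - 1"] \<open>k \<le> m\<close> by auto
    then have "b - A \<le> s * (poly p b - poly p A)"
      unfolding s_def
      by (intro branch_growth[OF c \<open>k \<le> m\<close>])
        (use False in \<open>force simp: b_def A_def\<close>)+
    then have "0 < s * (poly p b - v)" using s by (auto simp: b_def abs_if split: if_splits)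
    then show thesis using that[of b] False \<open>k \<le> m\<close> by (auto simp: b_def)
  qed
  have "a < b"
    using a b crit_less[OF c, of "k - 1" k] \<open>k \<le> m\<close> by (cases "k = 0"; cases "k < m") (auto simp: A_def B_def)
  moreover have "continuous_on S (poly p)" for S by (rule continuous_on_poly) (rule continuous_on_id)
  ultimately obtain t where t: "a \<le> t" "t \<le> b" "poly p t = v"
    using s a(3) b(3) IVT'[of "poly p" a v b] IVT2'[of "poly p" b v a] by auto
  then have "t \<noteq> a" "t \<noteq> b" using a(3) b(3) by auto
  then show ?thesis using t a(1) b(1) by (intro exI[of _ t]) auto
qed

lemma branch_inj:
  assumes c: "crit m x p" and "k \<le> m" "poly p t = poly p t'"
    and "k > 0 \<Longrightarrow> x (k - 1) \<le> t" "k < m \<Longrightarrow> t \<le> x k" "k > 0 \<Longrightarrow> x (k - 1) \<le> t'" "k < m \<Longrightarrow> t' \<le> x k"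
  shows "t = t'"
  using branch_mono[OF c \<open>k \<le> m\<close>, of t t'] branch_mono[OF c \<open>k \<le> m\<close>, of t' t] assms
  by (cases t t' rule: linorder_cases) auto

subsection \<open>Equal critical oscillation determines the polynomial\<close>

text \<open>Lagrange interpolation at \<open>n + 1\<close> points expresses the coefficient of
  degree \<open>n\<close>, which is zero, as a sum of quotients \<open>r (t i) / l i (t i)\<close>.
  Alternation makes all of them nonnegative, so each vanishes. This handles weak signs, where zeros
  at the nodes would spoil a direct count of sign changes.\<close>

lemma alternation_imp_zero:
  fixes r :: "real poly"
  assumes deg: "degree r < n" and t: "\<And>i j. i < j \<Longrightarrow> j \<le> n \<Longrightarrow> t i < t j"
    and alt: "\<And>i. i \<le> n \<Longrightarrow> 0 \<le> (-1) ^ (n + i) * poly r (t i)"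
  shows "r = 0"
proof -
  \<comment> \<open>\<open>sk i\<close> enumerates the nodes other than \<open>i\<close>, so
    \<open>l i\<close> is the Lagrange basis polynomial before normalisation.\<close>
  define sk where "sk i j = (if j < i then j else Suc j)" for i j :: nat
  define l where "l i = lin_prod n (\<lambda>j. t (sk i j))" for i
  have l0: "poly (l i) (t j) = 0" if "j \<noteq> i" "j \<le> n" "i \<le> n" for i j
  proof -
    have "sk i (if j < i then j else j - 1) = j" "(if j < i then j else j - 1) < n"
      using that by (auto simp: sk_def)
    then show ?thesis unfolding l_def poly_lin_prod by (metis diff_self finite_lessThan lessThan_iff prod_zero)
  qed
  have lpos: "0 < (-1) ^ (n + i) * poly (l i) (t i)" if "i \<le> n" for i
    unfolding l_def poly_lin_prod
    by (rule sign_prod) (use that in \<open>auto simp: sk_def intro!: t\<close>)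
  have inj: "inj_on t {..n}"
    by (rule linorder_inj_onI) (use t in \<open>fastforce simp: less_le\<close>)+
  have zero: "q = 0" if "degree q < Suc n" "\<And>i. i \<le> n \<Longrightarrow> poly q (t i) = 0" for q
  proof (rule ccontr)
    assume "q \<noteq> 0"
    have "Suc n = card (t ` {..n})" using card_image[OF inj] by simp
    also have "\<dots> \<le> card {z. poly q z = 0}"
      using \<open>q \<noteq> 0\<close> that by (intro card_mono poly_roots_finite) auto
    also have "\<dots> \<le> degree q" using \<open>q \<noteq> 0\<close> by (rule card_poly_roots_bound)
    finally show False using that by simp
  qed
  define c where "c i = poly r (t i) / poly (l i) (t i)" for i
  have "r - (\<Sum>i\<le>n. smult (c i) (l i)) = 0"
  proof (rule zero)
    have "degree (smult (c i) (l i)) \<le> n" for i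
      using degree_smult_le degree_lin_prod l_def by metis
    then have "degree (\<Sum>i\<le>n. smult (c i) (l i)) \<le> n" by (intro degree_sum_le) auto
    then show "degree (r - (\<Sum>i\<le>n. smult (c i) (l i))) < Suc n"
      using deg by (intro le_imp_less_Suc degree_diff_le) auto
    fix j assume j: "j \<le> n"
    have "(\<Sum>i\<le>n. c i * poly (l i) (t j)) = (\<Sum>i\<le>n. if i = j then c i * poly (l i) (t j) else 0)"
      using l0 j by (intro sum.cong) auto
    also have "\<dots> = poly r (t j)"
    proof -
      have "poly (l j) (t j) \<noteq> 0" using lpos[OF j] by auto
      then show ?thesis using j by (simp add: c_def)
    qed
    finally show "poly (r - (\<Sum>i\<le>n. smult (c i) (l i))) (t j) = 0" by (simp add: poly_sum)
  qed
  \<comment> \<open>Each \<open>l i\<close> is monic of degree \<open>n\<close>.\<close>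
  then have "coeff r n = (\<Sum>i\<le>n. c i)"
    using lead_coeff_lin_prod by (simp add: coeff_sum l_def)
  then have s0: "(\<Sum>i\<le>n. c i) = 0" using deg by (simp add: coeff_eq_0)
  have cnn: "0 \<le> c i" if "i \<le> n" for i
  proof -
    have "0 \<le> ((-1) ^ (n + i) * poly r (t i)) / ((-1) ^ (n + i) * poly (l i) (t i))"
      using alt lpos that by (intro divide_nonneg_pos) auto
    then show ?thesis by (simp add: c_def)
  qed
  have "c i = 0" if "i \<le> n" for i
    using s0 cnn that sum_nonneg_eq_0_iff[of "{..n}" c] by auto
  then have "poly r (t i) = 0" if "i \<le> n" for i using lpos[OF that] that by (force simp: c_def)
  then show ?thesis using zero deg by simp
qed

text \<open>The values of a Chebyshev polynomial rescaled to the interval from 0 to 1. Critical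
  point \<open>i\<close> is node \<open>Suc i\<close>, so that maxima receive the value 1; nodes
  \<open>0\<close> and \<open>Suc m\<close> lie on the outer branches.\<close>

definition wave :: "nat \<Rightarrow> nat \<Rightarrow> real" where
  "wave m j = (if even (m + j) then 0 else 1)"

text \<open>The critical points are completed by one point on each outer branch where the next value
  of the wave is reached. Between consecutive nodes the polynomial is monotone, so it stays between
  0 and 1.\<close>

lemma oscillation:
  assumes c: "crit m x p" and val: "\<And>i. i < m \<Longrightarrow> poly p (x i) = wave m (Suc i)" and "m > 0"
  obtains t where "\<And>i j. i < j \<Longrightarrow> j \<le> Suc m \<Longrightarrow> t i < t j" "\<And>i. i \<le> Suc m \<Longrightarrow> poly p (t i) = wave m i"
    "\<And>s. t 0 \<le> s \<Longrightarrow> s \<le> t (Suc m) \<Longrightarrow> 0 \<le> poly p s \<and> poly p s \<le> 1"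
proof -
  obtain a where a: "a < x 0" "poly p a = wave m 0"
    using branch_surj[OF c, of 0 "wave m 0"] val[of 0] \<open>m > 0\<close> by (cases "even m") (auto simp: wave_def)
  obtain b where b: "x (m - 1) < b" "poly p b = wave m (Suc m)"
    using branch_surj[OF c, of m "wave m (Suc m)"] val[of "m - 1"] \<open>m > 0\<close> by (cases "even m") (auto simp: wave_def)
  define t where "t j = (if j = 0 then a else if j \<le> m then x (j - 1) else b)" for j
  have st: "t j < t (Suc j)" if "j \<le> m" for j
    using that a b \<open>m > 0\<close> crit_less[OF c, of "j - 1" j] by (cases "j = 0"; cases "j = m") (auto simp: t_def)
  have mono: "t i < t j" if "i < j" "j \<le> Suc m" for i j
    using that by (induction j) (auto simp: less_Suc_eq intro: st less_trans)
  have v: "poly p (t i) = wave m i" if "i \<le> Suc m" for i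
    using that a b val[of "i - 1"] \<open>m > 0\<close> by (auto simp: t_def le_Suc_eq not_le)
  have bd: "0 \<le> poly p s \<and> poly p s \<le> 1" if s: "t 0 \<le> s" "s \<le> t (Suc m)" for s
  proof -
    have "\<exists>k\<le>j. t k \<le> s \<and> s \<le> t (Suc k)" if "s \<le> t (Suc j)" for j
      using that s by (induction j) (auto, metis le_SucI linear nle_le)
    then obtain k where k: "k \<le> m" "t k \<le> s" "s \<le> t (Suc k)" using s by blast
    have lo: "k > 0 \<Longrightarrow> x (k - 1) \<le> t k" and hi: "k < m \<Longrightarrow> t (Suc k) \<le> x k" using k by (auto simp: t_def)
    have lo': "k > 0 \<Longrightarrow> x (k - 1) \<le> s" and hi': "k < m \<Longrightarrow> s \<le> x k" using lo hi k by auto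
    have "0 \<le> (-1) ^ (m + k) * (poly p s - poly p (t k))"
      using branch_mono[OF c k(1), of "t k" s] k lo hi' by (cases "s = t k") auto
    moreover have "0 \<le> (-1) ^ (m + k) * (poly p (t (Suc k)) - poly p s)"
      using branch_mono[OF c k(1), of s "t (Suc k)"] k lo' hi by (cases "s = t (Suc k)") auto
    ultimately show ?thesis using v[of k] v[of "Suc k"] k by (auto simp: wave_def split: if_splits)
  qed
  show thesis by (rule that[OF mono v bd])
qed

lemma crit_shift:
  assumes "crit m y q"
  shows "crit m (\<lambda>i. y i - h) (pcompose q [:h, 1:])"
proof -
  have "pcompose (lin_prod m y) [:h, 1:] = lin_prod m (\<lambda>i. y i - h)"
    by (simp add: lin_prod_def pcompose_prod pcompose_pCons)
  then show ?thesis
    using assms by (auto simp: crit_def pderiv_pcompose pcompose_smult pderiv_pCons)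
qed

text \<open>The polynomial with the shorter interval of oscillation alternates between 0 and 1 while
  a translate of the other stays between 0 and 1 there. Their difference alternates weakly at
  \<open>m + 2\<close> nodes and, both being monic, has degree at most \<open>m\<close>.\<close>

lemma wave_unique_aux:
  assumes c: "crit m x p" and d: "crit m y q" and "m > 0"
    and vx: "\<And>i. i < m \<Longrightarrow> poly p (x i) = wave m (Suc i)"
    and vy: "\<And>i. i < m \<Longrightarrow> poly q (y i) = wave m (Suc i)"
    and lc: "degree p = Suc m" "degree q = Suc m" "coeff p (Suc m) = 1" "coeff q (Suc m) = 1"
  shows "\<exists>h. \<forall>i<m. x i = y i - h"
proof -
  obtain t where t: "\<And>i j. i < j \<Longrightarrow> j \<le> Suc m \<Longrightarrow> t i < t j" "\<And>i. i \<le> Suc m \<Longrightarrow> poly p (t i) = wave m i"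
    "\<And>s. t 0 \<le> s \<Longrightarrow> s \<le> t (Suc m) \<Longrightarrow> 0 \<le> poly p s \<and> poly p s \<le> 1"
    using oscillation[OF c vx \<open>m > 0\<close>] by blast
  obtain u where u: "\<And>i j. i < j \<Longrightarrow> j \<le> Suc m \<Longrightarrow> u i < u j" "\<And>i. i \<le> Suc m \<Longrightarrow> poly q (u i) = wave m i"
    "\<And>s. u 0 \<le> s \<Longrightarrow> s \<le> u (Suc m) \<Longrightarrow> 0 \<le> poly q s \<and> poly q s \<le> 1"
    using oscillation[OF d vy \<open>m > 0\<close>] by blast
  \<comment> \<open>The claim is asymmetric in the interval lengths and is used below for both
    orders of the two polynomials.\<close>
  have main: "\<exists>h. \<forall>i<m. x i = y i - h"
    if c: "crit m x p" and d: "crit m y q" and lc: "degree p = Suc m" "degree q = Suc m" "coeff p (Suc m) = 1" "coeff q (Suc m) = 1"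
      and t: "\<And>i j. i < j \<Longrightarrow> j \<le> Suc m \<Longrightarrow> t i < t j" "\<And>i. i \<le> Suc m \<Longrightarrow> poly p (t i) = wave m i"
      and u: "\<And>s. u 0 \<le> s \<Longrightarrow> s \<le> u (Suc m) \<Longrightarrow> 0 \<le> poly q s \<and> poly q s \<le> 1"
      and len: "t (Suc m) - t 0 \<le> u (Suc m) - u 0" for x y p q and t u :: "nat \<Rightarrow> real"
  proof -
    \<comment> \<open>Aligning the left ends places the shorter interval inside the longer
      one.\<close>
    define h where "h = u 0 - t 0"
    define q' where "q' = pcompose q [:h, 1:]"
    have dq: "degree q' = Suc m" by (simp add: q'_def lc degree_pcompose)
    have lq: "coeff q' (Suc m) = 1"
      using lead_coeff_comp[of "[:h, 1:]" q] lc dq by (simp add: q'_def)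
    have "p - q' = 0"
    proof (rule alternation_imp_zero[where n = "Suc m" and t = t])
      have "coeff (p - q') j = 0" if "j \<ge> Suc m" for j
        using that lc dq lq by (cases "j = Suc m") (auto simp: coeff_eq_0)
      then show "degree (p - q') < Suc m" by (metis leI leading_coeff_0_iff degree_0 zero_less_Suc)
      fix i assume i: "i \<le> Suc m"
      have "t 0 \<le> t i" "t i \<le> t (Suc m)" using t(1)[of 0 i] t(1)[of i "Suc m"] i
        by (cases "i = 0"; cases "i = Suc m"; simp add: less_imp_le)+
      then have "0 \<le> poly q' (t i) \<and> poly q' (t i) \<le> 1"
        using u[of "t i + h"] len by (simp add: q'_def poly_pcompose h_def add.commute)
      then show "0 \<le> (-1) ^ (Suc m + i) * poly (p - q') (t i)"
        using t(2)[OF i] by (auto simp: wave_def)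
    qed (use t in auto)
    then have "crit m (\<lambda>i. y i - h) p" using crit_shift[OF d, of h] by (simp add: q'_def)
    then show ?thesis using crit_unique[OF c] by blast
  qed
  show ?thesis
  proof (cases "t (Suc m) - t 0 \<le> u (Suc m) - u 0")
    case True
    show ?thesis by (rule main[OF c d lc t(1,2) u(3) True])
  next
    case False
    then have False': "u (Suc m) - u 0 \<le> t (Suc m) - t 0" by simp
    obtain h where "\<forall>i<m. y i = x i - h"
      using main[OF d c lc(2,1,4,3) u(1,2) t(3) False'] by blast
    then have "\<forall>i<m. x i = y i - (- h)" by simp
    then show ?thesis by blast
  qed
qed

lemma degree_monic_crit_poly: "degree (crit_poly m x) = Suc m" "coeff (crit_poly m x) (Suc m) = 1"
proof -
  show 1: "coeff (crit_poly m x) (Suc m) = 1" by (simp add: coeff_crit_poly lead_coeff_lin_prod)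
  have "degree (crit_poly m x) \<le> Suc m" by (rule degree_le) (simp add: coeff_crit_poly)
  moreover have "Suc m \<le> degree (crit_poly m x)" by (rule le_degree) (simp add: 1)
  ultimately show "degree (crit_poly m x) = Suc m" by simp
qed

text \<open>Unit height differences become the wave once the first critical value is adjusted by a
  constant. The translation left open by \<open>wave_unique_aux\<close> is excluded by
  centring.\<close>

lemma equal_oscillation_unique:
  assumes x: "\<And>i j. i < j \<Longrightarrow> j < m \<Longrightarrow> x i < x j" and y: "\<And>i j. i < j \<Longrightarrow> j < m \<Longrightarrow> y i < y j"
    and sx: "(\<Sum>i<m. x i) = 0" and sy: "(\<Sum>i<m. y i) = 0"
    and vx: "\<And>i. Suc i < m \<Longrightarrow> (-1) ^ (m + Suc i) * (poly (crit_poly m x) (x (Suc i)) - poly (crit_poly m x) (x i)) = 1"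
    and vy: "\<And>i. Suc i < m \<Longrightarrow> (-1) ^ (m + Suc i) * (poly (crit_poly m y) (y (Suc i)) - poly (crit_poly m y) (y i)) = 1"
    and "i < m"
  shows "x i = y i"
proof -
  define P where "P x = crit_poly m x + [:wave m 1 - poly (crit_poly m x) (x 0):]" for x
  have c: "crit m x (P x)" if "\<And>i j. i < j \<Longrightarrow> j < m \<Longrightarrow> x i < x j" for x
    using that crit_crit_poly[of m x] by (simp add: crit_def P_def pderiv_add pderiv_pCons)
  have lc: "degree (P x) = Suc m" "coeff (P x) (Suc m) = 1" for x
    using degree_monic_crit_poly[of m x] by (simp_all add: P_def degree_add_eq_left)
  have v: "poly (P x) (x i) = wave m (Suc i)"
    if "\<And>i. Suc i < m \<Longrightarrow> (-1) ^ (m + Suc i) * (poly (crit_poly m x) (x (Suc i)) - poly (crit_poly m x) (x i)) = 1" "i < m" for i x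
    using that(2)
  proof (induction i)
    case 0 then show ?case by (simp add: P_def)
  next
    case (Suc i)
    then have "poly (P x) (x i) = wave m (Suc i)" by simp
    moreover have "(-1) ^ (m + Suc i) * (poly (P x) (x (Suc i)) - poly (P x) (x i)) = 1"
      using that(1)[OF Suc.prems] by (simp add: P_def)
    ultimately show ?case by (cases "even (m + i)") (auto simp: wave_def)
  qed
  obtain h where h: "\<forall>i<m. x i = y i - h"
    using wave_unique_aux[OF c[OF x] c[OF y] _ v[OF vx] v[OF vy]] lc \<open>i < m\<close> by force
  then have "(\<Sum>i<m. x i) = (\<Sum>i<m. y i) - real m * h" by (simp add: sum_subtractf)
  then have "h = 0" using sx sy \<open>i < m\<close> by simp
  then show ?thesis using h \<open>i < m\<close> by simp
qed

subsection \<open>Critical points as functions of critical values\<close>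

lemma Euclidean_space_eq: "Euclidean_space d = top_of_set {x. \<forall>i\<ge>d. x i = 0}"
  by (simp add: Euclidean_space_def euclidean_product_topology)

text \<open>A proper local injection is a covering, so the number of preimages is locally constant;
  invariance of domain supplies the local surjectivity.\<close>

lemma proper_locally_injective_imp_bij:
  fixes f :: "(nat \<Rightarrow> real) \<Rightarrow> (nat \<Rightarrow> real)"
  assumes X: "openin (Euclidean_space d) X" "connected X"
    and cont: "continuous_on X f" and into: "f ` X \<subseteq> X"
    and locinj: "\<And>y. y \<in> X \<Longrightarrow> \<exists>V. openin (top_of_set X) V \<and> y \<in> V \<and> inj_on f V"
    and proper: "\<And>y a. (\<And>k::nat. y k \<in> X) \<Longrightarrow> (\<lambda>k. f (y k)) \<longlonglongrightarrow> a \<Longrightarrow> a \<in> X \<Longrightarrow>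
        \<exists>r l. strict_mono (r::nat \<Rightarrow> nat) \<and> l \<in> X \<and> (y \<circ> r) \<longlonglongrightarrow> l"
    and one: "a0 \<in> X" "\<And>y y'. y \<in> X \<Longrightarrow> y' \<in> X \<Longrightarrow> f y = a0 \<Longrightarrow> f y' = a0 \<Longrightarrow> y = y'"
  shows "inj_on f X" "f ` X = X" "continuous_on X (inv_into X f)"
proof -
  \<comment> \<open>Domain and target are open in the same coordinate space, so invariance of domain
    makes \<open>f\<close> open wherever it is injective.\<close>
  have img: "openin (top_of_set X) (f ` V)" if V: "openin (top_of_set X) V" "inj_on f V" for V
  proof -
    have VX: "V \<subseteq> X" using V(1) openin_imp_subset by blast
    have oV: "openin (Euclidean_space d) V"
      using V X openin_trans unfolding Euclidean_space_eq by blast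
    have XE: "X \<subseteq> {x. \<forall>i\<ge>d. x i = 0}"
      using X(1) openin_imp_subset unfolding Euclidean_space_eq by blast
    have "continuous_map (subtopology (Euclidean_space d) V) (Euclidean_space d) f"
    proof -
      have "subtopology (Euclidean_space d) V = top_of_set V"
        using VX XE by (simp add: Euclidean_space_eq subtopology_subtopology inf.absorb2)
      then show ?thesis
        using continuous_on_subset[OF cont VX] into VX XE
        by (auto simp: Euclidean_space_eq continuous_map_in_subtopology)
    qed
    with oV have o: "openin (Euclidean_space d) (f ` V)"
      using V(2) by (rule invariance_of_domain_Euclidean_space)
    have "f ` V \<subseteq> X" using VX into by blast
    then show ?thesis
      by (rule openin_subset_trans[OF o[unfolded Euclidean_space_eq] _ XE])
  qed
  have lim: "f l = a" if "\<And>k. y k \<in> X" "(\<lambda>k. f (y k)) \<longlonglongrightarrow> a" "strict_mono r" "l \<in> X" "(y \<circ> r) \<longlonglongrightarrow> l"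
    for y a r l
  proof -
    have "(\<lambda>k. f ((y \<circ> r) k)) \<longlonglongrightarrow> f l"
      by (rule continuous_on_tendsto_compose[OF cont that(5,4)]) (simp add: that(1))
    moreover have "(\<lambda>k. f ((y \<circ> r) k)) \<longlonglongrightarrow> a"
      using LIMSEQ_subseq_LIMSEQ[OF that(2,3)] by (simp add: o_def)
    ultimately show ?thesis by (rule LIMSEQ_unique)
  qed
  have closedI: "closedin (top_of_set X) T"
    if "T \<subseteq> X" "\<And>a s. (\<And>k::nat. s k \<in> T) \<Longrightarrow> s \<longlonglongrightarrow> a \<Longrightarrow> a \<in> X \<Longrightarrow> a \<in> T" for T
  proof -
    have "x \<in> T" if "x \<in> X" "x \<in> closure T" for x
    proof -
      obtain s where "\<forall>n. s n \<in> T" "s \<longlonglongrightarrow> x"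
        using \<open>x \<in> closure T\<close> unfolding closure_sequential by blast
      then show ?thesis using \<open>x \<in> X\<close> \<open>\<And>a s. (\<And>k::nat. s k \<in> T) \<Longrightarrow> s \<longlonglongrightarrow> a \<Longrightarrow> a \<in> X \<Longrightarrow> a \<in> T\<close> by blast
    qed
    then have "T = X \<inter> closure T" using \<open>T \<subseteq> X\<close> closure_subset[of T] by blast
    then show ?thesis unfolding closedin_closed using closed_closure by blast
  qed
  \<comment> \<open>The values with more than one preimage. This set is open because two preimages
    have disjoint neighbourhoods with open images, and closed by properness; it misses
    \<open>a0\<close>, so connectedness makes it empty.\<close>
  define N2 where "N2 = {a \<in> X. \<exists>y\<in>X. \<exists>y'\<in>X. y \<noteq> y' \<and> f y = a \<and> f y' = a}"
  have "openin (top_of_set X) N2"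
  proof (subst openin_subopen, intro ballI)
    fix a assume "a \<in> N2"
    then obtain y y' where y: "y \<in> X" "y' \<in> X" "y \<noteq> y'" "f y = a" "f y' = a" by (auto simp: N2_def)
    obtain V where V: "openin (top_of_set X) V" "y \<in> V" "inj_on f V" using locinj y by blast
    obtain V' where V': "openin (top_of_set X) V'" "y' \<in> V'" "inj_on f V'" using locinj y by blast
    obtain U U' where U: "open U" "open U'" "y \<in> U" "y' \<in> U'" "U \<inter> U' = {}"
      using hausdorff[OF \<open>y \<noteq> y'\<close>] by blast
    have "openin (top_of_set X) (f ` (V \<inter> U))" "openin (top_of_set X) (f ` (V' \<inter> U'))"
      by (rule img[OF openin_Int_open[OF V(1) U(1)] inj_on_subset[OF V(3)]], simp)
        (rule img[OF openin_Int_open[OF V'(1) U(2)] inj_on_subset[OF V'(3)]], simp)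
    then have "openin (top_of_set X) (f ` (V \<inter> U) \<inter> f ` (V' \<inter> U'))" by blast
    moreover have "a \<in> f ` (V \<inter> U) \<inter> f ` (V' \<inter> U')"
    proof -
      have "f y \<in> f ` (V \<inter> U)" by (rule imageI) (simp add: V(2) U(3))
      moreover have "f y' \<in> f ` (V' \<inter> U')" by (rule imageI) (simp add: V'(2) U(4))
      ultimately show ?thesis using y(4,5) by simp
    qed
    moreover have "f ` (V \<inter> U) \<inter> f ` (V' \<inter> U') \<subseteq> N2"
    proof
      fix b assume "b \<in> f ` (V \<inter> U) \<inter> f ` (V' \<inter> U')"
      then obtain z z' where z: "z \<in> V \<inter> U" "z' \<in> V' \<inter> U'" "f z = b" "f z' = b"
        by (metis IntD1 IntD2 imageE)
      have "V \<subseteq> X" "V' \<subseteq> X" using openin_imp_subset[OF V(1)] openin_imp_subset[OF V'(1)] .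
      then have zX: "z \<in> X" "z' \<in> X" using z by auto
      moreover have "b \<in> X" using into imageI[OF zX(1), of f] z(3) by auto
      moreover have "z \<noteq> z'" using z(1,2) U(5) by auto
      ultimately show "b \<in> N2" using z(3,4) unfolding N2_def by blast
    qed
    ultimately show "\<exists>T. openin (top_of_set X) T \<and> a \<in> T \<and> T \<subseteq> N2" by blast
  qed
  moreover have "closedin (top_of_set X) N2"
  proof (rule closedI)
    fix s a assume s: "\<And>k::nat. s k \<in> N2" "s \<longlonglongrightarrow> a" "a \<in> X"
    then have "\<forall>k. \<exists>y y'. y \<in> X \<and> y' \<in> X \<and> y \<noteq> y' \<and> f y = s k \<and> f y' = s k"
      unfolding N2_def by blast
    then obtain y y' where y: "\<And>k. y k \<in> X" "\<And>k. y' k \<in> X" "\<And>k. y k \<noteq> y' k" "\<And>k. f (y k) = s k" "\<And>k. f (y' k) = s k"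
      by metis
    obtain r l where r: "strict_mono r" "l \<in> X" "(y \<circ> r) \<longlonglongrightarrow> l"
      using proper[of y a] y s by auto
    have "(\<lambda>k. f ((y' \<circ> r) k)) \<longlonglongrightarrow> a"
      using LIMSEQ_subseq_LIMSEQ[OF s(2) r(1)] y by (simp add: o_def)
    then obtain q l' where q: "strict_mono q" "l' \<in> X" "((y' \<circ> r) \<circ> q) \<longlonglongrightarrow> l'"
      using proper[of "y' \<circ> r" a] y s by auto
    have f1: "f l = a" by (rule lim[OF y(1) _ r]) (simp add: y s)
    have f2: "f l' = a" by (rule lim[OF y(2) _ strict_mono_o[OF r(1) q(1)] q(2)]) (use q in \<open>simp_all add: y s o_assoc\<close>)
    \<comment> \<open>Otherwise two distinct preimages of one value would eventually lie in a
      neighbourhood on which \<open>f\<close> is injective.\<close>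
    have "l \<noteq> l'"
    proof
      assume "l = l'"
      obtain V where V: "openin (top_of_set X) V" "l \<in> V" "inj_on f V" using locinj r by blast
      obtain T where T: "open T" "V = X \<inter> T" using V by (auto simp: openin_open)
      have "((y \<circ> r) \<circ> q) \<longlonglongrightarrow> l" by (rule LIMSEQ_subseq_LIMSEQ[OF r(3) q(1)])
      then have "\<forall>\<^sub>F k in sequentially. ((y \<circ> r) \<circ> q) k \<in> T" using T V topological_tendstoD by blast
      moreover have "\<forall>\<^sub>F k in sequentially. ((y' \<circ> r) \<circ> q) k \<in> T"
        using T V \<open>l = l'\<close> topological_tendstoD[OF q(3)] by blast
      ultimately have "\<forall>\<^sub>F k in sequentially. ((y \<circ> r) \<circ> q) k \<in> T \<and> ((y' \<circ> r) \<circ> q) k \<in> T"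
        by (rule eventually_conj)
      then obtain k where "y (r (q k)) \<in> T" "y' (r (q k)) \<in> T"
        using eventually_happens'[OF sequentially_bot] by (auto simp: o_def)
      then show False
        using inj_onD[OF V(3), of "y (r (q k))" "y' (r (q k))"] y(3)[of "r (q k)"]
        by (simp add: y(1,2,4,5) T(2))
    qed
    then show "a \<in> N2" using f1 f2 s(3) r(2) q(2) unfolding N2_def by blast
  qed (auto simp: N2_def)
  ultimately have "N2 = {} \<or> N2 = X"
    by (intro connected_clopen[THEN iffD1, OF X(2), rule_format] conjI)
  moreover have "a0 \<notin> N2" using one(2) unfolding N2_def by blast
  ultimately have "N2 = {}" using one by blast
  then show inj: "inj_on f X" using into by (auto simp: N2_def inj_on_def)
  \<comment> \<open>The same connectedness argument for surjectivity: the image is open by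
    \<open>img\<close> and closed by properness.\<close>
  have "openin (top_of_set X) (f ` X)" by (rule img[OF _ inj]) simp
  moreover have "closedin (top_of_set X) (f ` X)"
  proof (rule closedI[OF into])
    fix s a assume s: "\<And>k::nat. s k \<in> f ` X" "s \<longlonglongrightarrow> a" "a \<in> X"
    define y where "y k = inv_into X f (s k)" for k
    have y: "y k \<in> X" "f (y k) = s k" for k
      using s(1) by (simp_all add: y_def inv_into_into f_inv_into_f)
    obtain r l where r: "strict_mono r" "l \<in> X" "(y \<circ> r) \<longlonglongrightarrow> l"
      using proper[of y a] y s by auto
    have "f l = a" by (rule lim[OF y(1) _ r]) (simp add: y s)
    then show "a \<in> f ` X" using r(2) by (rule image_eqI[OF sym])
  qed
  ultimately have "f ` X = {} \<or> f ` X = X"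
    by (intro connected_clopen[THEN iffD1, OF X(2), rule_format] conjI)
  then show surj: "f ` X = X" using one(1) by auto
  show "continuous_on X (inv_into X f)"
  proof (rule continuous_on_inverse_open_map[OF cont surj])
    show "inv_into X f (f x) = x" if "x \<in> X" for x using inj that by simp
    show "openin (top_of_set X) (f ` U)" if "openin (top_of_set X) U" for U
      by (rule img[OF that inj_on_subset[OF inj openin_imp_subset[OF that]]])
  qed
qed

section \<open>Gaps of critical points and differences of critical values\<close>

definition orthant :: "nat \<Rightarrow> (nat \<Rightarrow> real) set" where
  "orthant d = {y. (\<forall>i<d. 0 < y i) \<and> (\<forall>i\<ge>d. y i = 0)}"

lemma open_all_less:
  fixes f :: "nat \<Rightarrow> 'a::topological_space \<Rightarrow> real"
  assumes "\<And>i. i < d \<Longrightarrow> continuous_on UNIV (f i)"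
  shows "open {y. \<forall>i<d. f i y < c i}"
proof -
  have "{y. \<forall>i<d. f i y < c i} = (\<Inter>i\<in>{..<d}. {y. f i y < c i})" by auto
  moreover have "open \<dots>"
    using assms by (intro open_INT ballI open_Collect_less) auto
  ultimately show ?thesis by simp
qed

lemma openin_orthant: "openin (Euclidean_space d) (orthant d)"
proof -
  have "open {y::nat \<Rightarrow> real. \<forall>i<d. - y i < 0}"
    by (rule open_all_less) (intro continuous_intros continuous_on_product_coordinates)
  then have "openin (top_of_set {x::nat \<Rightarrow> real. \<forall>i\<ge>d. x i = 0}) ({x. \<forall>i\<ge>d. x i = 0} \<inter> {y. \<forall>i<d. - y i < 0})"
    by (rule openin_open_Int)
  then show ?thesis unfolding Euclidean_space_eq by (simp add: orthant_def Collect_conj_eq Int_commute)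
qed

lemma connected_orthant: "connected (orthant d)"
proof (rule path_connected_imp_connected, unfold path_connected_def, intro ballI)
  fix x y assume xy: "x \<in> orthant d" "y \<in> orthant d"
  define g where "g = (\<lambda>t::real. \<lambda>i::nat. (1 - t) * x i + t * y i)"
  have "continuous_on {0..1} g" unfolding g_def by (intro continuous_intros)
  moreover have "g t \<in> orthant d" if "0 \<le> t" "t \<le> 1" for t
  proof -
    have "0 < (1 - t) * x i + t * y i" if "i < d" for i
    proof (cases "t = 0")
      case False
      then show ?thesis using that xy \<open>0 \<le> t\<close> \<open>t \<le> 1\<close> by (intro add_nonneg_pos) (auto simp: orthant_def less_imp_le)
    qed (use that xy in \<open>auto simp: orthant_def\<close>)
    then show ?thesis using xy by (auto simp: g_def orthant_def)
  qed
  ultimately show "\<exists>g. path g \<and> path_image g \<subseteq> orthant d \<and> pathstart g = x \<and> pathfinish g = y"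
    by (intro exI[of _ g]) (auto simp: path_def path_image_def pathstart_def pathfinish_def g_def)
qed

text \<open>Partial sums minus their mean: the centred tuple of \<open>d + 1\<close> points with
  successive gaps \<open>y\<close>.\<close>

definition gap_pts :: "nat \<Rightarrow> (nat \<Rightarrow> real) \<Rightarrow> nat \<Rightarrow> real" where
  "gap_pts d y i = (\<Sum>j<i. y j) - (\<Sum>k<Suc d. \<Sum>j<k. y j) / real (Suc d)"

text \<open>The sign is the orientation of branch \<open>Suc i\<close> for \<open>Suc d\<close>
  critical points, which makes the heights positive. Zeros beyond \<open>d\<close> keep source and
  target in the same coordinate space.\<close>

definition heights :: "nat \<Rightarrow> (nat \<Rightarrow> real) \<Rightarrow> nat \<Rightarrow> real" where
  "heights d y i = (if i < d then (-1) ^ (Suc d + Suc i) *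
     (poly (crit_poly (Suc d) (gap_pts d y)) (gap_pts d y (Suc i)) - poly (crit_poly (Suc d) (gap_pts d y)) (gap_pts d y i)) else 0)"

lemma gap_pts_Suc: "gap_pts d y (Suc i) = gap_pts d y i + y i"
  by (simp add: gap_pts_def)

lemma sum_gap_pts: "(\<Sum>i<Suc d. gap_pts d y i) = 0"
proof -
  have "(\<Sum>i<Suc d. gap_pts d y i) = (\<Sum>i<Suc d. \<Sum>j<i. y j) - real (Suc d) * ((\<Sum>k<Suc d. \<Sum>j<k. y j) / real (Suc d))"
    unfolding gap_pts_def sum_subtractf by simp
  then show ?thesis by simp
qed

lemma gap_pts_less:
  assumes "y \<in> orthant d" "i < j" "j < Suc d"
  shows "gap_pts d y i < gap_pts d y j"
  using assms(2,3)
proof (induction j)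
  case (Suc j)
  have "0 < y j" using assms(1) Suc.prems by (auto simp: orthant_def)
  then show ?case using Suc by (cases "i = j") (auto simp: gap_pts_Suc)
qed simp

lemma gap_pts_crit: "y \<in> orthant d \<Longrightarrow> crit (Suc d) (gap_pts d y) (crit_poly (Suc d) (gap_pts d y))"
  by (rule crit_crit_poly) (rule gap_pts_less)

lemma continuous_gap_pts: "continuous_on S (\<lambda>y. gap_pts d y i)"
  unfolding gap_pts_def
  by (intro continuous_intros continuous_on_subset[OF continuous_on_product_coordinates subset_UNIV]) simp

lemma continuous_heights: "continuous_on S (heights d)"
proof (rule continuous_on_coordinatewise_then_product)
  fix i show "continuous_on S (\<lambda>y. heights d y i)"
    unfolding heights_def
    by (cases "i < d") (auto simp only: if_True if_False intro!: continuous_intros continuous_poly_crit_poly continuous_gap_pts)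
qed

lemma heights_orthant:
  assumes y: "y \<in> orthant d"
  shows "heights d y \<in> orthant d"
proof -
  have "0 < heights d y i" if "i < d" for i
    using branch_mono[OF gap_pts_crit[OF y], of "Suc i" "gap_pts d y i" "gap_pts d y (Suc i)"]
      gap_pts_less[OF y, of i "Suc i"] that by (simp add: heights_def)
  then show ?thesis by (auto simp: orthant_def heights_def)
qed

text \<open>On the middle third of a gap all critical points are at distance at least
  \<open>g = y i / 3\<close>, so the rise there is at least \<open>g * g ^ Suc d\<close>, which is
  at least \<open>g\<close> once \<open>g > 1\<close>. Hence bounded heights bound the gaps.\<close>

lemma heights_lower:
  assumes y: "y \<in> orthant d" and "i < d"
  shows "y i / 3 \<le> 1 \<or> y i / 3 \<le> heights d y i"
proof -
  define x where "x = gap_pts d y"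
  define p where "p = crit_poly (Suc d) x"
  define s where "s = ((-1) ^ (Suc d + Suc i) :: real)"
  have c: "crit (Suc d) x p" unfolding x_def p_def by (rule gap_pts_crit[OF y])
  define g where "g = y i / 3"
  have g: "0 < g" "x (Suc i) = x i + 3 * g"
    using y \<open>i < d\<close> by (auto simp: orthant_def g_def x_def gap_pts_Suc)
  have mono: "0 < s * (poly p b - poly p a)" if "a < b" "x i \<le> a" "b \<le> x (Suc i)" for a b
    unfolding s_def using branch_mono[OF c, of "Suc i" a b] that \<open>i < d\<close> by simp
  have 1: "0 < s * (poly p (x i + g) - poly p (x i))"
    and 2: "0 < s * (poly p (x i + 2 * g) - poly p (x i + g))"
    and 3: "0 < s * (poly p (x (Suc i)) - poly p (x i + 2 * g))"
    using g by (auto intro!: mono)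
  obtain t where t: "x i + g < t" "t < x i + 2 * g"
    "poly p (x i + 2 * g) - poly p (x i + g) = (x i + 2 * g - (x i + g)) * poly (pderiv p) t"
    using poly_MVT[of "x i + g" "x i + 2 * g" p] g by auto
  have abs1: "\<bar>s\<bar> = 1" by (simp add: s_def power_abs)
  have "g ^ Suc d = (\<Prod>j<Suc d. g)" by simp
  also have "\<dots> \<le> (\<Prod>j<Suc d. \<bar>t - x j\<bar>)"
  proof (rule prod_mono)
    fix j assume j: "j \<in> {..<Suc d}"
    show "0 \<le> g \<and> g \<le> \<bar>t - x j\<bar>"
    proof (cases "j \<le> i")
      case True
      then have "x j \<le> x i" using crit_le[OF c, of j i] \<open>i < d\<close> by simp
      then show ?thesis using t g by auto
    next
      case False
      then have "x (Suc i) \<le> x j" using crit_le[OF c, of "Suc i" j] j by simp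
      then show ?thesis using t g by auto
    qed
  qed
  finally have pr: "g ^ Suc d \<le> (\<Prod>j<Suc d. \<bar>t - x j\<bar>)" .
  have "s * (poly p (x i + 2 * g) - poly p (x i + g)) = \<bar>poly p (x i + 2 * g) - poly p (x i + g)\<bar>"
    using 2 abs1 by (metis abs_mult abs_of_pos mult_1)
  also have "\<dots> = g * (real (Suc (Suc d)) * (\<Prod>j<Suc d. \<bar>t - x j\<bar>))"
    using t(3) g(1) c by (simp add: crit_def poly_lin_prod abs_mult abs_prod del: of_nat_Suc)
  also have "\<dots> \<ge> g * (1 * g ^ Suc d)"
    using pr g(1) by (intro mult_left_mono mult_mono) auto
  finally have "g * g ^ Suc d \<le> s * (poly p (x i + 2 * g) - poly p (x i + g))" by simp
  also have "\<dots> \<le> heights d y i"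
  proof -
    have "heights d y i = s * (poly p (x (Suc i)) - poly p (x i))"
      using \<open>i < d\<close> by (simp add: heights_def x_def[symmetric] p_def[symmetric] s_def)
    then show ?thesis using 1 3 by (simp add: algebra_simps)
  qed
  finally have A: "g * g ^ Suc d \<le> heights d y i" .
  show ?thesis
  proof (cases "g \<le> 1")
    case False
    then have "g * 1 \<le> g * g ^ Suc d" using g(1) by (intro mult_left_mono one_le_power) auto
    then show ?thesis using A by (simp add: g_def)
  qed (simp add: g_def)
qed

text \<open>All critical points lie in an interval of length \<open>d * B\<close>, which bounds the
  derivative and makes the height at most proportional to its gap. Hence heights away from zero keep
  the gaps away from zero.\<close>

lemma heights_upper:
  assumes y: "y \<in> orthant d" and "i < d" and L: "\<And>j. j < d \<Longrightarrow> y j \<le> B"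
  shows "heights d y i \<le> y i * (real (Suc (Suc d)) * (real d * B) ^ Suc d)"
proof -
  define x where "x = gap_pts d y"
  define p where "p = crit_poly (Suc d) x"
  define s where "s = ((-1) ^ (Suc d + Suc i) :: real)"
  have c: "crit (Suc d) x p" unfolding x_def p_def by (rule gap_pts_crit[OF y])
  have g: "0 < y i" "x (Suc i) = x i + y i"
    using y \<open>i < d\<close> by (auto simp: orthant_def x_def gap_pts_Suc)
  obtain t where t: "x i < t" "t < x (Suc i)"
    "poly p (x (Suc i)) - poly p (x i) = (x (Suc i) - x i) * poly (pderiv p) t"
    using poly_MVT[of "x i" "x (Suc i)" p] g by auto
  have span: "x d \<le> x 0 + real d * B"
  proof -
    have "x j \<le> x 0 + real j * B" if "j \<le> d" for j
      using that
    proof (induction j)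
      case (Suc j)
      then show ?case using L[of j] by (simp add: x_def gap_pts_Suc algebra_simps)
    qed simp
    then show ?thesis by simp
  qed
  have abs1: "\<bar>s\<bar> = 1" by (simp add: s_def power_abs)
  have "(\<Prod>j<Suc d. \<bar>t - x j\<bar>) \<le> (\<Prod>j<Suc d. real d * B)"
  proof (rule prod_mono)
    fix j assume j: "j \<in> {..<Suc d}"
    have "x 0 \<le> x j" "x j \<le> x d" "x 0 \<le> x i" "x (Suc i) \<le> x d"
      using crit_le[OF c, of 0 j] crit_le[OF c, of j d] crit_le[OF c, of 0 i] crit_le[OF c, of "Suc i" d] j \<open>i < d\<close> by auto
    then show "0 \<le> \<bar>t - x j\<bar> \<and> \<bar>t - x j\<bar> \<le> real d * B" using t span by auto
  qed
  then have pr: "(\<Prod>j<Suc d. \<bar>t - x j\<bar>) \<le> (real d * B) ^ Suc d" by simp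
  have "heights d y i = s * (poly p (x (Suc i)) - poly p (x i))"
    using \<open>i < d\<close> by (simp add: heights_def x_def[symmetric] p_def[symmetric] s_def)
  also have "\<dots> \<le> \<bar>poly p (x (Suc i)) - poly p (x i)\<bar>"
    using abs1 by (metis abs_ge_self abs_mult mult_1)
  also have "\<dots> = y i * (real (Suc (Suc d)) * (\<Prod>j<Suc d. \<bar>t - x j\<bar>))"
    using t(3) g c by (simp add: crit_def poly_lin_prod abs_mult abs_prod del: of_nat_Suc)
  also have "\<dots> \<le> y i * (real (Suc (Suc d)) * (real d * B) ^ Suc d)"
    using pr g(1) by (intro mult_left_mono) auto
  finally show ?thesis .
qed

lemma ex_positive_lower_bound:
  fixes f :: "nat \<Rightarrow> real"
  assumes "\<And>i. i < d \<Longrightarrow> 0 < f i"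
  shows "\<exists>e>0. \<forall>i<d. e < f i"
  using assms
proof (induction d)
  case 0 show ?case by (intro exI[of _ 1]) simp
next
  case (Suc d)
  then obtain e where "e > 0" "\<forall>i<d. e < f i" by force
  then show ?case using Suc.prems[of d]
    by (intro exI[of _ "min e (f d / 2)"]) (auto simp: less_Suc_eq)
qed

text \<open>Convergent heights are eventually bounded above and away from zero. The two estimates
  then confine the gaps to a compact box inside the orthant.\<close>

lemma heights_proper:
  assumes y: "\<And>k::nat. y k \<in> orthant d" and lim: "(\<lambda>k. heights d (y k)) \<longlonglongrightarrow> a" and a: "a \<in> orthant d"
  shows "\<exists>r l. strict_mono (r::nat \<Rightarrow> nat) \<and> l \<in> orthant d \<and> (y \<circ> r) \<longlonglongrightarrow> l"
proof -
  obtain e where e: "e > 0" "\<forall>i<d. e < a i"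
    using ex_positive_lower_bound[of d a] a by (auto simp: orthant_def)
  define H where "H = (\<Sum>i<d. a i) + 1"
  have aH: "a i < H" if "i < d" for i
  proof -
    have "a i \<le> (\<Sum>i<d. a i)" using a that by (intro member_le_sum) (auto simp: orthant_def less_imp_le)
    then show ?thesis by (simp add: H_def)
  qed
  have clim: "(\<lambda>k. heights d (y k) i) \<longlonglongrightarrow> a i" for i
    by (rule continuous_on_tendsto_compose[OF continuous_on_product_coordinates lim]) auto
  have "\<forall>\<^sub>F k in sequentially. \<forall>i\<in>{..<d}. e < heights d (y k) i \<and> heights d (y k) i < H"
    by (intro eventually_ball_finite ballI eventually_conj order_tendstoD[OF clim])
      (use e aH in auto)
  then obtain k0 where k0: "\<And>k i. k \<ge> k0 \<Longrightarrow> i < d \<Longrightarrow> e < heights d (y k) i \<and> heights d (y k) i < H"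
    unfolding eventually_sequentially by auto
  \<comment> \<open>The two entries are the bounds on a gap in the two cases of
    \<open>heights_lower\<close>.\<close>
  define B where "B = max 3 (3 * H)"
  define C where "C = real (Suc (Suc d)) * (real d * B) ^ Suc d"
  have up: "y k i \<le> B" if "k \<ge> k0" "i < d" for k i
    using heights_lower[OF y[of k] that(2)] k0[OF that] by (auto simp: B_def)
  have low: "e \<le> y k i * C" if "k \<ge> k0" "i < d" for k i
    using heights_upper[OF y[of k] that(2), of B] up[OF that(1)] k0[OF that] by (simp add: C_def)
  \<comment> \<open>Coordinates from \<open>d\<close> on are pinned to zero, so the box is compact
    in the full function space.\<close>
  define Box where "Box = Pi\<^sub>E UNIV (\<lambda>i. if i < d then {e / C..B} else {0::real})"
  have "compactin (product_topology (\<lambda>i. euclidean) UNIV) Box"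
    unfolding Box_def compactin_PiE by auto
  then have "compact Box" by (simp add: euclidean_product_topology)
  then have sc: "seq_compact Box" by (rule compact_imp_seq_compact)
  have Cpos: "C > 0" if "d > 0" using that by (auto simp: C_def B_def intro!: mult_pos_pos zero_less_power)
  have "y (k + k0) \<in> Box" for k
    using up[of "k + k0"] low[of "k + k0"] Cpos y[of "k + k0"]
    by (auto simp: Box_def PiE_iff orthant_def divide_le_eq)
  then obtain l r where r: "l \<in> Box" "strict_mono (r::nat \<Rightarrow> nat)" "((\<lambda>k. y (k + k0)) \<circ> r) \<longlonglongrightarrow> l"
    using sc unfolding seq_compact_def by metis
  have "l \<in> orthant d"
  proof -
    have "0 < l i" if "i < d" for i
    proof -
      have "e / C \<le> l i" using r(1) that by (auto simp: Box_def PiE_iff split: if_splits)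
      moreover have "0 < e / C" using e Cpos that by auto
      ultimately show ?thesis by linarith
    qed
    moreover have "l i = 0" if "i \<ge> d" for i
    proof -
      have "l i \<in> (if i < d then {e / C..B} else {0})" using r(1) unfolding Box_def PiE_iff by blast
      then show ?thesis using that by simp
    qed
    ultimately show ?thesis by (simp add: orthant_def)
  qed
  moreover have "strict_mono (\<lambda>k. r k + k0)" using r(2) by (simp add: strict_mono_def)
  moreover have "(y \<circ> (\<lambda>k. r k + k0)) \<longlonglongrightarrow> l" using r(3) by (simp add: o_def)
  ultimately show ?thesis by blast
qed

lemma gap_pts_inj:
  assumes "y \<in> orthant d" "y' \<in> orthant d" "\<And>i. i < Suc d \<Longrightarrow> gap_pts d y i = gap_pts d y' i"
  shows "y = y'"
proof
  fix i show "y i = y' i"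
  proof (cases "i < d")
    case True then show ?thesis using gap_pts_Suc[of d y i] gap_pts_Suc[of d y' i] assms(3)[of i] assms(3)[of "Suc i"] by simp
  qed (use assms in \<open>simp add: orthant_def\<close>)
qed

text \<open>If every critical point moves by less than half of the smallest gap, the interlacing
  required by \<open>close_crit_eq\<close> persists.\<close>

lemma heights_locally_inj:
  assumes y: "y \<in> orthant d"
  shows "\<exists>V. openin (top_of_set (orthant d)) V \<and> y \<in> V \<and> inj_on (heights d) V"
proof -
  obtain e where e: "e > 0" "\<forall>i<d. e < y i"
    using ex_positive_lower_bound[of d y] y by (auto simp: orthant_def)
  define W where "W = {z. \<forall>i<Suc d. \<bar>gap_pts d z i - gap_pts d y i\<bar> < e / 2}"
  have "open W" unfolding W_def
    by (rule open_all_less) (intro continuous_intros continuous_gap_pts)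
  then have "openin (top_of_set (orthant d)) (orthant d \<inter> W)" by (rule openin_open_Int)
  moreover have "y \<in> orthant d \<inter> W" using y e by (simp add: W_def)
  moreover have "inj_on (heights d) (orthant d \<inter> W)"
  proof (rule inj_onI)
    fix u v assume u: "u \<in> orthant d \<inter> W" and v: "v \<in> orthant d \<inter> W" and eq: "heights d u = heights d v"
    define P where "P z = crit_poly (Suc d) (gap_pts d z)" for z
    \<comment> \<open>The shift equalises the first critical values; equal heights then equalise all
      of them.\<close>
    define q where "q = P v + [:poly (P u) (gap_pts d u 0) - poly (P v) (gap_pts d v 0):]"
    have c: "crit (Suc d) (gap_pts d u) (P u)" unfolding P_def by (rule gap_pts_crit) (use u in simp)
    have "crit (Suc d) (gap_pts d v) (P v)" unfolding P_def by (rule gap_pts_crit) (use v in simp)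
    then have c': "crit (Suc d) (gap_pts d v) q" by (simp add: crit_def q_def pderiv_add pderiv_pCons)
    have close: "gap_pts d z i < gap_pts d z' (Suc i)" if "z \<in> W" "z' \<in> W" "Suc i < Suc d" for z z' i
    proof -
      have "\<bar>gap_pts d z i - gap_pts d y i\<bar> < e / 2" "\<bar>gap_pts d z' (Suc i) - gap_pts d y (Suc i)\<bar> < e / 2"
        using that unfolding W_def by auto
      moreover have "e < y i" using e that by simp
      ultimately show ?thesis using gap_pts_Suc[of d y i] unfolding abs_less_iff by linarith
    qed
    have "P u = q"
    proof (rule close_crit_eq[OF c c'])
      have "P u - q = crit_poly (Suc d) (gap_pts d u) - crit_poly (Suc d) (gap_pts d v)
          + [:- (poly (P u) (gap_pts d u 0) - poly (P v) (gap_pts d v 0)):]"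
        by (simp add: P_def q_def)
      then show "degree (P u - q) < Suc d"
        by (simp only:) (rule degree_crit_poly_diff[OF _ sum_gap_pts sum_gap_pts], simp)
      show "poly (P u) (gap_pts d u i) = poly q (gap_pts d v i)" if "i < Suc d" for i
        using that
      proof (induction i)
        case 0 show ?case by (simp add: q_def)
      next
        case (Suc i)
        have "heights d u i = heights d v i" using eq by simp
        then have "poly (P u) (gap_pts d u (Suc i)) - poly (P u) (gap_pts d u i)
            = poly (P v) (gap_pts d v (Suc i)) - poly (P v) (gap_pts d v i)"
          using Suc.prems by (simp add: heights_def P_def)
        then show ?case using Suc by (simp add: q_def)
      qed
    qed (use close u v in auto)
    then have "gap_pts d u i = gap_pts d v i" if "i < Suc d" for i
      using crit_unique[OF c] c' that by metis
    then show "u = v" using gap_pts_inj u v by blast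
  qed
  ultimately show ?thesis by blast
qed

lemma heights_bij:
  shows "inj_on (heights d) (orthant d)" "heights d ` orthant d = orthant d"
    "continuous_on (orthant d) (inv_into (orthant d) (heights d))"
proof -
  \<comment> \<open>Unit heights are the Chebyshev case, whose fibre has only one point.\<close>
  define a0 where "a0 = (\<lambda>i. if i < d then 1 else 0 :: real)"
  have a0: "a0 \<in> orthant d" by (simp add: a0_def orthant_def)
  have uniq: "y = y'" if "y \<in> orthant d" "y' \<in> orthant d" "heights d y = a0" "heights d y' = a0" for y y'
  proof (rule gap_pts_inj[OF that(1,2)])
    fix i assume "i < Suc d"
    have *: "(-1) ^ (Suc d + Suc i) * (poly (crit_poly (Suc d) (gap_pts d z)) (gap_pts d z (Suc i)) -
        poly (crit_poly (Suc d) (gap_pts d z)) (gap_pts d z i)) = 1"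
      if "heights d z = a0" "Suc i < Suc d" for z i
      using fun_cong[OF that(1), of i] that(2) by (simp add: heights_def a0_def)
    show "gap_pts d y i = gap_pts d y' i"
      by (rule equal_oscillation_unique[of "Suc d", OF gap_pts_less[OF that(1)] gap_pts_less[OF that(2)]
            sum_gap_pts sum_gap_pts *[OF that(3)] *[OF that(4)] \<open>i < Suc d\<close>])
  qed
  note * = proper_locally_injective_imp_bij[OF openin_orthant connected_orthant continuous_heights
      _ heights_locally_inj heights_proper a0 uniq]
  have into: "heights d ` orthant d \<subseteq> orthant d" using heights_orthant by blast
  show "inj_on (heights d) (orthant d)" by (rule *(1)[OF into])
  show "heights d ` orthant d = orthant d" by (rule *(2)[OF into])
  show "continuous_on (orthant d) (inv_into (orthant d) (heights d))" by (rule *(3)[OF into])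
qed

section \<open>Realising prescribed critical and boundary values\<close>

definition lt :: "bool \<Rightarrow> 'a::linorder \<Rightarrow> 'a \<Rightarrow> bool" where
  "lt e a b = (if e then a < b else b < a)"

lemma lt_real: "lt (even n) a b \<longleftrightarrow> 0 < (-1) ^ n * (b - a :: real)"
  by (auto simp: lt_def)

text \<open>Entries \<open>0..<m\<close> of \<open>w\<close> are the critical values in the order of the critical points, and
  entry \<open>m + j\<close> is the value at a boundary point on the \<open>k j\<close>-th of the \<open>m + 1\<close> monotone branches;
  branch \<open>k\<close> joins the critical points \<open>k - 1\<close> and \<open>k\<close> and is increasing iff \<open>m + k\<close> is even.\<close>

definition zigzag :: "nat \<Rightarrow> nat \<Rightarrow> (nat \<Rightarrow> nat) \<Rightarrow> (nat \<Rightarrow> 'a::linorder) \<Rightarrow> bool" where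
  "zigzag m l k w \<longleftrightarrow> (\<forall>i. Suc i < m \<longrightarrow> lt (even (m + Suc i)) (w i) (w (Suc i))) \<and>
     (\<forall>j<l. k j \<le> m \<and> (0 < k j \<longrightarrow> lt (even (m + k j)) (w (k j - 1)) (w (m + j)))
        \<and> (k j < m \<longrightarrow> lt (even (m + k j)) (w (m + j)) (w (k j))))"

text \<open>Only the order of the entries matters. This permits passing between real values and
  their ranks, which is why \<open>zigzag\<close> is polymorphic.\<close>

lemma zigzag_order_iso:
  assumes "zigzag m l k w" "\<And>s t. s < m + l \<Longrightarrow> t < m + l \<Longrightarrow> w s < w t \<Longrightarrow> v s < v t"
  shows "zigzag m l k v"
proof -
  have "lt e (w s) (w t) \<Longrightarrow> s < m + l \<Longrightarrow> t < m + l \<Longrightarrow> lt e (v s) (v t)" for e s t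
    using assms(2) by (auto simp: lt_def)
  then show ?thesis using assms(1) by (auto simp: zigzag_def)
qed

text \<open>Inverts \<open>heights\<close> at the oriented differences of \<open>w\<close>. Only
  differences enter; the additive constant is restored by \<open>level_shift\<close>.\<close>

definition crit_pts :: "nat \<Rightarrow> (nat \<Rightarrow> real) \<Rightarrow> nat \<Rightarrow> real" where
  "crit_pts m w = gap_pts (m - 1) (inv_into (orthant (m - 1)) (heights (m - 1))
     (\<lambda>i. if Suc i < m then (-1) ^ (m + Suc i) * (w (Suc i) - w i) else 0))"

lemma diffs_orthant:
  assumes "zigzag m l k w"
  shows "(\<lambda>i. if Suc i < m then (-1) ^ (m + Suc i) * (w (Suc i) - w i) else 0) \<in> orthant (m - 1)"
  using assms unfolding zigzag_def lt_real by (auto simp: orthant_def)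

lemma crit_pts:
  assumes "zigzag m l k w"
  shows "crit m (crit_pts m w) (crit_poly m (crit_pts m w))" (is ?A)
    and "(\<Sum>i<m. crit_pts m w i) = 0" (is ?B)
    and "Suc i < m \<Longrightarrow> poly (crit_poly m (crit_pts m w)) (crit_pts m w (Suc i)) -
      poly (crit_poly m (crit_pts m w)) (crit_pts m w i) = w (Suc i) - w i"
proof -
  have "?A \<and> ?B \<and> (\<forall>i. Suc i < m \<longrightarrow> poly (crit_poly m (crit_pts m w)) (crit_pts m w (Suc i)) -
      poly (crit_poly m (crit_pts m w)) (crit_pts m w i) = w (Suc i) - w i)"
  proof (cases m)
    case 0 then show ?thesis by (auto intro!: crit_crit_poly)
  next
    case (Suc d)
    define a where "a = (\<lambda>i. if Suc i < m then (-1) ^ (m + Suc i) * (w (Suc i) - w i) else 0)"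
    have "a \<in> orthant d" using diffs_orthant[OF assms] Suc by (simp add: a_def)
    define y where "y = inv_into (orthant d) (heights d) a"
    have y: "y \<in> orthant d" "heights d y = a"
      using \<open>a \<in> orthant d\<close> heights_bij(2)[of d] unfolding y_def
      by (metis inv_into_into, metis f_inv_into_f)
    have x: "crit_pts m w = gap_pts d y" unfolding crit_pts_def y_def a_def using Suc by simp
    show ?thesis unfolding x unfolding Suc
    proof (intro conjI allI impI)
      fix i assume "Suc i < Suc d"
      then show "poly (crit_poly (Suc d) (gap_pts d y)) (gap_pts d y (Suc i)) -
        poly (crit_poly (Suc d) (gap_pts d y)) (gap_pts d y i) = w (Suc i) - w i"
        using fun_cong[OF y(2), of i] Suc by (simp add: heights_def a_def)
    qed (rule gap_pts_crit[OF y(1)], rule sum_gap_pts)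
  qed
  then show ?A ?B "Suc i < m \<Longrightarrow> poly (crit_poly m (crit_pts m w)) (crit_pts m w (Suc i)) -
      poly (crit_poly m (crit_pts m w)) (crit_pts m w i) = w (Suc i) - w i" by blast+
qed

lemma crit_pts_unique:
  assumes c: "crit m x (crit_poly m x)" and sx: "(\<Sum>i<m. x i) = 0"
    and d: "\<And>i. Suc i < m \<Longrightarrow> poly (crit_poly m x) (x (Suc i)) - poly (crit_poly m x) (x i) = w (Suc i) - w i"
    and "i < m"
  shows "crit_pts m w i = x i"
proof -
  obtain d where m: "m = Suc d" using \<open>i < m\<close> by (metis gr0_implies_Suc gr_implies_not0 neq0_conv)
  define y where "y i = (if i < d then x (Suc i) - x i else 0)" for i
  have y: "y \<in> orthant d" using crit_less[OF c] m by (auto simp: orthant_def y_def)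
  have part: "(\<Sum>j<i. y j) = x i - x 0" if "i < m" for i
    using that m by (induction i) (auto simp: y_def)
  have "(\<Sum>k<Suc d. \<Sum>j<k. y j) = (\<Sum>k<Suc d. x k - x 0)" using part m by (intro sum.cong) auto
  also have "\<dots> = - real (Suc d) * x 0" using sx m by (simp add: sum_subtractf algebra_simps)
  finally have tot: "(\<Sum>k<Suc d. \<Sum>j<k. y j) = - real (Suc d) * x 0" .
  have gx: "gap_pts d y i = x i" if "i < m" for i
    using part[OF that] unfolding gap_pts_def tot by (simp del: of_nat_Suc)
  have lp: "lin_prod m (gap_pts d y) = lin_prod m x" unfolding lin_prod_def using gx by simp
  then have cp: "crit_poly m (gap_pts d y) = crit_poly m x" by (simp add: crit_poly_def)
  have "heights d y = (\<lambda>i. if Suc i < m then (-1) ^ (m + Suc i) * (w (Suc i) - w i) else 0)"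
  proof
    fix i
    show "heights d y i = (if Suc i < m then (-1) ^ (m + Suc i) * (w (Suc i) - w i) else 0)"
      using d[of i] gx[of i] gx[of "Suc i"] cp m by (auto simp: heights_def)
  qed
  then have "inv_into (orthant d) (heights d)
     (\<lambda>i. if Suc i < m then (-1) ^ (m + Suc i) * (w (Suc i) - w i) else 0) = y"
    using inv_into_f_f[OF heights_bij(1) y] by simp
  then show ?thesis unfolding crit_pts_def using m gx[OF \<open>i < m\<close>] by simp
qed

lemma continuous_crit_pts:
  assumes "\<And>s. s \<in> S \<Longrightarrow> zigzag m l k (w s)" "\<And>i. i < m \<Longrightarrow> continuous_on S (\<lambda>s. w s i)"
  shows "continuous_on S (\<lambda>s. crit_pts m (w s) i)"
proof -
  define a where "a s = (\<lambda>i. if Suc i < m then (-1) ^ (m + Suc i) * (w s (Suc i) - w s i) else 0)" for s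
  have "continuous_on S a"
  proof (rule continuous_on_coordinatewise_then_product)
    fix i show "continuous_on S (\<lambda>s. a s i)"
      unfolding a_def by (cases "Suc i < m") (auto simp only: if_True if_False intro!: continuous_intros assms)
  qed
  moreover have "a ` S \<subseteq> orthant (m - 1)" using diffs_orthant[OF assms(1)] by (auto simp: a_def)
  ultimately have "continuous_on S (\<lambda>s. inv_into (orthant (m - 1)) (heights (m - 1)) (a s))"
    by (rule continuous_on_compose2[OF heights_bij(3)])
  from continuous_on_compose2[OF continuous_gap_pts[of UNIV] this]
  show ?thesis unfolding crit_pts_def a_def by simp
qed

definition in_branch :: "nat \<Rightarrow> (nat \<Rightarrow> real) \<Rightarrow> nat \<Rightarrow> real \<Rightarrow> bool" where
  "in_branch m x k t \<longleftrightarrow> (0 < k \<longrightarrow> x (k - 1) < t) \<and> (k < m \<longrightarrow> t < x k)"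

text \<open>The additive constant turning the polynomial into one with critical values \<open>w\<close>.\<close>

definition level_shift :: "nat \<Rightarrow> (nat \<Rightarrow> real) \<Rightarrow> real" where
  "level_shift m w = (if m = 0 then 0 else w 0 - poly (crit_poly m (crit_pts m w)) (crit_pts m w 0))"

definition bd_pt :: "nat \<Rightarrow> (nat \<Rightarrow> nat) \<Rightarrow> (nat \<Rightarrow> real) \<Rightarrow> nat \<Rightarrow> real" where
  "bd_pt m k w j = (SOME t. in_branch m (crit_pts m w) (k j) t \<and>
     poly (crit_poly m (crit_pts m w)) t + level_shift m w = w (m + j))"

lemma crit_pts_value:
  assumes "zigzag m l k w" "i < m"
  shows "poly (crit_poly m (crit_pts m w)) (crit_pts m w i) + level_shift m w = w i"
  using assms(2)
proof (induction i)
  case 0 then show ?case by (simp add: level_shift_def)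
next
  case (Suc i)
  then show ?case using crit_pts(3)[OF assms(1) Suc.prems] by simp
qed

lemma bd_pt:
  assumes z: "zigzag m l k w" and "j < l"
  shows "in_branch m (crit_pts m w) (k j) (bd_pt m k w j)" (is ?A)
    and "poly (crit_poly m (crit_pts m w)) (bd_pt m k w j) + level_shift m w = w (m + j)" (is ?B)
proof -
  let ?x = "crit_pts m w" and ?p = "crit_poly m (crit_pts m w)"
  have k: "k j \<le> m" "0 < k j \<longrightarrow> lt (even (m + k j)) (w (k j - 1)) (w (m + j))"
    "k j < m \<longrightarrow> lt (even (m + k j)) (w (m + j)) (w (k j))"
    using z \<open>j < l\<close> by (auto simp: zigzag_def)
  have "\<exists>t. (k j > 0 \<longrightarrow> ?x (k j - 1) < t) \<and> (k j < m \<longrightarrow> t < ?x (k j)) \<and> poly ?p t = w (m + j) - level_shift m w"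
  proof (rule branch_surj[OF crit_pts(1)[OF z] k(1)])
    assume "0 < k j"
    then have "poly ?p (?x (k j - 1)) = w (k j - 1) - level_shift m w"
      using crit_pts_value[OF z, of "k j - 1"] k(1) by (simp add: eq_diff_eq)
    then show "0 < (-1) ^ (m + k j) * (w (m + j) - level_shift m w - poly ?p (?x (k j - 1)))"
      using k(2) \<open>0 < k j\<close> unfolding lt_real by simp
  next
    assume "k j < m"
    then have "poly ?p (?x (k j)) = w (k j) - level_shift m w"
      using crit_pts_value[OF z, of "k j"] by (simp add: eq_diff_eq)
    then show "0 < (-1) ^ (m + k j) * (poly ?p (?x (k j)) - (w (m + j) - level_shift m w))"
      using k(3) \<open>k j < m\<close> unfolding lt_real by simp
  qed
  then have "\<exists>t. in_branch m ?x (k j) t \<and> poly ?p t + level_shift m w = w (m + j)"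
    by (auto simp: in_branch_def algebra_simps)
  from someI_ex[OF this] show ?A ?B unfolding bd_pt_def by auto
qed

lemma bd_pt_unique:
  assumes z: "zigzag m l k w" and "j < l" and "in_branch m (crit_pts m w) (k j) t"
    "poly (crit_poly m (crit_pts m w)) t + level_shift m w = w (m + j)"
  shows "t = bd_pt m k w j"
proof (rule branch_inj[OF crit_pts(1)[OF z]])
  show "k j \<le> m" using z \<open>j < l\<close> by (auto simp: zigzag_def)
qed (use assms bd_pt[OF z \<open>j < l\<close>] in \<open>auto simp: in_branch_def\<close>)

lemma continuous_level_shift:
  assumes "\<And>s. s \<in> S \<Longrightarrow> zigzag m l k (w s)" "\<And>i. i < m \<Longrightarrow> continuous_on S (\<lambda>s. w s i)"
  shows "continuous_on S (\<lambda>s. level_shift m (w s))"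
proof (cases "m = 0")
  case False
  show ?thesis
    unfolding level_shift_def if_not_P[OF False]
    by (intro continuous_intros continuous_poly_crit_poly continuous_crit_pts[OF assms] assms(2))
      (use False in simp_all)
qed (simp add: level_shift_def)

text \<open>An implicit function argument without derivatives: strict monotonicity on the branch
  gives opposite strict signs at \<open>b - d\<close> and \<open>b + d\<close>. The signs, and the
  inclusion of both points in the branch, survive a small change of \<open>s\<close>, so the unique
  root stays between them.\<close>

lemma continuous_bd_pt:
  fixes S :: "real set"
  assumes z: "\<And>s. s \<in> S \<Longrightarrow> zigzag m l k (w s)" and cw: "\<And>i. i < m + l \<Longrightarrow> continuous_on S (\<lambda>s. w s i)"
    and j: "j < l"
  shows "continuous_on S (\<lambda>s. bd_pt m k (w s) j)"
  unfolding continuous_on_iff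
proof (intro ballI allI impI)
  fix s0 and e :: real assume s0: "s0 \<in> S" and "e > 0"
  define x where "x s = crit_pts m (w s)" for s
  define b where "b = bd_pt m k (w s0) j"
  define f where "f s t = poly (crit_poly m (x s)) t + level_shift m (w s) - w s (m + j)" for s t
  define K where "K = k j"
  have K: "K \<le> m" using z[OF s0] j by (auto simp: zigzag_def K_def)
  have cw': "\<And>i. i < m \<Longrightarrow> continuous_on S (\<lambda>s. w s i)" using cw by simp
  have cx: "continuous_on S (\<lambda>s. x s i)" for i unfolding x_def by (rule continuous_crit_pts[OF z cw'])
  have cf: "continuous_on S (\<lambda>s. f s t)" for t
    unfolding f_def
    by (intro continuous_intros continuous_poly_crit_poly cx continuous_level_shift[OF z cw'] cw) (use j in auto)
  have b: "in_branch m (x s0) K b" "f s0 b = 0"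
    using bd_pt[OF z[OF s0] j] by (simp_all add: x_def K_def b_def f_def)
  obtain d where d: "0 < d" "d < e" "in_branch m (x s0) K (b - d)" "in_branch m (x s0) K (b + d)"
  proof -
    \<comment> \<open>Half the distance to each end of the branch leaves room for the ends to move;
      an outer branch has the default 1 on its open side.\<close>
    define d where "d = min (e / 2) (min (if 0 < K then (b - x s0 (K - 1)) / 2 else 1) (if K < m then (x s0 K - b) / 2 else 1))"
    have d0: "0 < d" using b(1) \<open>e > 0\<close> by (auto simp: d_def in_branch_def)
    have "d \<le> (if 0 < K then (b - x s0 (K - 1)) / 2 else 1)" "d \<le> (if K < m then (x s0 K - b) / 2 else 1)"
      unfolding d_def by (meson min.cobounded1 min.cobounded2 order_trans)+
    then have d1: "0 < K \<longrightarrow> 2 * d \<le> b - x s0 (K - 1)" and d2: "K < m \<longrightarrow> 2 * d \<le> x s0 K - b" by auto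
    have "d < e" using \<open>e > 0\<close> by (simp add: d_def)
    moreover have "in_branch m (x s0) K (b - d)"
      unfolding in_branch_def using d0 d1 b(1)[unfolded in_branch_def] by (intro conjI impI) linarith+
    moreover have "in_branch m (x s0) K (b + d)"
      unfolding in_branch_def using d0 d2 b(1)[unfolded in_branch_def] by (intro conjI impI) linarith+
    ultimately show thesis using that d0 by blast
  qed
  have c0: "crit m (x s0) (crit_poly m (x s0))" using crit_pts(1)[OF z[OF s0]] by (simp add: x_def)
  define g where "g = ((-1) ^ (m + K) :: real)"
  have diff: "f s0 t = poly (crit_poly m (x s0)) t - poly (crit_poly m (x s0)) b" for t
    using b(2) by (simp add: f_def)
  have "0 < g * (poly (crit_poly m (x s0)) b - poly (crit_poly m (x s0)) (b - d))"
    unfolding g_def by (rule branch_mono[OF c0 K]) (use b(1) d in \<open>auto simp: in_branch_def\<close>)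
  then have lo: "g * f s0 (b - d) < 0" unfolding diff by (simp add: algebra_simps)
  have "0 < g * (poly (crit_poly m (x s0)) (b + d) - poly (crit_poly m (x s0)) b)"
    unfolding g_def by (rule branch_mono[OF c0 K]) (use b(1) d in \<open>auto simp: in_branch_def\<close>)
  then have hi: "0 < g * f s0 (b + d)" unfolding diff .
  have tends: "((\<lambda>s. h s) \<longlongrightarrow> h s0) (at s0 within S)" if "continuous_on S h" for h :: "real \<Rightarrow> real"
    using that s0 by (simp add: continuous_on_def)
  have tf: "((\<lambda>s. g * f s t) \<longlongrightarrow> g * f s0 t) (at s0 within S)" for t
    by (rule tends) (intro continuous_intros cf)
  have tx: "((\<lambda>s. x s i) \<longlongrightarrow> x s0 i) (at s0 within S)" for i
    by (rule tends) (rule cx)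
  have "\<forall>\<^sub>F s in at s0 within S. g * f s (b - d) < 0" by (rule order_tendstoD(2)[OF tf lo])
  moreover have "\<forall>\<^sub>F s in at s0 within S. 0 < g * f s (b + d)" by (rule order_tendstoD(1)[OF tf hi])
  moreover have "\<forall>\<^sub>F s in at s0 within S. 0 < K \<longrightarrow> x s (K - 1) < b - d"
    using order_tendstoD(2)[OF tx, of "K - 1" "b - d"] d by (cases "0 < K") (auto simp: in_branch_def)
  moreover have "\<forall>\<^sub>F s in at s0 within S. K < m \<longrightarrow> b + d < x s K"
    using order_tendstoD(1)[OF tx, of "b + d" K] d by (cases "K < m") (auto simp: in_branch_def)
  ultimately have ev: "\<forall>\<^sub>F s in at s0 within S. g * f s (b - d) < 0 \<and> 0 < g * f s (b + d) \<and>
      (0 < K \<longrightarrow> x s (K - 1) < b - d) \<and> (K < m \<longrightarrow> b + d < x s K)"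
    by eventually_elim auto
  have near: "dist (bd_pt m k (w s) j) b < e"
    if s: "s \<in> S" "g * f s (b - d) < 0" "0 < g * f s (b + d)"
      "0 < K \<longrightarrow> x s (K - 1) < b - d" "K < m \<longrightarrow> b + d < x s K" for s
  proof -
    have cont: "continuous_on T (\<lambda>t. g * f s t)" for T
      unfolding f_def by (intro continuous_intros)
    obtain t where t: "b - d \<le> t" "t \<le> b + d" "g * f s t = 0"
      using IVT'[of "\<lambda>t. g * f s t" "b - d" 0 "b + d"] s cont d by force
    have "f s t = 0" using t(3) by (auto simp: g_def)
    then have "t = bd_pt m k (w s) j"
      using bd_pt_unique[OF z[OF s(1)] j, of t] s t by (auto simp: f_def in_branch_def K_def x_def)
    then show ?thesis using t d by (auto simp: dist_real_def)
  qed
  obtain r where r: "r > 0" "\<forall>s\<in>S. s \<noteq> s0 \<and> dist s s0 < r \<longrightarrow> g * f s (b - d) < 0 \<and> 0 < g * f s (b + d) \<and>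
      (0 < K \<longrightarrow> x s (K - 1) < b - d) \<and> (K < m \<longrightarrow> b + d < x s K)"
    using ev unfolding eventually_at by auto
  have "dist (bd_pt m k (w s) j) (bd_pt m k (w s0) j) < e" if "s \<in> S" "dist s s0 < r" for s
    using near[OF that(1)] r that \<open>e > 0\<close> by (cases "s = s0") (auto simp: b_def)
  then show "\<exists>d>0. \<forall>x'\<in>S. dist x' s0 < d \<longrightarrow> dist (bd_pt m k (w x') j) (bd_pt m k (w s0) j) < e"
    using r(1) by blast
qed

subsection \<open>Combinatorial type of a very nice morsification\<close>

text \<open>Boundary points are labelled from 1 in the parameter space but from 0 in the
  combinatorial types, hence the \<open>Suc\<close>.\<close>

definition vals :: "nat \<Rightarrow> real poly \<Rightarrow> (nat \<Rightarrow> real) \<Rightarrow> (nat \<Rightarrow> real) \<Rightarrow> nat \<Rightarrow> real" where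
  "vals m p x b t = poly p (if t < m then x t else b (Suc (t - m)))"

definition crits :: "nat \<Rightarrow> real poly \<Rightarrow> nat \<Rightarrow> real" where
  "crits m p = (SOME x. crit m x p)"

definition rank_in :: "nat \<Rightarrow> (nat \<Rightarrow> 'a::linorder) \<Rightarrow> nat \<Rightarrow> nat" where
  "rank_in N v t = card {s. s < N \<and> v s < v t}"

lemma rank_in_mono:
  assumes "s < N" "v s < v t"
  shows "rank_in N v s < rank_in N v t"
  unfolding rank_in_def
  by (rule psubset_card_mono) (use assms in \<open>auto dest: less_trans\<close>)

lemma rank_in_less: "t < N \<Longrightarrow> rank_in N v t < N"
proof -
  assume "t < N"
  then have "card {s. s < N \<and> v s < v t} < card {..<N}" by (intro psubset_card_mono) auto
  then show ?thesis by (simp add: rank_in_def)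
qed

lemma rank_in_inj:
  assumes "inj_on v {..<N}"
  shows "inj_on (rank_in N v) {..<N}"
proof (rule inj_onI)
  fix s t assume st: "s \<in> {..<N}" "t \<in> {..<N}" "rank_in N v s = rank_in N v t"
  then have "v s = v t" using rank_in_mono[of s N v t] rank_in_mono[of t N v s] by (metis lessThan_iff less_irrefl neqE)
  then show "s = t" using assms st by (auto dest: inj_onD)
qed

lemma rank_in_less_iff:
  assumes "inj_on v {..<N}" "s < N" "t < N"
  shows "rank_in N v s < rank_in N v t \<longleftrightarrow> v s < v t"
  using rank_in_mono[of s N v t] rank_in_mono[of t N v s] assms(2,3) inj_onD[OF assms(1), of s t]
  by (cases "v s" "v t" rule: linorder_cases) auto

lemma rank_in_cong:
  assumes "\<And>s. s < N \<Longrightarrow> v s < v t \<longleftrightarrow> w s < w t"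
  shows "rank_in N v t = rank_in N w t"
  unfolding rank_in_def using assms by (metis (no_types, lifting))

lemma rank_in_bij:
  fixes u :: "nat \<Rightarrow> nat"
  assumes "inj_on u {..<N}" "u ` {..<N} \<subseteq> {..<N}" "t < N"
  shows "rank_in N u t = u t"
proof -
  have surj: "u ` {..<N} = {..<N}" using assms by (simp add: endo_inj_surj)
  have "u ` {s. s < N \<and> u s < u t} = {..<u t}"
  proof
    show "{..<u t} \<subseteq> u ` {s. s < N \<and> u s < u t}"
    proof
      fix r assume r: "r \<in> {..<u t}"
      have "u t < N" using assms by auto
      then have "r \<in> u ` {..<N}" using r surj by auto
      then show "r \<in> u ` {s. s < N \<and> u s < u t}" using r by auto
    qed
  qed auto
  moreover have "inj_on u {s. s < N \<and> u s < u t}" using assms(1) by (rule inj_on_subset) auto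
  ultimately show ?thesis unfolding rank_in_def by (metis card_image card_lessThan)
qed

lemma crits: "crit m x p \<Longrightarrow> crit m (crits m p) p"
  unfolding crits_def by (rule someI[where P = "\<lambda>x. crit m x p"])

lemma crits_eq: "crit m x p \<Longrightarrow> i < m \<Longrightarrow> crits m p i = x i"
  using crits crit_unique by blast

text \<open>Exactly the critical points below index \<open>k\<close> lie to the left of branch
  \<open>k\<close>. As a count, the branch number depends only on finitely many strict comparisons,
  which is convenient for openness of the fibres.\<close>

lemma in_branch_card:
  assumes c: "crit m x p" and "k \<le> m" and b: "in_branch m x k b"
  shows "card {i. i < m \<and> x i < b} = k"
proof -
  have "{i. i < m \<and> x i < b} = {..<k}"
  proof (intro equalityI subsetI)
    fix i assume i: "i \<in> {i. i < m \<and> x i < b}"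
    show "i \<in> {..<k}"
    proof (rule ccontr)
      assume "i \<notin> {..<k}"
      then have "x k \<le> x i" "k < m" using crit_le[OF c, of k i] i by auto
      then show False using b i by (auto simp: in_branch_def)
    qed
  next
    fix i assume i: "i \<in> {..<k}"
    then have "x i \<le> x (k - 1)" using crit_le[OF c, of i "k - 1"] \<open>k \<le> m\<close> by auto
    then show "i \<in> {i. i < m \<and> x i < b}" using b i \<open>k \<le> m\<close> by (auto simp: in_branch_def)
  qed
  then show ?thesis by simp
qed

lemma ex_in_branch:
  assumes "\<And>i. i < m \<Longrightarrow> b \<noteq> x i"
  shows "\<exists>k\<le>m. in_branch m x k b"
  using assms
proof (induction m)
  case 0 show ?case by (simp add: in_branch_def)
next
  case (Suc m)
  then obtain k where k: "k \<le> m" "in_branch m x k b" by auto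
  have ne: "b \<noteq> x m" using Suc.prems by simp
  show ?case
  proof (cases "k < m \<or> b < x m")
    case True
    then show ?thesis using k by (intro exI[of _ k]) (auto simp: in_branch_def less_Suc_eq le_less)
  next
    case False
    then show ?thesis using k ne by (intro exI[of _ "Suc m"]) (auto simp: in_branch_def)
  qed
qed

lemma zigzag_vals:
  assumes c: "crit m x p" and k: "\<And>j. j < l \<Longrightarrow> k j \<le> m \<and> in_branch m x (k j) (b (Suc j))"
  shows "zigzag m l k (vals m p x b)"
  unfolding zigzag_def lt_real
proof (intro conjI allI impI)
  fix i assume i: "Suc i < m"
  then show "0 < (-1) ^ (m + Suc i) * (vals m p x b (Suc i) - vals m p x b i)"
    using branch_mono[OF c, of "Suc i" "x i" "x (Suc i)"] crit_less[OF c, of i "Suc i"] by (simp add: vals_def)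
next
  fix j assume j: "j < l" then show "k j \<le> m" using k by simp
  show "0 < (-1) ^ (m + k j) * (vals m p x b (m + j) - vals m p x b (k j - 1))" if "0 < k j"
    using branch_mono[OF c, of "k j" "x (k j - 1)" "b (Suc j)"] k[OF j] that
    by (auto simp add: vals_def in_branch_def)
  show "0 < (-1) ^ (m + k j) * (vals m p x b (k j) - vals m p x b (m + j))" if "k j < m"
    using branch_mono[OF c, of "k j" "b (Suc j)" "x (k j)"] k[OF j] that
    by (auto simp add: vals_def in_branch_def)
qed

subsection \<open>Complex critical points\<close>

lemma map_poly_of_real_mult:
  "map_poly complex_of_real (p * q) = map_poly complex_of_real p * map_poly complex_of_real q"
  by (rule poly_eqI) (simp add: coeff_mult coeff_map_poly)

lemma map_poly_of_real_lin_prod: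
  "map_poly complex_of_real (lin_prod m x) = (\<Prod>i<m. [:- complex_of_real (x i), 1:])"
proof (induction m)
  case (Suc m)
  show ?case
    unfolding lin_prod_def prod.lessThan_Suc map_poly_of_real_mult Suc[unfolded lin_prod_def]
    by (simp add: map_poly_pCons del: mult_pCons_left mult_pCons_right)
qed (simp add: lin_prod_def)

lemma pderiv_map_poly_of_real:
  "pderiv (map_poly complex_of_real p) = map_poly complex_of_real (pderiv p)"
  by (rule poly_eqI) (simp add: coeff_pderiv coeff_map_poly)

lemma poly_map_poly_of_real:
  "poly (map_poly complex_of_real p) (complex_of_real t) = complex_of_real (poly p t)"
  by (induction p) (simp_all add: map_poly_pCons)

lemma complex_critical_points_eq:
  assumes "crit m x p"
  shows "complex_critical_points p = image_mset (\<lambda>i. complex_of_real (x i)) (mset_set {..<m})"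
proof -
  have "complex_critical_points p = proots (\<Prod>i<m. [:- complex_of_real (x i), 1:])"
    using assms unfolding complex_critical_points_def pderiv_map_poly_of_real crit_def
    by (simp add: map_poly_smult map_poly_of_real_lin_prod del: of_nat_Suc)
  also have "\<dots> = (\<Sum>i<m. {#complex_of_real (x i)#})"
    by (subst proots_prod) auto
  also have "\<dots> = image_mset (\<lambda>i. complex_of_real (x i)) (mset_set {..<m})"
    by (induction m) (simp_all add: lessThan_Suc add.commute)
  finally show ?thesis .
qed

lemma critical_boundary_values_eq:
  assumes "crit m x p"
  shows "critical_values p + boundary_values l p b =
    image_mset (\<lambda>t. complex_of_real (vals m p x b t)) (mset_set {..<m + l})"
proof (induction l)
  case 0
  have "image_mset (\<lambda>t. complex_of_real (poly p (x t))) (mset_set {..<m}) =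
      image_mset (\<lambda>t. complex_of_real (vals m p x b t)) (mset_set {..<m})"
    by (rule image_mset_cong) (simp add: vals_def)
  then show ?case
    by (simp add: critical_values_def boundary_values_def complex_critical_points_eq[OF assms]
        image_mset.compositionality o_def poly_map_poly_of_real)
next
  case (Suc l)
  have "boundary_values (Suc l) p b = add_mset (complex_of_real (poly p (b (Suc l)))) (boundary_values l p b)"
    by (simp add: boundary_values_def atLeastAtMostSuc_conv)
  then show ?case using Suc by (simp add: lessThan_Suc vals_def)
qed

lemma count_image_mset_le_1_iff:
  assumes "finite A"
  shows "(\<forall>v. count (image_mset f (mset_set A)) v \<le> 1) \<longleftrightarrow> inj_on f A"
proof -
  have c: "count (image_mset f (mset_set A)) v = card {a \<in> A. f a = v}" for v
    using assms by (simp add: count_image_mset' Collect_conj_eq Int_commute eq_commute)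
  show ?thesis
  proof
    assume L: "\<forall>v. count (image_mset f (mset_set A)) v \<le> 1"
    show "inj_on f A"
    proof (rule inj_onI)
      fix a a' assume a: "a \<in> A" "a' \<in> A" "f a = f a'"
      have "card {a'' \<in> A. f a'' = f a} \<le> Suc 0" using L c by simp
      then show "a = a'" using a assms by (auto simp: card_le_Suc0_iff_eq)
    qed
  next
    assume "inj_on f A"
    then show "\<forall>v. count (image_mset f (mset_set A)) v \<le> 1"
      unfolding c using assms by (auto simp: card_le_Suc0_iff_eq inj_on_def)
  qed
qed

lemma degree_pderiv_morsif:
  "degree (pderiv (morsif_poly (Suc m) lam)) = m" "coeff (pderiv (morsif_poly (Suc m) lam)) m = real (Suc m)"
proof -
  show 1: "coeff (pderiv (morsif_poly (Suc m) lam)) m = real (Suc m)"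
    by (simp add: coeff_pderiv coeff_morsif_poly)
  have "degree (pderiv (morsif_poly (Suc m) lam)) \<le> m"
    by (rule degree_le) (simp add: coeff_pderiv coeff_morsif_poly)
  moreover have "m \<le> degree (pderiv (morsif_poly (Suc m) lam))" by (rule le_degree) (simp add: 1 del: of_nat_Suc)
  ultimately show "degree (pderiv (morsif_poly (Suc m) lam)) = m" by simp
qed

text \<open>The derivative and the product over the \<open>x i\<close> have the same degree and
  leading coefficient, so their difference has degree below \<open>m\<close>, yet it vanishes at
  \<open>m\<close> distinct points unless it is zero.\<close>

lemma critI:
  assumes p: "p = morsif_poly (Suc m) lam" and x: "\<And>i j. i < j \<Longrightarrow> j < m \<Longrightarrow> x i < x j"
    and roots: "\<And>i. i < m \<Longrightarrow> poly (pderiv p) (x i) = 0"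
  shows "crit m x p"
proof -
  define q where "q = pderiv p - smult (real (Suc m)) (lin_prod m x)"
  have "q = 0"
  proof (rule ccontr)
    assume "q \<noteq> 0"
    have inj: "inj_on x {..<m}"
      by (rule linorder_inj_onI) (use x in \<open>fastforce simp: less_le\<close>)+
    have "coeff q j = 0" if "j \<ge> m" for j
      using that degree_pderiv_morsif[of m lam] degree_lin_prod[of m x] lead_coeff_lin_prod[of m x]
      by (cases "j = m") (auto simp: q_def p coeff_eq_0)
    then have "degree q < m" using \<open>q \<noteq> 0\<close> by (metis leI leading_coeff_0_iff)
    moreover have "poly q (x i) = 0" if "i < m" for i
      using that roots by (auto simp: q_def poly_lin_prod)
    then have "m \<le> card {t. poly q t = 0}"
      using card_mono[of "{t. poly q t = 0}" "x ` {..<m}"] card_image[OF inj] \<open>q \<noteq> 0\<close>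
      by (auto simp: poly_roots_finite)
    ultimately show False using card_poly_roots_bound[OF \<open>q \<noteq> 0\<close>] by simp
  qed
  then show ?thesis using x by (simp add: crit_def q_def)
qed

text \<open>Simple critical values force simple critical points, so the \<open>m\<close> complex
  roots of the derivative, being real, can be listed in increasing order.\<close>

lemma very_nice_iff:
  fixes m l :: nat and lam b :: "nat \<Rightarrow> real"
  defines "p \<equiv> morsif_poly (Suc m) lam"
  shows "very_nice (Suc m) l (lam, b) \<longleftrightarrow>
    (\<exists>x. crit m x p) \<and> inj_on (vals m p (crits m p) b) {..<m + l}" (is "?L \<longleftrightarrow> ?R")
proof -
  have key: "(\<forall>v. count (critical_values p + boundary_values l p b) v \<le> 1) \<longleftrightarrow>
      inj_on (vals m p (crits m p) b) {..<m + l}" if "crit m x p" for x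
    unfolding critical_boundary_values_eq[OF crits[OF that]]
    by (subst count_image_mset_le_1_iff) (auto simp: inj_on_def)
  show ?thesis
  proof
    assume ?R
    then obtain x where x: "crit m x p" and inj: "inj_on (vals m p (crits m p) b) {..<m + l}" by blast
    have "set_mset (complex_critical_points p) \<subseteq> \<real>"
      unfolding complex_critical_points_eq[OF x] by auto
    then show ?L using key[OF x] inj by (simp add: very_nice_def p_def[symmetric])
  next
    assume ?L
    then have re: "set_mset (complex_critical_points p) \<subseteq> \<real>"
      and cnt: "\<And>v. count (critical_values p + boundary_values l p b) v \<le> 1"
      by (auto simp: very_nice_def p_def Let_def)
    define C where "C = complex_critical_points p"
    define q where "q = map_poly complex_of_real (pderiv p)"
    have C: "C = proots q" by (simp add: C_def q_def complex_critical_points_def pderiv_map_poly_of_real)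
    have dq: "degree q = m" unfolding q_def p_def by (subst degree_map_poly) (auto simp: degree_pderiv_morsif)
    have "pderiv p \<noteq> 0" using degree_pderiv_morsif(2)[of m lam] by (auto simp: p_def simp del: of_nat_Suc)
    then have "q \<noteq> 0" unfolding q_def by (auto simp: poly_eq_iff coeff_map_poly)
    \<comment> \<open>A repeated critical point would repeat its critical value.\<close>
    have "count C z \<le> 1" for z
    proof -
      let ?f = "poly (map_poly complex_of_real p)"
      have "count C z \<le> count (image_mset ?f C) (?f z)"
        by (cases "z \<in># C") (auto simp: count_image_mset not_in_iff intro!: member_le_sum)
      also have "\<dots> \<le> 1" using cnt[of "?f z"] by (simp add: C_def critical_values_def)
      finally show ?thesis .
    qed
    then have "count C z = count (mset_set (set_mset C)) z" for z
      by (metis One_nat_def count_eq_zero_iff count_mset_set(1,3) finite_set_mset le_SucE le_zero_eq)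
    then have "C = mset_set (set_mset C)" by (rule multiset_eqI)
    then have "size C = card (set_mset C)" by (metis size_mset_set)
    then have "card (set_mset C) = m" using size_proots_complex[of q] dq C by simp
    moreover define R where "R = {t. poly (pderiv p) t = 0}"
    have "set_mset C = complex_of_real ` R"
    proof (intro equalityI subsetI)
      fix z assume z: "z \<in> set_mset C"
      then obtain t where "z = complex_of_real t" using re by (auto simp: C_def Reals_def)
      moreover have "poly q z = 0" using z C \<open>q \<noteq> 0\<close> by simp
      ultimately show "z \<in> complex_of_real ` R" by (simp add: q_def R_def poly_map_poly_of_real)
    next
      fix z assume "z \<in> complex_of_real ` R"
      then show "z \<in> set_mset C" using \<open>q \<noteq> 0\<close> unfolding C by (auto simp: q_def R_def poly_map_poly_of_real)
    qed
    ultimately have cR: "card R = m" by (simp add: card_image inj_on_def)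
    have fR: "finite R" using \<open>pderiv p \<noteq> 0\<close> by (simp add: R_def poly_roots_finite)
    define x where "x i = sorted_list_of_set R ! i" for i
    have "crit m x p"
    proof (rule critI[OF p_def[THEN meta_eq_to_obj_eq]])
      show "x i < x j" if "i < j" "j < m" for i j
        unfolding x_def using that cR fR
        by (metis length_sorted_list_of_set sorted_wrt_nth_less strict_sorted_list_of_set)
      show "poly (pderiv p) (x i) = 0" if "i < m" for i
      proof -
        have "x i \<in> set (sorted_list_of_set R)" unfolding x_def by (rule nth_mem) (use that cR in simp)
        then show ?thesis using fR by (simp add: R_def)
      qed
    qed
    then show ?R using key cnt by blast
  qed
qed

section \<open>The type of a morsification and the reconstruction from values\<close>

definition pol :: "nat \<Rightarrow> param \<Rightarrow> real poly" where
  "pol m z = morsif_poly (Suc m) (fst z)"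

definition val_at :: "nat \<Rightarrow> param \<Rightarrow> nat \<Rightarrow> real" where
  "val_at m z = vals m (pol m z) (crits m (pol m z)) (snd z)"

definition ctype :: "nat \<Rightarrow> nat \<Rightarrow> param \<Rightarrow> (nat \<Rightarrow> nat) \<times> (nat \<Rightarrow> nat)" where
  "ctype m l z = ((\<lambda>j\<in>{..<l}. card {i. i < m \<and> crits m (pol m z) i < snd z (Suc j)}),
     (\<lambda>t\<in>{..<m + l}. rank_in (m + l) (val_at m z) t))"

text \<open>An injective \<open>u\<close> on ranks is a bijection, that is, a total order of all
  values. Extensionality makes equal data equal pairs.\<close>

definition types :: "nat \<Rightarrow> nat \<Rightarrow> ((nat \<Rightarrow> nat) \<times> (nat \<Rightarrow> nat)) set" where
  "types m l = {(k, u). k \<in> {..<l} \<rightarrow>\<^sub>E {..m} \<and> u \<in> {..<m + l} \<rightarrow>\<^sub>E {..<m + l} \<and>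
     inj_on u {..<m + l} \<and> zigzag m l k u}"

abbreviation "vn_space m l \<equiv> very_nice_space (Suc m) l"

lemma topspace_vn: "topspace (vn_space m l) =
   {z. fst z \<in> extensional {2..<Suc m} \<and> snd z \<in> extensional {1..l} \<and> very_nice (Suc m) l z}"
  by (auto simp: very_nice_space_def param_space_def PiE_def)

lemma vn_iff:
  "z \<in> topspace (vn_space m l) \<longleftrightarrow> fst z \<in> extensional {2..<Suc m} \<and> snd z \<in> extensional {1..l} \<and>
     (\<exists>x. crit m x (pol m z)) \<and> inj_on (val_at m z) {..<m + l}"
  using very_nice_iff[of m l "fst z" "snd z"] by (simp add: topspace_vn pol_def val_at_def)

lemma vn_crit: "z \<in> topspace (vn_space m l) \<Longrightarrow> crit m (crits m (pol m z)) (pol m z)"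
  using vn_iff crits by blast

lemma vn_ne:
  assumes z: "z \<in> topspace (vn_space m l)" and "i < m" "j < l"
  shows "snd z (Suc j) \<noteq> crits m (pol m z) i"
proof
  assume "snd z (Suc j) = crits m (pol m z) i"
  then have "val_at m z (m + j) = val_at m z i" using \<open>i < m\<close> by (simp add: val_at_def vals_def)
  then show False using z assms unfolding vn_iff by (auto dest: inj_onD)
qed

lemma vn_branch:
  assumes z: "z \<in> topspace (vn_space m l)" and "j < l"
  shows "fst (ctype m l z) j \<le> m" "in_branch m (crits m (pol m z)) (fst (ctype m l z) j) (snd z (Suc j))"
proof -
  obtain k where k: "k \<le> m" "in_branch m (crits m (pol m z)) k (snd z (Suc j))"
    using ex_in_branch vn_ne[OF z _ \<open>j < l\<close>] by blast
  moreover have "fst (ctype m l z) j = k"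
    using in_branch_card[OF vn_crit[OF z] k] \<open>j < l\<close> by (simp add: ctype_def)
  ultimately show "fst (ctype m l z) j \<le> m" "in_branch m (crits m (pol m z)) (fst (ctype m l z) j) (snd z (Suc j))" by simp_all
qed

lemma vn_zigzag:
  assumes z: "z \<in> topspace (vn_space m l)"
  shows "zigzag m l (fst (ctype m l z)) (val_at m z)"
  unfolding val_at_def by (rule zigzag_vals[OF vn_crit[OF z]]) (use vn_branch[OF z] in simp)

lemma zigzag_restrict: "zigzag m l k u \<Longrightarrow> zigzag m l k (restrict u {..<m + l})"
  by (erule zigzag_order_iso) auto

lemma ctype_in_types:
  assumes z: "z \<in> topspace (vn_space m l)"
  shows "ctype m l z \<in> types m l"
proof -
  have inj: "inj_on (val_at m z) {..<m + l}" using z vn_iff by blast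
  have "zigzag m l (fst (ctype m l z)) (rank_in (m + l) (val_at m z))"
    using vn_zigzag[OF z] by (rule zigzag_order_iso) (rule rank_in_mono)
  then have "zigzag m l (fst (ctype m l z)) (snd (ctype m l z))"
    by (simp add: ctype_def zigzag_restrict)
  moreover have "inj_on (snd (ctype m l z)) {..<m + l}"
    using rank_in_inj[OF inj] by (simp add: ctype_def inj_on_def)
  moreover have "snd (ctype m l z) \<in> {..<m + l} \<rightarrow>\<^sub>E {..<m + l}"
    using rank_in_less by (auto simp: ctype_def)
  moreover have "fst (ctype m l z) \<in> {..<l} \<rightarrow>\<^sub>E {..m}"
    using vn_branch(1)[OF z] by (auto simp: ctype_def)
  ultimately show ?thesis by (cases "ctype m l z") (simp add: types_def)
qed

definition config :: "nat \<Rightarrow> nat \<Rightarrow> (nat \<Rightarrow> nat) \<Rightarrow> (nat \<Rightarrow> real) \<Rightarrow> param" where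
  "config m l k w = (lam_of m (crit_pts m w), \<lambda>j\<in>{1..l}. bd_pt m k w (j - 1))"

text \<open>The values are realised up to the constant \<open>level_shift\<close>, since
  \<open>morsif_poly\<close> has no constant term; neither injectivity nor ranks notice the
  shift.\<close>

lemma config:
  assumes z: "zigzag m l k w" and inj: "inj_on w {..<m + l}"
  shows "config m l k w \<in> topspace (vn_space m l)"
    and "ctype m l (config m l k w) = (restrict k {..<l}, restrict (rank_in (m + l) w) {..<m + l})"
proof -
  let ?z = "config m l k w"
  have P: "pol m ?z = crit_poly m (crit_pts m w)"
    by (simp add: pol_def config_def morsif_lam_of[OF crit_pts(2)[OF z]])
  have c: "crit m (crit_pts m w) (pol m ?z)" using crit_pts(1)[OF z] by (simp add: P)
  have v: "val_at m ?z t = w t - level_shift m w" if "t < m + l" for t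
  proof (cases "t < m")
    case True
    then show ?thesis using crit_pts_value[OF z True] crits_eq[OF c True] by (simp add: val_at_def vals_def P)
  next
    case False
    then have "t - m < l" using that by simp
    then show ?thesis using bd_pt(2)[OF z \<open>t - m < l\<close>] False by (simp add: val_at_def vals_def P) (simp add: config_def)
  qed
  have "inj_on (val_at m ?z) {..<m + l}" using inj v by (simp add: inj_on_def)
  then show vn: "?z \<in> topspace (vn_space m l)"
    unfolding vn_iff using c by (auto simp: config_def lam_of_def)
  have "card {i. i < m \<and> crits m (pol m ?z) i < snd ?z (Suc j)} = k j" if j: "j < l" for j
  proof -
    have "{i. i < m \<and> crits m (pol m ?z) i < snd ?z (Suc j)} = {i. i < m \<and> crit_pts m w i < bd_pt m k w j}"
      using crits_eq[OF c] j by (auto simp: config_def)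
    then show ?thesis
      using in_branch_card[OF c _ bd_pt(1)[OF z j]] z j by (simp add: zigzag_def)
  qed
  moreover have "rank_in (m + l) (val_at m ?z) t = rank_in (m + l) w t" if "t < m + l" for t
    by (rule rank_in_cong) (use v that in auto)
  ultimately show "ctype m l ?z = (restrict k {..<l}, restrict (rank_in (m + l) w) {..<m + l})"
    unfolding ctype_def by (auto intro!: restrict_ext)
qed

text \<open>For values that come from a parameter the level shift is zero and the reconstruction is
  exact. A path in value space therefore ends at the given parameters.\<close>

lemma config_val_at:
  assumes z: "z \<in> topspace (vn_space m l)"
  shows "config m l (fst (ctype m l z)) (val_at m z) = z"
proof -
  define k where "k = fst (ctype m l z)"
  define w where "w = val_at m z"
  define x where "x = crits m (pol m z)"
  have zz: "zigzag m l k w" unfolding k_def w_def by (rule vn_zigzag[OF z])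
  have c: "crit m x (pol m z)" unfolding x_def by (rule vn_crit[OF z])
  have ext: "fst z \<in> extensional {2..<Suc m}" "snd z \<in> extensional {1..l}" using z vn_iff by blast+
  have sx: "(\<Sum>i<m. x i) = 0" and lam: "fst z = lam_of m x"
    using crit_morsif[OF c[unfolded pol_def] ext(1)] by auto
  have P: "pol m z = crit_poly m x" unfolding pol_def lam by (rule morsif_lam_of[OF sx])
  have w1: "w i = poly (crit_poly m x) (x i)" if "i < m" for i
  proof -
    have "w i = poly (pol m z) (x i)" using that by (simp add: w_def val_at_def vals_def x_def)
    then show ?thesis by (simp only: P)
  qed
  have xe: "crit_pts m w i = x i" if "i < m" for i
    by (rule crit_pts_unique[OF c[unfolded P] sx _ that]) (simp add: w1)
  then have "lin_prod m (crit_pts m w) = lin_prod m x" by (simp add: lin_prod_def)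
  then have cp: "crit_poly m (crit_pts m w) = crit_poly m x" by (simp add: crit_poly_def)
  then have l1: "lam_of m (crit_pts m w) = fst z" unfolding lam lam_of_def by simp
  have ls: "level_shift m w = 0" by (simp add: level_shift_def cp xe w1)
  have "bd_pt m k w j = snd z (Suc j)" if j: "j < l" for j
  proof (rule bd_pt_unique[OF zz j, symmetric])
    have "in_branch m x (k j) (snd z (Suc j))" "k j \<le> m"
      using vn_branch[OF z j] by (simp_all add: k_def x_def)
    then show "in_branch m (crit_pts m w) (k j) (snd z (Suc j))"
      using xe by (auto simp: in_branch_def)
    show "poly (crit_poly m (crit_pts m w)) (snd z (Suc j)) + level_shift m w = w (m + j)"
      by (simp add: cp ls) (simp add: w_def val_at_def vals_def P)
  qed
  then have "(\<lambda>j\<in>{1..l}. bd_pt m k w (j - 1)) = snd z"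
    using ext(2) by (intro extensionalityI[of _ "{1..l}"]) (auto simp: Suc_le_eq)
  then show ?thesis unfolding config_def k_def[symmetric] w_def[symmetric] l1 by simp
qed

text \<open>The ranks themselves serve as the prescribed real values.\<close>

lemma types_surj:
  assumes "(k, u) \<in> types m l"
  shows "\<exists>z\<in>topspace (vn_space m l). ctype m l z = (k, u)"
proof -
  define w where "w t = real (u t)" for t
  have u: "k \<in> {..<l} \<rightarrow>\<^sub>E {..m}" "u \<in> {..<m + l} \<rightarrow>\<^sub>E {..<m + l}" "inj_on u {..<m + l}" "zigzag m l k u"
    using assms by (auto simp: types_def)
  have zz: "zigzag m l k w" using u(4) by (rule zigzag_order_iso) (simp add: w_def)
  have inj: "inj_on w {..<m + l}" using u(3) by (simp add: w_def inj_on_def)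
  have "rank_in (m + l) w t = u t" if "t < m + l" for t
  proof -
    have "rank_in (m + l) w t = rank_in (m + l) u t" by (rule rank_in_cong) (simp add: w_def)
    also have "\<dots> = u t" by (rule rank_in_bij[OF u(3) _ that]) (use u(2) in auto)
    finally show ?thesis .
  qed
  then have "restrict (rank_in (m + l) w) {..<m + l} = u"
    using u(2) by (intro extensionalityI[of _ "{..<m + l}"]) (auto simp: PiE_def)
  moreover have "restrict k {..<l} = k" using u(1) by (simp add: PiE_def extensional_restrict)
  ultimately show ?thesis using config[OF zz inj] by auto
qed

text \<open>Two value vectors in the same order have all their convex combinations in that order,
  with the branches fixed. The segment of value vectors is carried back to the parameter space by
  \<open>config\<close>, whose coordinates are continuous in the values.\<close>

lemma fiber_path_connected:
  "path_connectedin (vn_space m l) {z \<in> topspace (vn_space m l). ctype m l z = \<tau>}"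
  unfolding path_connectedin
proof (intro conjI ballI)
  let ?F = "{z \<in> topspace (vn_space m l). ctype m l z = \<tau>}"
  show "?F \<subseteq> topspace (vn_space m l)" by auto
  fix z0 z1 assume "z0 \<in> ?F" "z1 \<in> ?F"
  then have z0: "z0 \<in> topspace (vn_space m l)" "ctype m l z0 = \<tau>" and
    z1: "z1 \<in> topspace (vn_space m l)" "ctype m l z1 = \<tau>" by auto
  define k where "k = fst \<tau>"
  define v0 where "v0 = val_at m z0"
  define v1 where "v1 = val_at m z1"
  define w where "w s t = (1 - s) * v0 t + s * v1 t" for s :: real and t
  define g where "g s = config m l k (w s)" for s
  have inj0: "inj_on v0 {..<m + l}" and inj1: "inj_on v1 {..<m + l}"
    using z0 z1 vn_iff unfolding v0_def v1_def by blast+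
  have rk: "rank_in (m + l) v0 t = rank_in (m + l) v1 t" if "t < m + l" for t
  proof -
    have "snd (ctype m l z0) t = snd (ctype m l z1) t" using z0(2) z1(2) by simp
    then show ?thesis using that by (simp add: ctype_def v0_def v1_def)
  qed
  have iso: "v0 s < v0 t \<longleftrightarrow> v1 s < v1 t" if "s < m + l" "t < m + l" for s t
    using rank_in_less_iff[OF inj0 that] rank_in_less_iff[OF inj1 that] rk that by simp
  have mono: "w s a < w s b \<longleftrightarrow> v0 a < v0 b" if "0 \<le> s" "s \<le> 1" "a < m + l" "b < m + l" for s a b
  proof -
    have *: "w s a < w s b" if "v0 a < v0 b" "a < m + l" "b < m + l" for a b
    proof -
      have "v1 a < v1 b" using iso that by simp
      show ?thesis
      proof (cases "s = 0")
        case False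
        have "(1 - s) * v0 a \<le> (1 - s) * v0 b" using \<open>s \<le> 1\<close> that(1) by (intro mult_left_mono) auto
        moreover have "s * v1 a < s * v1 b"
          using \<open>0 \<le> s\<close> False \<open>v1 a < v1 b\<close> by (intro mult_strict_left_mono) auto
        ultimately show ?thesis unfolding w_def by (rule add_le_less_mono)
      qed (use that(1) in \<open>simp add: w_def\<close>)
    qed
    show ?thesis
      using *[of a b] *[of b a] that inj_onD[OF inj0, of a b]
      by (cases "v0 a" "v0 b" rule: linorder_cases) auto
  qed
  have zz: "zigzag m l k (w s)" if "0 \<le> s" "s \<le> 1" for s
  proof -
    have "zigzag m l k v0" using vn_zigzag[OF z0(1)] z0(2) by (simp add: k_def v0_def)
    then show ?thesis by (rule zigzag_order_iso) (use mono that in auto)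
  qed
  have injw: "inj_on (w s) {..<m + l}" if "0 \<le> s" "s \<le> 1" for s
  proof (rule inj_onI)
    fix a b assume "a \<in> {..<m + l}" "b \<in> {..<m + l}" "w s a = w s b"
    then show "a = b" using mono[OF that, of a b] mono[OF that, of b a] inj_onD[OF inj0, of a b]
      by (cases "v0 a" "v0 b" rule: linorder_cases) auto
  qed
  have "w 0 = v0" "w 1 = v1" by (simp_all add: w_def fun_eq_iff)
  then have ends: "g 0 = z0" "g 1 = z1"
    using config_val_at[OF z0(1)] config_val_at[OF z1(1)] z0(2) z1(2)
    by (simp_all add: g_def k_def v0_def v1_def)
  have inF: "g s \<in> ?F" if "0 \<le> s" "s \<le> 1" for s
  proof -
    have "rank_in (m + l) (w s) t = rank_in (m + l) v0 t" if "t < m + l" for t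
      by (rule rank_in_cong) (use mono \<open>0 \<le> s\<close> \<open>s \<le> 1\<close> that in auto)
    then have "restrict (rank_in (m + l) (w s)) {..<m + l} = snd \<tau>"
      using z0(2) by (auto simp: ctype_def v0_def)
    moreover have "restrict k {..<l} = fst \<tau>" using z0(2) by (auto simp: ctype_def k_def)
    ultimately show ?thesis using config[OF zz[OF that] injw[OF that]] by (simp add: g_def)
  qed
  have zz': "\<And>s. s \<in> {0..1} \<Longrightarrow> zigzag m l k (w s)" using zz by simp
  have cw: "continuous_on {0..1} (\<lambda>s. w s t)" for t unfolding w_def by (intro continuous_intros)
  have "continuous_map (top_of_set {0..1}) (param_space (Suc m) l) g"
    unfolding g_def config_def param_space_def
  proof (rule continuous_map_pairedI)
    show "continuous_map (top_of_set {0..1}) (product_topology (\<lambda>_. euclideanreal) {2..<Suc m})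
        (\<lambda>s. lam_of m (crit_pts m (w s)))"
      unfolding continuous_map_componentwise
    proof (intro conjI ballI)
      fix i assume i: "i \<in> {2..<Suc m}"
      have "continuous_on {0..1} (\<lambda>s. coeff (crit_poly m (crit_pts m (w s))) (Suc m - i))"
        by (intro continuous_coeff_crit_poly continuous_crit_pts[OF zz'] cw)
      then show "continuous_map (top_of_set {0..1}) euclideanreal (\<lambda>s. lam_of m (crit_pts m (w s)) i)"
        using i by (simp add: lam_of_def)
    qed (auto simp: lam_of_def)
    show "continuous_map (top_of_set {0..1}) (product_topology (\<lambda>_. euclideanreal) {1..l})
        (\<lambda>s. \<lambda>j\<in>{1..l}. bd_pt m k (w s) (j - 1))"
      unfolding continuous_map_componentwise
    proof (intro conjI ballI)
      fix j assume j: "j \<in> {1..l}"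
      have "continuous_on {0..1} (\<lambda>s. bd_pt m k (w s) (j - 1))"
        by (rule continuous_bd_pt[OF zz' cw]) (use j in auto)
      then show "continuous_map (top_of_set {0..1}) euclideanreal (\<lambda>s. (\<lambda>j\<in>{1..l}. bd_pt m k (w s) (j - 1)) j)"
        using j by simp
    qed auto
  qed
  then have "pathin (vn_space m l) g"
    unfolding pathin_def very_nice_space_def continuous_map_in_subtopology
    using inF by (auto simp: topspace_vn)
  then show "\<exists>g. pathin (vn_space m l) g \<and> g \<in> {0..1} \<rightarrow> ?F \<and> g 0 = z0 \<and> g 1 = z1"
    using ends inF by (intro exI[of _ g]) auto
qed

section \<open>Openness of the fibres and the number of components\<close>

lemma openin_Collect_ball:
  assumes "finite I" "\<And>i. i \<in> I \<Longrightarrow> openin Y {z \<in> topspace Y. P i z}"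
  shows "openin Y {z \<in> topspace Y. \<forall>i\<in>I. P i z}"
  using assms
proof (induction I rule: finite_induct)
  case (insert i I)
  have "{z \<in> topspace Y. \<forall>i\<in>insert i I. P i z} = {z \<in> topspace Y. P i z} \<inter> {z \<in> topspace Y. \<forall>i\<in>I. P i z}"
    by auto
  then show ?case using insert by (simp add: openin_Int)
qed simp

lemma openin_less:
  fixes f g :: "'a \<Rightarrow> real"
  assumes "continuous_map Y euclidean f" "continuous_map Y euclidean g"
  shows "openin Y {z \<in> topspace Y. f z < g z}"
proof -
  have "continuous_map Y euclidean (\<lambda>z. g z - f z)" by (intro continuous_intros assms)
  then have "openin Y {z \<in> topspace Y. g z - f z \<in> {0<..}}"
    by (rule openin_continuous_map_preimage) simp
  then show ?thesis by simp
qed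

text \<open>Where \<open>f\<close> and \<open>g\<close> never agree, the failure of \<open><\<close>
  is again a strict inequality.\<close>

lemma openin_less_iff:
  fixes f g :: "'a \<Rightarrow> real"
  assumes "continuous_map Y euclidean f" "continuous_map Y euclidean g" "\<And>z. z \<in> topspace Y \<Longrightarrow> f z \<noteq> g z"
  shows "openin Y {z \<in> topspace Y. f z < g z \<longleftrightarrow> b}"
proof (cases b)
  case True then show ?thesis using openin_less[OF assms(1,2)] by simp
next
  case False
  have "{z \<in> topspace Y. f z < g z \<longleftrightarrow> b} = {z \<in> topspace Y. g z < f z}"
    using False by (auto simp: not_less order_le_less) (metis assms(3))
  then show ?thesis using openin_less[OF assms(2,1)] by simp
qed

text \<open>The complement of a fibre is the union of the other fibres. So fibres are clopen as well
  as connected, and the nonempty ones are the components.\<close>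

lemma card_components_eq_card_image:
  assumes op: "\<And>c. openin Y {z \<in> topspace Y. f z = c}" and con: "\<And>c. connectedin Y {z \<in> topspace Y. f z = c}"
  shows "card (connected_components_of Y) = card (f ` topspace Y)"
proof -
  have comp: "connected_component_of_set Y z = {z' \<in> topspace Y. f z' = f z}" if z: "z \<in> topspace Y" for z
  proof
    show "{z' \<in> topspace Y. f z' = f z} \<subseteq> connected_component_of_set Y z"
      by (rule connected_component_of_maximal[OF con]) (use z in simp)
    have "topspace Y - {z' \<in> topspace Y. f z' = f z} = (\<Union>c\<in>-{f z}. {z' \<in> topspace Y. f z' = c})" by auto
    moreover have "openin Y \<dots>" by (intro openin_Union) (use op in auto)
    ultimately have "closedin Y {z' \<in> topspace Y. f z' = f z}" by (simp add: closedin_def)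
    then have "connected_component_of_set Y z \<subseteq> {z' \<in> topspace Y. f z' = f z} \<or>
        disjnt (connected_component_of_set Y z) {z' \<in> topspace Y. f z' = f z}"
      using op connectedin_clopen_cases connectedin_connected_component_of by metis
    moreover have "z \<in> connected_component_of_set Y z" using z by (simp add: connected_component_of_refl)
    ultimately show "connected_component_of_set Y z \<subseteq> {z' \<in> topspace Y. f z' = f z}"
      using z by (auto simp: disjnt_iff)
  qed
  have "connected_components_of Y = (\<lambda>c. {z' \<in> topspace Y. f z' = c}) ` f ` topspace Y"
    unfolding connected_components_of_def using comp by (auto simp: image_image)
  moreover have "inj_on (\<lambda>c. {z' \<in> topspace Y. f z' = c}) (f ` topspace Y)"
    by (rule inj_onI) blast
  ultimately show ?thesis by (simp add: card_image)
qed

lemma continuous_lam: "i \<in> {2..<Suc m} \<Longrightarrow> continuous_map (vn_space m l) euclideanreal (\<lambda>z. fst z i)"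
  unfolding very_nice_space_def param_space_def
  using continuous_map_compose[OF continuous_map_fst continuous_map_product_projection[of i "{2..<Suc m}"]]
  by (intro continuous_map_from_subtopology) (simp add: o_def)

lemma continuous_bd: "j \<in> {1..l} \<Longrightarrow> continuous_map (vn_space m l) euclideanreal (\<lambda>z. snd z j)"
  unfolding very_nice_space_def param_space_def
  using continuous_map_compose[OF continuous_map_snd continuous_map_product_projection[of j "{1..l}"]]
  by (intro continuous_map_from_subtopology) (simp add: o_def)

lemma continuous_pol:
  assumes "continuous_map (vn_space m l) euclideanreal t"
  shows "continuous_map (vn_space m l) euclideanreal (\<lambda>z. poly (pol m z) (t z))"
  unfolding pol_def morsif_poly_def poly_add poly_sum poly_monom
  by (intro continuous_intros assms continuous_lam) auto

lemma pderiv_sum: "pderiv (\<Sum>i\<in>A. f i) = (\<Sum>i\<in>A. pderiv (f i))"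
  by (induction A rule: infinite_finite_induct) (simp_all add: pderiv_add)

lemma continuous_pderiv_pol:
  "continuous_map (vn_space m l) euclideanreal (\<lambda>z. poly (pderiv (pol m z)) a)"
proof -
  have "poly (pderiv (pol m z)) a = real (Suc m) * a ^ m +
      (\<Sum>i\<in>{2..<Suc m}. real (Suc m - i) * fst z i * a ^ (Suc m - i - 1))" for z
    by (simp add: pol_def morsif_poly_def pderiv_add pderiv_sum pderiv_monom poly_sum poly_monom del: of_nat_Suc)
  then show ?thesis
    by (simp only:) (intro continuous_map_add continuous_map_sum continuous_map_real_mult continuous_lam; simp)
qed

text \<open>The derivative has opposite signs at \<open>x i - d\<close> and \<open>x i + d\<close>,
  an open condition on its coefficients. With \<open>d\<close> at most half of every gap these
  intervals are disjoint, so the \<open>m\<close> zeros found for a nearby parameter are all of its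
  critical points, in the right order.\<close>

lemma continuous_crits:
  assumes "i < m"
  shows "continuous_map (vn_space m l) euclideanreal (\<lambda>z. crits m (pol m z) i)"
  unfolding mtopology_is_euclidean[symmetric] Met_TC.continuous_map_to_metric
proof (intro ballI allI impI)
  fix z0 and e :: real assume z0: "z0 \<in> topspace (vn_space m l)" and e: "0 < e"
  define x where "x = crits m (pol m z0)"
  have c: "crit m x (pol m z0)" unfolding x_def by (rule vn_crit[OF z0])
  obtain d' where d': "0 < d'" "\<forall>i<m - 1. d' < x (Suc i) - x i"
    using ex_positive_lower_bound[of "m - 1" "\<lambda>i. x (Suc i) - x i"] crit_less[OF c] by auto
  define d where "d = min e d' / 2"
  have dd: "0 < d" "2 * d \<le> e" "2 * d \<le> d'" using d'(1) e by (auto simp: d_def)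
  have d: "0 < d" "d < e" "\<And>i. Suc i < m \<Longrightarrow> x i + d < x (Suc i) - d"
  proof -
    show "x i + d < x (Suc i) - d" if "Suc i < m" for i
    proof -
      have "d' < x (Suc i) - x i" using d'(2) that by simp
      then show ?thesis using dd by linarith
    qed
  qed (use dd e in linarith)+
  define U where "U = {z \<in> topspace (vn_space m l). \<forall>i\<in>{..<m}.
      poly (pderiv (pol m z)) (x i - d) * poly (pderiv (pol m z)) (x i + d) < 0}"
  have "openin (vn_space m l) U"
    unfolding U_def
    by (intro openin_Collect_ball openin_less continuous_intros continuous_pderiv_pol) auto
  moreover have "z0 \<in> U"
  proof -
    have "poly (pderiv (pol m z0)) (x i - d) * poly (pderiv (pol m z0)) (x i + d) < 0" if i: "i < m" for i
    proof -
      have up: "x j < x i - d" if "j < i" for j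
      proof -
        have "x j \<le> x (i - 1)" by (rule crit_le[OF c]) (use that i in auto)
        then show ?thesis using d(3)[of "i - 1"] that i d(1) by simp
      qed
      have dn: "x i + d < x j" if "i < j" "j < m" for j
      proof -
        have "x (Suc i) \<le> x j" by (rule crit_le[OF c]) (use that in auto)
        then show ?thesis using d(3)[of i] that i d(1) by simp
      qed
      have 1: "0 < (-1) ^ (m + i) * (\<Prod>j<m. x i - d - x j)"
        by (rule sign_prod) (use i up dn d(1) in \<open>auto simp: le_less intro: less_trans[OF _ dn]\<close>)
      have 2: "0 < (-1) ^ (m + Suc i) * (\<Prod>j<m. x i + d - x j)"
        by (rule sign_prod) (use i up dn d(1) in \<open>auto simp: less_Suc_eq intro: less_trans[OF up]\<close>)
      have "(\<Prod>j<m. x i - d - x j) * (\<Prod>j<m. x i + d - x j) < 0"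
        using 1 2 neg_one_cases[of "m + i"] by (auto simp: mult_less_0_iff zero_less_mult_iff)
      then have "real (Suc m) * real (Suc m) * ((\<Prod>j<m. x i - d - x j) * (\<Prod>j<m. x i + d - x j)) < 0"
        by (rule mult_pos_neg[rotated]) simp
      moreover have "poly (pderiv (pol m z0)) s = real (Suc m) * (\<Prod>j<m. s - x j)" for s
        using c by (simp add: crit_def poly_lin_prod)
      ultimately show ?thesis by (simp only: mult_ac)
    qed
    then show ?thesis using z0 by (simp add: U_def)
  qed
  moreover have "crits m (pol m z) i \<in> Met_TC.mball (crits m (pol m z0) i) e" if z: "z \<in> U" for z
  proof -
    have "\<exists>t. x j - d < t \<and> t < x j + d \<and> poly (pderiv (pol m z)) t = 0" if "j < m" for j
      using poly_IVT[of "x j - d" "x j + d" "pderiv (pol m z)"] z that d(1) by (auto simp: U_def)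
    then obtain r where r: "\<And>j. j < m \<Longrightarrow> x j - d < r j \<and> r j < x j + d \<and> poly (pderiv (pol m z)) (r j) = 0"
      by metis
    have "crit m r (pol m z)"
    proof (rule critI)
      show "pol m z = morsif_poly (Suc m) (fst z)" by (simp add: pol_def)
      fix a b assume ab: "a < b" "b < m"
      have "x a + d < x (Suc a) - d" "x (Suc a) \<le> x b" using d(3)[of a] crit_le[OF c, of "Suc a" b] ab by auto
      then show "r a < r b" using r[of a] r[of b] ab by force
    qed (use r in blast)
    then have "crits m (pol m z) i = r i" using crits_eq assms by blast
    then show ?thesis using r[OF assms] d(2) by (auto simp: x_def dist_real_def abs_less_iff)
  qed
  ultimately show "\<exists>U. openin (vn_space m l) U \<and> z0 \<in> U \<and>
      (\<forall>z\<in>U. crits m (pol m z) i \<in> Met_TC.mball (crits m (pol m z0) i) e)" by blast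
qed

lemma continuous_val_at:
  assumes "t < m + l"
  shows "continuous_map (vn_space m l) euclideanreal (\<lambda>z. val_at m z t)"
  unfolding val_at_def vals_def
  by (cases "t < m") (use assms in \<open>auto intro!: continuous_pol continuous_crits continuous_bd\<close>)

text \<open>A type is determined by finitely many strict comparisons of continuous functions that
  are never equal on the space of very nice morsifications.\<close>

lemma fiber_open: "openin (vn_space m l) {z \<in> topspace (vn_space m l). ctype m l z = \<tau>}"
proof (subst openin_subopen, intro ballI)
  let ?Y = "vn_space m l"
  fix z0 assume z0: "z0 \<in> {z \<in> topspace ?Y. ctype m l z = \<tau>}"
  define N1 where "N1 = {z \<in> topspace ?Y. \<forall>(i, j)\<in>{..<m} \<times> {..<l}.
      crits m (pol m z) i < snd z (Suc j) \<longleftrightarrow> crits m (pol m z0) i < snd z0 (Suc j)}"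
  define N2 where "N2 = {z \<in> topspace ?Y. \<forall>(s, t)\<in>{(s, t). s < m + l \<and> t < m + l \<and> s \<noteq> t}.
      val_at m z s < val_at m z t \<longleftrightarrow> val_at m z0 s < val_at m z0 t}"
  have "openin ?Y N1"
    unfolding N1_def
    by (intro openin_Collect_ball) (auto intro!: openin_less_iff continuous_crits continuous_bd dest: vn_ne)
  moreover have "openin ?Y N2"
    unfolding N2_def
  proof (intro openin_Collect_ball)
    show "finite {(s, t). s < m + l \<and> t < m + l \<and> s \<noteq> t}"
      by (rule finite_subset[of _ "{..<m + l} \<times> {..<m + l}"]) auto
    fix p assume "p \<in> {(s, t). s < m + l \<and> t < m + l \<and> s \<noteq> t}"
    then obtain s t where p: "p = (s, t)" and st: "s < m + l" "t < m + l" "s \<noteq> t" by blast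
    have "openin ?Y {z \<in> topspace ?Y. val_at m z s < val_at m z t \<longleftrightarrow> val_at m z0 s < val_at m z0 t}"
    proof (rule openin_less_iff[OF continuous_val_at[OF st(1)] continuous_val_at[OF st(2)]])
      fix z assume "z \<in> topspace ?Y"
      then have "inj_on (val_at m z) {..<m + l}" using vn_iff by blast
      then show "val_at m z s \<noteq> val_at m z t" using st by (auto dest: inj_onD)
    qed
    then show "openin ?Y {z \<in> topspace ?Y. case p of (s, t) \<Rightarrow>
        val_at m z s < val_at m z t \<longleftrightarrow> val_at m z0 s < val_at m z0 t}"
      unfolding p prod.case .
  qed
  ultimately have "openin ?Y (N1 \<inter> N2)" by (rule openin_Int)
  moreover have "z0 \<in> N1 \<inter> N2" using z0 by (auto simp: N1_def N2_def)
  moreover have "N1 \<inter> N2 \<subseteq> {z \<in> topspace ?Y. ctype m l z = \<tau>}"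
  proof
    fix z assume z: "z \<in> N1 \<inter> N2"
    have "{i. i < m \<and> crits m (pol m z) i < snd z (Suc j)} = {i. i < m \<and> crits m (pol m z0) i < snd z0 (Suc j)}"
      if "j < l" for j using z that by (auto simp: N1_def)
    moreover have "rank_in (m + l) (val_at m z) t = rank_in (m + l) (val_at m z0) t" if "t < m + l" for t
    proof (rule rank_in_cong)
      fix s assume "s < m + l"
      then show "val_at m z s < val_at m z t \<longleftrightarrow> val_at m z0 s < val_at m z0 t"
        using z that by (cases "s = t") (auto simp: N2_def)
    qed
    ultimately have "ctype m l z = ctype m l z0" unfolding ctype_def by (auto intro!: restrict_ext)
    then show "z \<in> {z \<in> topspace ?Y. ctype m l z = \<tau>}" using z z0 by (auto simp: N1_def)
  qed
  ultimately show "\<exists>T. openin ?Y T \<and> z0 \<in> T \<and> T \<subseteq> {z \<in> topspace ?Y. ctype m l z = \<tau>}" by blast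
qed

theorem K_eq_card_types: "K (Suc m) l = card (types m l)"
proof -
  have "K (Suc m) l = card (ctype m l ` topspace (vn_space m l))"
    unfolding K_def
    by (rule card_components_eq_card_image)
      (rule fiber_open, rule path_connectedin_imp_connectedin, rule fiber_path_connected)
  also have "ctype m l ` topspace (vn_space m l) = types m l"
    using ctype_in_types types_surj by (force simp: image_iff)
  finally show ?thesis .
qed

subsection \<open>Counting combinatorial types\<close>

definition ranking :: "nat \<Rightarrow> (nat \<Rightarrow> 'a::linorder) \<Rightarrow> nat \<Rightarrow> nat" where
  "ranking N w = restrict (rank_in N w) {..<N}"

lemma ranking_less_iff:
  "inj_on w {..<N} \<Longrightarrow> s < N \<Longrightarrow> t < N \<Longrightarrow> ranking N w s < ranking N w t \<longleftrightarrow> w s < w t"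
  by (simp add: ranking_def rank_in_less_iff)

lemma ranking_cong:
  assumes "\<And>s t. s < N \<Longrightarrow> t < N \<Longrightarrow> v s < v t \<longleftrightarrow> w s < w t"
  shows "ranking N v = ranking N w"
  unfolding ranking_def by (intro restrict_ext rank_in_cong) (use assms in auto)

lemma finite_types: "finite (types m l)"
proof -
  have "types m l \<subseteq> ({..<l} \<rightarrow>\<^sub>E {..m}) \<times> ({..<m + l} \<rightarrow>\<^sub>E {..<m + l})" by (auto simp: types_def)
  then show ?thesis by (rule finite_subset) (auto intro!: finite_PiE)
qed

lemma typesD:
  assumes "(k, u) \<in> types m l"
  shows "k \<in> {..<l} \<rightarrow>\<^sub>E {..m}" "u \<in> {..<m + l} \<rightarrow>\<^sub>E {..<m + l}" "inj_on u {..<m + l}" "zigzag m l k u"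
    "t < m + l \<Longrightarrow> u t < m + l" "bij_betw u {..<m + l} {..<m + l}"
proof -
  show *: "k \<in> {..<l} \<rightarrow>\<^sub>E {..m}" "u \<in> {..<m + l} \<rightarrow>\<^sub>E {..<m + l}" "inj_on u {..<m + l}" "zigzag m l k u"
    using assms by (auto simp: types_def)
  then show "t < m + l \<Longrightarrow> u t < m + l" by auto
  have "u ` {..<m + l} = {..<m + l}" using * by (intro endo_inj_surj) auto
  then show "bij_betw u {..<m + l} {..<m + l}" using * by (simp add: bij_betw_def)
qed

lemma types_eq_iff: "(k, u) \<in> types m l \<Longrightarrow> s < m + l \<Longrightarrow> t < m + l \<Longrightarrow> u s = u t \<longleftrightarrow> s = t"
  using typesD(3) by (metis inj_on_eq_iff lessThan_iff)

lemma ranking_types: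
  assumes "(k, u) \<in> types m l"
  shows "ranking (m + l) u = u"
  unfolding ranking_def
  by (rule extensionalityI[of _ "{..<m + l}"])
    (use typesD[OF assms] in \<open>auto simp: PiE_def intro!: rank_in_bij\<close>)

lemma ranking_in_types:
  assumes "zigzag m l k w" "inj_on w {..<m + l}" "k \<in> {..<l} \<rightarrow>\<^sub>E {..m}"
  shows "(k, ranking (m + l) w) \<in> types m l"
proof -
  have "zigzag m l k (ranking (m + l) w)"
    using assms(1) by (rule zigzag_order_iso) (simp add: ranking_less_iff assms(2))
  moreover have "inj_on (ranking (m + l) w) {..<m + l}"
    using rank_in_inj[OF assms(2)] by (simp add: ranking_def inj_on_def)
  ultimately show ?thesis using assms(3) by (auto simp: types_def ranking_def rank_in_less)
qed

lemma sum_card_swap: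
  assumes "finite A" "finite B"
  shows "(\<Sum>a\<in>A. card {b \<in> B. P a b}) = (\<Sum>b\<in>B. card {a \<in> A. P a b})"
proof -
  have "(\<Sum>a\<in>A. card {b \<in> B. P a b}) = (\<Sum>a\<in>A. \<Sum>b\<in>B. if P a b then 1 else 0)"
    using assms by (simp add: sum.If_cases Collect_conj_eq Int_commute)
  also have "\<dots> = (\<Sum>b\<in>B. \<Sum>a\<in>A. if P a b then 1 else 0)" by (rule sum.swap)
  also have "\<dots> = (\<Sum>b\<in>B. card {a \<in> A. P a b})"
    using assms by (simp add: sum.If_cases Collect_conj_eq Int_commute)
  finally show ?thesis .
qed

section \<open>Rises and falls in the order of values\<close>

definition is_max :: "nat \<Rightarrow> nat \<Rightarrow> bool" where
  "is_max m t \<longleftrightarrow> t < m \<and> even (m + t)"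

text \<open>The neighbours on the graph: exactly the pairs whose comparison \<open>zigzag\<close>
  prescribes directly, in either order.\<close>

definition linked :: "nat \<Rightarrow> nat \<Rightarrow> (nat \<Rightarrow> nat) \<Rightarrow> nat \<Rightarrow> nat \<Rightarrow> bool" where
  "linked m l k s t \<longleftrightarrow> s < m \<and> t < m \<and> (t = Suc s \<or> s = Suc t) \<or>
     (\<exists>j<l. s = m + j \<and> t < m \<and> (t = k j \<or> Suc t = k j) \<or> t = m + j \<and> s < m \<and> (s = k j \<or> Suc s = k j))"

lemma zigzagD:
  assumes "zigzag m l k w"
  shows "Suc i < m \<Longrightarrow> lt (even (m + Suc i)) (w i) (w (Suc i))"
    and "j < l \<Longrightarrow> k j \<le> m"
    and "j < l \<Longrightarrow> 0 < k j \<Longrightarrow> lt (even (m + k j)) (w (k j - 1)) (w (m + j))"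
    and "j < l \<Longrightarrow> k j < m \<Longrightarrow> lt (even (m + k j)) (w (m + j)) (w (k j))"
  using assms unfolding zigzag_def by blast+

lemma linked_sym: "linked m l k s t \<longleftrightarrow> linked m l k t s"
  unfolding linked_def by blast

lemma linkedI:
  shows "Suc i < m \<Longrightarrow> linked m l k i (Suc i)"
    and "j < l \<Longrightarrow> 0 < k j \<Longrightarrow> k j \<le> m \<Longrightarrow> linked m l k (k j - 1) (m + j)"
    and "j < l \<Longrightarrow> k j < m \<Longrightarrow> linked m l k (m + j) (k j)"
proof -
  show "Suc i < m \<Longrightarrow> linked m l k i (Suc i)" by (simp add: linked_def)
  assume j: "j < l"
  show "linked m l k (k j - 1) (m + j)" if "0 < k j" "k j \<le> m"
    unfolding linked_def by (rule disjI2, rule exI[of _ j]) (use that j in simp)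
  show "linked m l k (m + j) (k j)" if "k j < m"
    unfolding linked_def by (rule disjI2, rule exI[of _ j]) (use that j in simp)
qed

lemma linked_less: "linked m l k s t \<Longrightarrow> s < m + l"
  by (auto simp: linked_def)

lemma zigzag_linked:
  assumes z: "zigzag m l k w" and o: "\<And>s t. linked m l k s t \<Longrightarrow> w s < w t \<Longrightarrow> v s < v t"
  shows "zigzag m l k v"
proof -
  have lt: "lt e (v s) (v t)" if "lt e (w s) (w t)" "linked m l k s t" for e s t
  proof (cases e)
    case True then show ?thesis using o[of s t] that by (simp add: lt_def)
  next
    case False then show ?thesis using o[of t s] that linked_sym[of m l k s t] by (simp add: lt_def)
  qed
  show ?thesis unfolding zigzag_def
  proof (intro conjI allI impI)
    fix i assume i: "Suc i < m"
    show "lt (even (m + Suc i)) (v i) (v (Suc i))"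
      by (rule lt[OF zigzagD(1)[OF z i] linkedI(1)[OF i]])
  next
    fix j assume j: "j < l"
    show k: "k j \<le> m" by (rule zigzagD(2)[OF z j])
    show "lt (even (m + k j)) (v (k j - 1)) (v (m + j))" if "0 < k j"
      by (rule lt[OF zigzagD(3)[OF z j that] linkedI(2)[where k = k, OF j that k]])
    show "lt (even (m + k j)) (v (m + j)) (v (k j))" if "k j < m"
      by (rule lt[OF zigzagD(4)[OF z j that] linkedI(3)[where k = k, OF j that]])
  qed
qed

text \<open>A local maximum is the upper end of every branch it bounds. Consequently a fall, with a
  maximum immediately below a non-maximum, never has linked bearers.\<close>

lemma linked_max:
  assumes z: "zigzag m l k u" and "linked m l k x y" "\<not> is_max m x" "is_max m y"
  shows "u x < u y"
proof -
  have y: "y < m" "even (m + y)" using assms(4) by (simp_all add: is_max_def)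
  consider (a) "x < m" "y = Suc x" | (b) "x < m" "x = Suc y"
    | (c) j where "j < l" "x = m + j" "k j = y" | (d) j where "j < l" "x = m + j" "k j = Suc y"
    using assms(2) y(1) unfolding linked_def by auto
  then show ?thesis
  proof cases
    case a then show ?thesis using zigzagD(1)[OF z, of x] y by (simp add: lt_def)
  next
    case b then show ?thesis using zigzagD(1)[OF z, of y] y by (simp add: lt_def)
  next
    case c then show ?thesis using zigzagD(4)[OF z c(1)] y by (simp add: lt_def)
  next
    case d then show ?thesis using zigzagD(3)[OF z d(1)] y by (simp add: lt_def)
  qed
qed

text \<open>Two consecutive values can be exchanged unless their bearers are linked.\<close>

lemma card_swap:
  assumes xy: "x < m + l" "y < m + l" "x \<noteq> y"
  shows "card {(k, u) \<in> types m l. \<not> linked m l k x y \<and> u y = Suc (u x)} =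
    card {(k, u) \<in> types m l. \<not> linked m l k x y \<and> u x = Suc (u y)}"
proof (rule bij_betw_same_card)
  define f where "f = (\<lambda>(k :: nat \<Rightarrow> nat, u :: nat \<Rightarrow> nat). (k, u \<circ> Transposition.transpose x y))"
  have mem: "(k, u \<circ> Transposition.transpose x y) \<in> types m l"
    if T: "(k, u) \<in> types m l" and nl: "\<not> linked m l k x y" and con: "u y = Suc (u x) \<or> u x = Suc (u y)" for k u
  proof -
    have tr: "Transposition.transpose x y t < m + l \<longleftrightarrow> t < m + l" for t using xy by (auto simp: Transposition.transpose_def)
    have "zigzag m l k (u \<circ> Transposition.transpose x y)"
    proof (rule zigzag_linked[OF typesD(4)[OF T]])
      fix s t assume st: "linked m l k s t" "u s < u t"
      then have lt: "s < m + l" "t < m + l" using linked_less linked_sym by blast+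
      have "\<not> (s = x \<and> t = y)" "\<not> (s = y \<and> t = x)" using st(1) nl linked_sym by blast+
      moreover have ne: "u r \<noteq> u x" "u r \<noteq> u y" "Transposition.transpose x y r = r"
        if "r < m + l" "r \<notin> {x, y}" for r
        using types_eq_iff[OF T that(1)] xy that by (simp_all add: Transposition.transpose_def)
      moreover have tin: "u (Transposition.transpose x y r) = u x \<or> u (Transposition.transpose x y r) = u y"
        if "r \<in> {x, y}" for r
        using that by (auto simp: Transposition.transpose_def)
      \<comment> \<open>No third entry has a value between those of \<open>x\<close> and
        \<open>y\<close>, so comparisons with a third entry survive the exchange.\<close>
      ultimately consider "s \<in> {x, y}" "t \<notin> {x, y}" | "s \<notin> {x, y}" "t \<in> {x, y}" | "s \<notin> {x, y}" "t \<notin> {x, y}"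
        using st(2) by auto
      then show "(u \<circ> Transposition.transpose x y) s < (u \<circ> Transposition.transpose x y) t"
      proof cases
        case 1
        then have "u s = u x \<or> u s = u y" by auto
        then have "u (Transposition.transpose x y s) < u t"
          using con st(2) tin[OF 1(1)] ne(1,2)[OF \<open>t < m + l\<close> 1(2)] by linarith
        then show ?thesis using ne(3)[OF \<open>t < m + l\<close> 1(2)] by simp
      next
        case 2
        then have "u t = u x \<or> u t = u y" by auto
        then have "u s < u (Transposition.transpose x y t)"
          using con st(2) tin[OF 2(2)] ne(1,2)[OF \<open>s < m + l\<close> 2(1)] by linarith
        then show ?thesis using ne(3)[OF \<open>s < m + l\<close> 2(1)] by simp
      next
        case 3
        then show ?thesis using ne(3) \<open>s < m + l\<close> \<open>t < m + l\<close> st(2) by simp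
      qed
    qed
    moreover have "inj_on (u \<circ> Transposition.transpose x y) {..<m + l}"
    proof (rule comp_inj_on)
      show "inj_on u (Transposition.transpose x y ` {..<m + l})"
        by (rule inj_on_subset[OF typesD(3)[OF T]]) (use tr in auto)
    qed simp
    moreover have "u \<circ> Transposition.transpose x y \<in> {..<m + l} \<rightarrow>\<^sub>E {..<m + l}"
      using typesD(2)[OF T] tr by (auto simp: PiE_iff extensional_def)
    ultimately show ?thesis using typesD(1)[OF T] by (simp add: types_def)
  qed
  show "bij_betw f {(k, u) \<in> types m l. \<not> linked m l k x y \<and> u y = Suc (u x)}
      {(k, u) \<in> types m l. \<not> linked m l k x y \<and> u x = Suc (u y)}"
  proof (rule bij_betw_byWitness[where f' = f])
    show "f ` {(k, u) \<in> types m l. \<not> linked m l k x y \<and> u y = Suc (u x)} \<subseteq>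
        {(k, u) \<in> types m l. \<not> linked m l k x y \<and> u x = Suc (u y)}"
    proof (rule image_subsetI)
      fix a assume "a \<in> {(k, u) \<in> types m l. \<not> linked m l k x y \<and> u y = Suc (u x)}"
      then obtain k u where a: "a = (k, u)" "(k, u) \<in> types m l" "\<not> linked m l k x y" "u y = Suc (u x)" by blast
      then have "(k, u \<circ> Transposition.transpose x y) \<in> types m l" by (intro mem) simp_all
      then show "f a \<in> {(k, u) \<in> types m l. \<not> linked m l k x y \<and> u x = Suc (u y)}"
        using a by (simp add: f_def)
    qed
    show "f ` {(k, u) \<in> types m l. \<not> linked m l k x y \<and> u x = Suc (u y)} \<subseteq>
        {(k, u) \<in> types m l. \<not> linked m l k x y \<and> u y = Suc (u x)}"
    proof (rule image_subsetI)
      fix a assume "a \<in> {(k, u) \<in> types m l. \<not> linked m l k x y \<and> u x = Suc (u y)}"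
      then obtain k u where a: "a = (k, u)" "(k, u) \<in> types m l" "\<not> linked m l k x y" "u x = Suc (u y)" by blast
      then have "(k, u \<circ> Transposition.transpose x y) \<in> types m l" by (intro mem) simp_all
      then show "f a \<in> {(k, u) \<in> types m l. \<not> linked m l k x y \<and> u y = Suc (u x)}"
        using a by (simp add: f_def)
    qed
  qed (auto simp: f_def comp_def)
qed

text \<open>Rises and falls alternate and, as \<open>Q 0\<close> fails, begin with a rise; the last
  value of \<open>Q\<close> decides whether one rise remains unmatched.\<close>

lemma count_rises_falls:
  fixes Q :: "nat \<Rightarrow> bool"
  assumes "\<not> Q 0" "N > 0"
  shows "card {r. Suc r < N \<and> \<not> Q r \<and> Q (Suc r)} =
    card {r. Suc r < N \<and> Q r \<and> \<not> Q (Suc r)} + (if Q (N - 1) then 1 else 0)"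
  using assms(2)
proof (induction N rule: nat_induct_non_zero)
  case 1 then show ?case using assms(1) by simp
next
  case (Suc N)
  define R where "R A B = {r. Suc r < N \<and> A r \<and> B (Suc r)}" for A B :: "nat \<Rightarrow> bool"
  have fin: "finite (R A B)" for A B
    unfolding R_def by (rule finite_subset[of _ "{..N}"]) auto
  have out: "N - 1 \<notin> R A B" for A B using Suc.hyps by (simp add: R_def)
  have step: "{r. Suc r < Suc N \<and> A r \<and> B (Suc r)} = (if A (N - 1) \<and> B N then insert (N - 1) (R A B) else R A B)"
    for A B :: "nat \<Rightarrow> bool"
  proof (rule Set.set_eqI)
    fix r
    show "r \<in> {r. Suc r < Suc N \<and> A r \<and> B (Suc r)} \<longleftrightarrow>
        r \<in> (if A (N - 1) \<and> B N then insert (N - 1) (R A B) else R A B)"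
    proof (cases "r = N - 1")
      case True then show ?thesis using Suc.hyps by (simp add: R_def)
    next
      case False
      then have "Suc r < Suc N \<longleftrightarrow> Suc r < N" using Suc.hyps by linarith
      then show ?thesis using False by (simp add: R_def)
    qed
  qed
  have "card (R (\<lambda>r. \<not> Q r) Q) = card (R Q (\<lambda>r. \<not> Q r)) + (if Q (N - 1) then 1 else 0)"
    using Suc.IH by (simp add: R_def)
  then show ?case
    unfolding step[of "\<lambda>r. \<not> Q r" Q] step[of Q "\<lambda>r. \<not> Q r"]
    using fin out by (cases "Q (N - 1)"; cases "Q N") simp_all
qed

text \<open>With \<open>m \<ge> 2\<close> a local maximum has a neighbouring minimum. So the lowest
  rank is not a maximum, as \<open>count_rises_falls\<close> requires.\<close>

lemma is_max_above:
  assumes T: "(k, u) \<in> types m l" and "m \<ge> 2" "is_max m t"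
  shows "\<exists>s<m + l. u s < u t"
proof (cases t)
  case 0
  then have "u 1 < u t" using zigzagD(1)[OF typesD(4)[OF T], of 0] assms by (simp add: lt_def is_max_def)
  then show ?thesis using \<open>m \<ge> 2\<close> by (intro exI[of _ 1]) auto
next
  case (Suc i)
  then have "u i < u t" using zigzagD(1)[OF typesD(4)[OF T], of i] assms by (simp add: lt_def is_max_def)
  then show ?thesis using Suc assms(3) by (intro exI[of _ i]) (auto simp: is_max_def)
qed

text \<open>A local minimum likewise has a neighbouring maximum, so the highest rank belongs to a
  maximum or to a boundary point.\<close>

lemma not_is_max_below:
  assumes T: "(k, u) \<in> types m l" and "m \<ge> 2" "\<not> is_max m t" "t < m"
  shows "\<exists>s<m + l. u t < u s"
proof (cases t)
  case 0
  then have "u t < u 1" using zigzagD(1)[OF typesD(4)[OF T], of 0] assms by (simp add: lt_def is_max_def)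
  then show ?thesis using \<open>m \<ge> 2\<close> by (intro exI[of _ 1]) auto
next
  case (Suc i)
  then have "u t < u i" using zigzagD(1)[OF typesD(4)[OF T], of i] assms by (simp add: lt_def is_max_def)
  then show ?thesis using Suc assms(4) by (intro exI[of _ i]) auto
qed

text \<open>\<open>N\<close> exceeds all ranks and stands for the value of a branch that is unbounded above.\<close>

definition branch_top :: "nat \<Rightarrow> nat \<Rightarrow> nat \<Rightarrow> (nat \<Rightarrow> nat) \<Rightarrow> nat" where
  "branch_top m N \<kappa> u =
     (if even (m + \<kappa>) then (if \<kappa> < m then u \<kappa> else N) else (if 0 < \<kappa> then u (\<kappa> - 1) else N))"

text \<open>One set of bearers indexes both rises (\<open>u y = Suc (u x)\<close>) and falls
  (\<open>u x = Suc (u y)\<close>), so that \<open>card_swap\<close> can match them pair by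
  pair.\<close>

definition pairs :: "nat \<Rightarrow> nat \<Rightarrow> (nat \<times> nat) set" where
  "pairs m N = {(x, y). x < N \<and> y < N \<and> \<not> is_max m x \<and> is_max m y}"

definition consecutive :: "(nat \<Rightarrow> nat) \<Rightarrow> nat \<Rightarrow> bool" where
  "consecutive u i \<longleftrightarrow> u i = Suc (u (Suc i)) \<or> u (Suc i) = Suc (u i)"

lemma finite_pairs: "finite (pairs m N)"
  by (rule finite_subset[of _ "{..<N} \<times> {..<N}"]) (auto simp: pairs_def)

text \<open>Reading bearers off the ranks reduces this to \<open>count_rises_falls\<close>. The
  correction stands on the left in the same form as in \<open>linked_rises\<close>, which avoids
  subtraction of natural numbers.\<close>

lemma rises_falls:
  assumes T: "(k, u) \<in> types m l" and "m \<ge> 2"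
  shows "card {(x, y) \<in> pairs m (m + l). u y = Suc (u x)} + (if \<exists>t. is_max m t \<and> u t = m + l - 1 then 0 else 1) =
    card {(x, y) \<in> pairs m (m + l). u x = Suc (u y)} + 1"
proof -
  define N where "N = m + l"
  define v where "v = inv_into {..<N} u"
  have uN: "u t < N" if "t < N" for t using typesD(5)[OF T] that by (simp add: N_def)
  have inj: "inj_on u {..<N}" and surj: "u ` {..<N} = {..<N}"
    using typesD(6)[OF T] by (simp_all add: N_def bij_betw_def)
  have vu: "v (u t) = t" if "t < N" for t using inj that by (simp add: v_def)
  have uv: "u (v r) = r" "v r < N" if "r < N" for r
    using surj that f_inv_into_f[of r u "{..<N}"] inv_into_into[of r u "{..<N}"] by (auto simp: v_def)
  define Q where "Q r = is_max m (v r)" for r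
  have max_lt: "is_max m t \<Longrightarrow> t < N" for t by (simp add: is_max_def N_def)
  have "N > 0" using \<open>m \<ge> 2\<close> by (simp add: N_def)
  have Q0: "\<not> Q 0"
    using is_max_above[OF T \<open>m \<ge> 2\<close>, of "v 0"] uv[OF \<open>N > 0\<close>] by (auto simp: Q_def)
  have "bij_betw (\<lambda>(x, y). u x) {(x, y) \<in> pairs m N. u y = Suc (u x)} {r. Suc r < N \<and> \<not> Q r \<and> Q (Suc r)}"
  proof (rule bij_betw_byWitness[where f' = "\<lambda>r. (v r, v (Suc r))"])
    show "\<forall>a\<in>{(x, y) \<in> pairs m N. u y = Suc (u x)}. (\<lambda>r. (v r, v (Suc r))) (case a of (x, y) \<Rightarrow> u x) = a"
    proof
      fix a assume "a \<in> {(x, y) \<in> pairs m N. u y = Suc (u x)}"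
      then obtain x y where a: "a = (x, y)" "(x, y) \<in> pairs m N" "u y = Suc (u x)" by auto
      then show "(\<lambda>r. (v r, v (Suc r))) (case a of (x, y) \<Rightarrow> u x) = a"
        using vu[of x] vu[of y] by (auto simp: pairs_def)
    qed
    show "(\<lambda>(x, y). u x) ` {(x, y) \<in> pairs m N. u y = Suc (u x)} \<subseteq> {r. Suc r < N \<and> \<not> Q r \<and> Q (Suc r)}"
    proof clarify
      fix x y assume xy: "(x, y) \<in> pairs m N" "u y = Suc (u x)"
      then show "Suc (u x) < N \<and> \<not> Q (u x) \<and> Q (Suc (u x))"
        using vu[of x] vu[of y] uN[of y] by (auto simp: pairs_def Q_def)
    qed
  qed (auto simp: pairs_def Q_def uv)
  then have r: "card {(x, y) \<in> pairs m N. u y = Suc (u x)} = card {r. Suc r < N \<and> \<not> Q r \<and> Q (Suc r)}"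
    by (rule bij_betw_same_card)
  have "bij_betw (\<lambda>(x, y). u y) {(x, y) \<in> pairs m N. u x = Suc (u y)} {r. Suc r < N \<and> Q r \<and> \<not> Q (Suc r)}"
  proof (rule bij_betw_byWitness[where f' = "\<lambda>r. (v (Suc r), v r)"])
    show "\<forall>a\<in>{(x, y) \<in> pairs m N. u x = Suc (u y)}. (\<lambda>r. (v (Suc r), v r)) (case a of (x, y) \<Rightarrow> u y) = a"
    proof
      fix a assume "a \<in> {(x, y) \<in> pairs m N. u x = Suc (u y)}"
      then obtain x y where a: "a = (x, y)" "(x, y) \<in> pairs m N" "u x = Suc (u y)" by auto
      then show "(\<lambda>r. (v (Suc r), v r)) (case a of (x, y) \<Rightarrow> u y) = a"
        using vu[of x] vu[of y] by (auto simp: pairs_def)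
    qed
    show "(\<lambda>(x, y). u y) ` {(x, y) \<in> pairs m N. u x = Suc (u y)} \<subseteq> {r. Suc r < N \<and> Q r \<and> \<not> Q (Suc r)}"
    proof clarify
      fix x y assume xy: "(x, y) \<in> pairs m N" "u x = Suc (u y)"
      then show "Suc (u y) < N \<and> Q (u y) \<and> \<not> Q (Suc (u y))"
        using vu[of x] vu[of y] uN[of x] by (auto simp: pairs_def Q_def)
    qed
  qed (auto simp: pairs_def Q_def uv)
  then have f: "card {(x, y) \<in> pairs m N. u x = Suc (u y)} = card {r. Suc r < N \<and> Q r \<and> \<not> Q (Suc r)}"
    by (rule bij_betw_same_card)
  have last: "(\<exists>t. is_max m t \<and> u t = N - 1) \<longleftrightarrow> Q (N - 1)"
    using uv[of "N - 1"] vu max_lt \<open>N > 0\<close> unfolding Q_def by (metis diff_less zero_less_one)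
  show ?thesis
    unfolding N_def[symmetric] r f last using count_rises_falls[of Q N] Q0 \<open>N > 0\<close> by auto
qed

text \<open>A linked rise joins two neighbouring critical points or leads from a boundary point to
  the critical point topping its branch. The correction term accounts for the one remaining
  possibility, a boundary point immediately below the fictitious top of an unbounded branch, that
  is, one of highest rank.\<close>

lemma linked_rises:
  assumes T: "(k, u) \<in> types m l" and "m \<ge> 2"
  shows "card {(x, y) \<in> pairs m (m + l). linked m l k x y \<and> u y = Suc (u x)} +
      (if \<exists>t. is_max m t \<and> u t = m + l - 1 then 0 else 1) =
    card {i \<in> {..<m - 1}. consecutive u i} + card {j \<in> {..<l}. Suc (u (m + j)) = branch_top m (m + l) (k j) u}"
proof -
  define N where "N = m + l"
  note eq = types_eq_iff[OF T, folded N_def]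
  have uN: "u t < N" if "t < N" for t using typesD(5)[OF T] that by (simp add: N_def)
  have kj: "k j \<le> m" if "j < l" for j using typesD(1)[OF T] that by auto
  have z: "zigzag m l k u" by (rule typesD(4)[OF T])
  define A1 where "A1 = {(x, y) \<in> pairs m N. x < m \<and> (y = Suc x \<or> x = Suc y) \<and> u y = Suc (u x)}"
  define A2 where "A2 = {(x, y) \<in> pairs m N. (\<exists>j<l. x = m + j \<and> (y = k j \<or> Suc y = k j)) \<and> u y = Suc (u x)}"
  define B where "B j \<longleftrightarrow> Suc (u (m + j)) = branch_top m N (k j) u" for j
  have A: "{(x, y) \<in> pairs m N. linked m l k x y \<and> u y = Suc (u x)} = A1 \<union> A2"
    by (auto simp: A1_def A2_def linked_def pairs_def is_max_def)
  have disj: "A1 \<inter> A2 = {}" by (auto simp: A1_def A2_def)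
  have fin: "finite A1" "finite A2"
    by (rule finite_subset[OF _ finite_pairs[of m N]], auto simp: A1_def A2_def)+
  have "bij_betw (\<lambda>(x, y). min x y) A1 {i \<in> {..<m - 1}. consecutive u i}"
  proof (rule bij_betw_byWitness[where f' = "\<lambda>i. if even (m + i) then (Suc i, i) else (i, Suc i)"])
    show "\<forall>a\<in>A1. (if even (m + (case a of (x, y) \<Rightarrow> min x y)) then (Suc (case a of (x, y) \<Rightarrow> min x y), case a of (x, y) \<Rightarrow> min x y)
        else (case a of (x, y) \<Rightarrow> min x y, Suc (case a of (x, y) \<Rightarrow> min x y))) = a"
      by (auto simp: A1_def pairs_def is_max_def)
    show "(\<lambda>(x, y). min x y) ` A1 \<subseteq> {i \<in> {..<m - 1}. consecutive u i}"
      by (auto simp: A1_def pairs_def is_max_def consecutive_def)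
    show "(\<lambda>i. if even (m + i) then (Suc i, i) else (i, Suc i)) ` {i \<in> {..<m - 1}. consecutive u i} \<subseteq> A1"
    proof (rule image_subsetI)
      fix i assume "i \<in> {i \<in> {..<m - 1}. consecutive u i}"
      then have i: "i < m - 1" "consecutive u i" by auto
      then have "lt (even (m + Suc i)) (u i) (u (Suc i))" using zigzagD(1)[OF z, of i] by simp
      then show "(if even (m + i) then (Suc i, i) else (i, Suc i)) \<in> A1"
        using i by (auto simp: A1_def pairs_def is_max_def consecutive_def lt_def N_def)
    qed
  qed auto
  then have c1: "card A1 = card {i \<in> {..<m - 1}. consecutive u i}" by (rule bij_betw_same_card)
  \<comment> \<open>The upper end of branch \<open>k j\<close>, unless that branch is unbounded
    above.\<close>
  define e where "e j = (if even (m + k j) then k j else k j - 1)" for j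
  have top: "(branch_top m N (k j) u = N) \<or>
      (is_max m (e j) \<and> branch_top m N (k j) u = u (e j) \<and> (e j = k j \<or> Suc (e j) = k j))"
    if "j < l" for j
  proof (cases "even (m + k j)")
    case True
    then show ?thesis by (cases "k j < m") (simp_all add: branch_top_def e_def is_max_def)
  next
    case False
    then show ?thesis using kj[OF that] by (cases "k j") (simp_all add: branch_top_def e_def is_max_def)
  qed
  have top': "branch_top m N (k j) u = u y"
    if "j < l" "is_max m y" "y = k j \<or> Suc y = k j" for j y
  proof (cases "y = k j")
    case True then show ?thesis using that by (auto simp: branch_top_def is_max_def)
  next
    case False
    then have "k j = Suc y" using that by auto
    then show ?thesis using that by (simp add: branch_top_def is_max_def)
  qed
  have e: "e j = y" if "is_max m y" "y = k j \<or> Suc y = k j" for j y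
  proof (cases "y = k j")
    case True then show ?thesis using that by (auto simp: e_def is_max_def)
  next
    case False
    then have "k j = Suc y" using that by auto
    then show ?thesis using that by (simp add: e_def is_max_def)
  qed
  have bij2: "bij_betw (\<lambda>(x, y). x - m) A2 {j \<in> {..<l}. B j \<and> branch_top m N (k j) u < N}"
  proof (rule bij_betw_byWitness[where f' = "\<lambda>j. (m + j, e j)"])
    show "\<forall>a\<in>A2. (\<lambda>j. (m + j, e j)) (case a of (x, y) \<Rightarrow> x - m) = a"
    proof
      fix a assume "a \<in> A2"
      then obtain x y j where "a = (x, y)" "x = m + j" "is_max m y" "y = k j \<or> Suc y = k j"
        by (auto simp: A2_def pairs_def)
      then show "(\<lambda>j. (m + j, e j)) (case a of (x, y) \<Rightarrow> x - m) = a" using e by simp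
    qed
    show "(\<lambda>(x, y). x - m) ` A2 \<subseteq> {j \<in> {..<l}. B j \<and> branch_top m N (k j) u < N}"
    proof (rule image_subsetI)
      fix a assume "a \<in> A2"
      then obtain x y j where j: "a = (x, y)" "j < l" "x = m + j" "y = k j \<or> Suc y = k j" "u y = Suc (u x)" "is_max m y" "y < N"
        by (auto simp: A2_def pairs_def)
      have "branch_top m N (k j) u = u y" by (rule top'[OF j(2,6,4)])
      then show "(case a of (x, y) \<Rightarrow> x - m) \<in> {j \<in> {..<l}. B j \<and> branch_top m N (k j) u < N}"
        using j uN[OF j(7)] by (simp add: B_def)
    qed
    show "(\<lambda>j. (m + j, e j)) ` {j \<in> {..<l}. B j \<and> branch_top m N (k j) u < N} \<subseteq> A2"
    proof (rule image_subsetI)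
      fix j assume "j \<in> {j \<in> {..<l}. B j \<and> branch_top m N (k j) u < N}"
      then have j: "j < l" "B j" "branch_top m N (k j) u < N" by auto
      then have "is_max m (e j)" "branch_top m N (k j) u = u (e j)" "e j = k j \<or> Suc (e j) = k j"
        using top[of j] by auto
      then show "(m + j, e j) \<in> A2"
        using j unfolding A2_def pairs_def B_def by (simp add: is_max_def N_def)
    qed
  qed auto
  then have c2: "card A2 = card {j \<in> {..<l}. B j \<and> branch_top m N (k j) u < N}" by (rule bij_betw_same_card)
  \<comment> \<open>Rank \<open>N - 1\<close> belongs to a maximum or else to a single boundary
    point, whose branch must be unbounded above since a critical top would have a higher
    rank.\<close>
  have c3: "card {j \<in> {..<l}. B j \<and> \<not> branch_top m N (k j) u < N} = (if \<exists>t. is_max m t \<and> u t = N - 1 then 0 else 1)"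
  proof (cases "\<exists>t. is_max m t \<and> u t = N - 1")
    case True
    then obtain t where t: "t < m" "u t = N - 1" by (auto simp: is_max_def)
    have "u (m + j) \<noteq> N - 1" if "j < l" for j
      using eq[of "m + j" t] t that by (simp add: N_def)
    moreover have "B j \<Longrightarrow> \<not> branch_top m N (k j) u < N \<Longrightarrow> u (m + j) = N - 1" if "j < l" for j
      using top[OF that] uN by (fastforce simp: B_def is_max_def N_def)
    ultimately have "{j \<in> {..<l}. B j \<and> \<not> branch_top m N (k j) u < N} = {}" by auto
    then show ?thesis using True by simp
  next
    case False
    have "N > 0" using \<open>m \<ge> 2\<close> by (simp add: N_def)
    then have "N - 1 \<in> u ` {..<N}" using typesD(6)[OF T] by (simp add: N_def bij_betw_def)
    then obtain t where t: "t < N" "u t = N - 1" by auto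
    have "t \<ge> m"
    proof (rule ccontr)
      assume "\<not> t \<ge> m"
      then obtain s where "s < N" "u t < u s"
        using not_is_max_below[OF T \<open>m \<ge> 2\<close>, of t] False t by (auto simp: N_def)
      then show False using uN[of s] t by simp
    qed
    then obtain j where j: "t = m + j" "j < l" using t by (metis N_def add_less_cancel_left le_Suc_ex)
    have "branch_top m N (k j) u = N"
    proof (rule ccontr)
      assume "branch_top m N (k j) u \<noteq> N"
      then have ej: "is_max m (e j)" "e j = k j \<or> Suc (e j) = k j" using top[OF j(2)] by auto
      have "linked m l k t (e j)" "\<not> is_max m t" "e j < N"
        using ej j by (auto simp: linked_def is_max_def N_def)
      then show False using linked_max[OF z, of t "e j"] ej uN[of "e j"] t by auto
    qed
    then have "{j \<in> {..<l}. B j \<and> \<not> branch_top m N (k j) u < N} = {j}"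
    proof -
      have uq: "j' = j" if "j' < l" "B j'" "\<not> branch_top m N (k j') u < N" for j'
      proof -
        have "branch_top m N (k j') u = N" using top[OF that(1)] that(3) uN by (fastforce simp: is_max_def N_def)
        then have "u (m + j') = u t" using that(2) t by (simp add: B_def)
        then show ?thesis using eq[of "m + j'" t] that(1) t j by (simp add: N_def)
      qed
      have Bj: "B j" using \<open>branch_top m N (k j) u = N\<close> t j \<open>N > 0\<close> by (simp add: B_def)
      show ?thesis
      proof (intro equalityI subsetI)
        fix j' assume "j' \<in> {j \<in> {..<l}. B j \<and> \<not> branch_top m N (k j) u < N}"
        then have "j' < l" "B j'" "\<not> branch_top m N (k j') u < N" by simp_all
        then have "j' = j" by (rule uq)
        then show "j' \<in> {j}" by simp
      next
        fix j' assume "j' \<in> {j}"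
        then show "j' \<in> {j \<in> {..<l}. B j \<and> \<not> branch_top m N (k j) u < N}"
          using Bj j(2) \<open>branch_top m N (k j) u = N\<close> by simp
      qed
    qed
    then show ?thesis using False by simp
  qed
  define B1 where "B1 = {j \<in> {..<l}. B j \<and> branch_top m N (k j) u < N}"
  define B2 where "B2 = {j \<in> {..<l}. B j \<and> \<not> branch_top m N (k j) u < N}"
  have "{j \<in> {..<l}. B j} = B1 \<union> B2" "B1 \<inter> B2 = {}" "finite B1" "finite B2"
    unfolding B1_def B2_def by auto
  then have "card {j \<in> {..<l}. B j} = card A2 + (if \<exists>t. is_max m t \<and> u t = N - 1 then 0 else 1)"
    using card_Un_disjoint[of B1 B2] c2 c3 unfolding B1_def[symmetric] B2_def[symmetric] by simp
  then show ?thesis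
    unfolding N_def[symmetric] A card_Un_disjoint[OF fin disj] c1 B_def by simp
qed

lemma card_split: "finite A \<Longrightarrow> card {a \<in> A. P a} = card {a \<in> A. Q a \<and> P a} + card {a \<in> A. \<not> Q a \<and> P a}"
  by (subst card_Un_disjoint[symmetric]) (auto intro!: arg_cong[where f = card])

text \<open>Let R, F, L and D be the sums over all types of the rises, the falls, the linked rises
  and the corrections. Then R + D equals F plus the number of types by \<open>rises_falls\<close>,
  and R = L + F by exchanging the order of summation and cancelling unlinked rises against falls. So
  the number of types is L + D, which \<open>linked_rises\<close> evaluates.\<close>

theorem card_types_eq:
  assumes "m \<ge> 2"
  shows "card (types m l) = (\<Sum>i<m - 1. card {\<tau> \<in> types m l. consecutive (snd \<tau>) i}) +
    (\<Sum>j<l. card {\<tau> \<in> types m l. Suc (snd \<tau> (m + j)) = branch_top m (m + l) (fst \<tau> j) (snd \<tau>)})"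
proof -
  let ?T = "types m l" and ?P = "pairs m (m + l)"
  define last where "last \<tau> = (if \<exists>t. is_max m t \<and> snd \<tau> t = m + l - 1 then 0 else 1 :: nat)" for \<tau> :: "(nat \<Rightarrow> nat) \<times> (nat \<Rightarrow> nat)"
  define up where "up \<tau> p \<longleftrightarrow> snd \<tau> (snd p) = Suc (snd \<tau> (fst p))" for \<tau> :: "(nat \<Rightarrow> nat) \<times> (nat \<Rightarrow> nat)" and p :: "nat \<times> nat"
  define dn where "dn \<tau> p \<longleftrightarrow> snd \<tau> (fst p) = Suc (snd \<tau> (snd p))" for \<tau> :: "(nat \<Rightarrow> nat) \<times> (nat \<Rightarrow> nat)" and p :: "nat \<times> nat"
  define lk where "lk \<tau> p \<longleftrightarrow> linked m l (fst \<tau>) (fst p) (snd p)" for \<tau> :: "(nat \<Rightarrow> nat) \<times> (nat \<Rightarrow> nat)" and p :: "nat \<times> nat"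
  note fin = finite_types[of m l] finite_pairs[of m "m + l"]
  have rf: "card {p \<in> ?P. up \<tau> p} + last \<tau> = card {p \<in> ?P. dn \<tau> p} + 1" if "\<tau> \<in> ?T" for \<tau>
    using rises_falls[of "fst \<tau>" "snd \<tau>" m l] that \<open>m \<ge> 2\<close>
    by (simp add: last_def up_def dn_def case_prod_beta')
  have lr: "card {p \<in> ?P. lk \<tau> p \<and> up \<tau> p} + last \<tau> =
    card {i \<in> {..<m - 1}. consecutive (snd \<tau>) i} + card {j \<in> {..<l}. Suc (snd \<tau> (m + j)) = branch_top m (m + l) (fst \<tau> j) (snd \<tau>)}"
    if "\<tau> \<in> ?T" for \<tau>
    using linked_rises[of "fst \<tau>" "snd \<tau>" m l] that \<open>m \<ge> 2\<close>
    by (simp add: last_def up_def lk_def case_prod_beta')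
  have sw: "card {\<tau> \<in> ?T. up \<tau> p} = card {\<tau> \<in> ?T. lk \<tau> p \<and> up \<tau> p} + card {\<tau> \<in> ?T. dn \<tau> p}" if p: "p \<in> ?P" for p
  proof -
    obtain x y where xy: "p = (x, y)" "x < m + l" "y < m + l" "\<not> is_max m x" "is_max m y"
      using p by (auto simp: pairs_def)
    have "card {\<tau> \<in> ?T. \<not> lk \<tau> p \<and> up \<tau> p} = card {\<tau> \<in> ?T. \<not> lk \<tau> p \<and> dn \<tau> p}"
      using card_swap[OF xy(2,3), of] xy(4,5) by (force simp: xy(1) lk_def up_def dn_def case_prod_beta')
    moreover have "{\<tau> \<in> ?T. \<not> lk \<tau> p \<and> dn \<tau> p} = {\<tau> \<in> ?T. dn \<tau> p}"
    proof (intro equalityI subsetI)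
      fix \<tau> assume t: "\<tau> \<in> {\<tau> \<in> ?T. dn \<tau> p}"
      then have "zigzag m l (fst \<tau>) (snd \<tau>)" using typesD(4)[of "fst \<tau>" "snd \<tau>"] by simp
      then have "\<not> lk \<tau> p"
        using linked_max[of m l "fst \<tau>" "snd \<tau>" x y] xy t by (auto simp: lk_def dn_def)
      then show "\<tau> \<in> {\<tau> \<in> ?T. \<not> lk \<tau> p \<and> dn \<tau> p}" using t by simp
    qed simp
    ultimately show ?thesis using card_split[OF fin(1), of "\<lambda>\<tau>. up \<tau> p" "\<lambda>\<tau>. lk \<tau> p"] by simp
  qed
  have "(\<Sum>\<tau>\<in>?T. card {p \<in> ?P. up \<tau> p}) = (\<Sum>p\<in>?P. card {\<tau> \<in> ?T. up \<tau> p})"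
    by (rule sum_card_swap[OF fin])
  also have "\<dots> = (\<Sum>p\<in>?P. card {\<tau> \<in> ?T. lk \<tau> p \<and> up \<tau> p}) + (\<Sum>p\<in>?P. card {\<tau> \<in> ?T. dn \<tau> p})"
    by (simp add: sw sum.distrib)
  also have "\<dots> = (\<Sum>\<tau>\<in>?T. card {p \<in> ?P. lk \<tau> p \<and> up \<tau> p}) + (\<Sum>\<tau>\<in>?T. card {p \<in> ?P. dn \<tau> p})"
    by (simp only: sum_card_swap[OF fin])
  finally have 1: "(\<Sum>\<tau>\<in>?T. card {p \<in> ?P. up \<tau> p}) =
      (\<Sum>\<tau>\<in>?T. card {p \<in> ?P. lk \<tau> p \<and> up \<tau> p}) + (\<Sum>\<tau>\<in>?T. card {p \<in> ?P. dn \<tau> p})" .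
  have "(\<Sum>\<tau>\<in>?T. card {p \<in> ?P. up \<tau> p}) + (\<Sum>\<tau>\<in>?T. last \<tau>) = (\<Sum>\<tau>\<in>?T. card {p \<in> ?P. dn \<tau> p} + 1)"
    unfolding sum.distrib[symmetric] by (rule sum.cong) (use rf in auto)
  then have 2: "(\<Sum>\<tau>\<in>?T. card {p \<in> ?P. up \<tau> p}) + (\<Sum>\<tau>\<in>?T. last \<tau>) = (\<Sum>\<tau>\<in>?T. card {p \<in> ?P. dn \<tau> p}) + card ?T"
    by (simp only: sum.distrib card_eq_sum[symmetric])
  have "(\<Sum>\<tau>\<in>?T. card {p \<in> ?P. lk \<tau> p \<and> up \<tau> p}) + (\<Sum>\<tau>\<in>?T. last \<tau>) =
      (\<Sum>\<tau>\<in>?T. card {i \<in> {..<m - 1}. consecutive (snd \<tau>) i}) +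
      (\<Sum>\<tau>\<in>?T. card {j \<in> {..<l}. Suc (snd \<tau> (m + j)) = branch_top m (m + l) (fst \<tau> j) (snd \<tau>)})"
    unfolding sum.distrib[symmetric] by (rule sum.cong) (use lr in auto)
  also have "(\<Sum>\<tau>\<in>?T. card {i \<in> {..<m - 1}. consecutive (snd \<tau>) i}) = (\<Sum>i<m - 1. card {\<tau> \<in> ?T. consecutive (snd \<tau>) i})"
    by (rule sum_card_swap[OF fin(1)]) simp
  also have "(\<Sum>\<tau>\<in>?T. card {j \<in> {..<l}. Suc (snd \<tau> (m + j)) = branch_top m (m + l) (fst \<tau> j) (snd \<tau>)}) =
      (\<Sum>j<l. card {\<tau> \<in> ?T. Suc (snd \<tau> (m + j)) = branch_top m (m + l) (fst \<tau> j) (snd \<tau>)})"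
    by (rule sum_card_swap[OF fin(1)]) simp
  finally show ?thesis using 1 2 by linarith
qed

lemma ranking_bij:
  assumes "inj_on w {..<N}"
  shows "ranking N w ` {..<N} = {..<N}"
proof (rule endo_inj_surj)
  show "ranking N w ` {..<N} \<subseteq> {..<N}" by (auto simp: ranking_def rank_in_less)
  show "inj_on (ranking N w) {..<N}" using rank_in_inj[OF assms] by (simp add: ranking_def inj_on_def)
qed simp

lemma ranking_Suc:
  assumes inj: "inj_on w {..<N}" and a: "a < N" "e < N" "w a < w e"
    and no: "\<And>t. t < N \<Longrightarrow> \<not> (w a < w t \<and> w t < w e)"
  shows "Suc (ranking N w a) = ranking N w e"
proof (rule ccontr)
  assume ne: "Suc (ranking N w a) \<noteq> ranking N w e"
  have "ranking N w a < ranking N w e" using ranking_less_iff[OF inj a(1,2)] a(3) by simp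
  then have lt: "Suc (ranking N w a) < ranking N w e" using ne by simp
  moreover have "ranking N w e \<in> {..<N}" using ranking_bij[OF inj] a(2) by blast
  ultimately have "Suc (ranking N w a) \<in> ranking N w ` {..<N}" using ranking_bij[OF inj] by simp
  then obtain t where t: "t < N" "ranking N w t = Suc (ranking N w a)" by auto
  then have "w a < w t" "w t < w e"
    using ranking_less_iff[OF inj a(1) t(1)] ranking_less_iff[OF inj t(1) a(2)] lt by simp_all
  then show False using no[OF t(1)] by simp
qed

lemma ranking_top:
  assumes inj: "inj_on w {..<N}" and a: "a < N" and no: "\<And>t. t < N \<Longrightarrow> \<not> w a < w t"
  shows "Suc (ranking N w a) = N"
proof (rule ccontr)
  assume ne: "Suc (ranking N w a) \<noteq> N"
  have "ranking N w a \<in> {..<N}" using ranking_bij[OF inj] a by blast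
  then have "Suc (ranking N w a) \<in> ranking N w ` {..<N}" using ranking_bij[OF inj] ne by simp
  then obtain t where t: "t < N" "ranking N w t = Suc (ranking N w a)" by auto
  then have "w a < w t" using ranking_less_iff[OF inj a t(1)] by simp
  then show False using no[OF t(1)] by simp
qed

lemma branch_top_cases:
  assumes "\<kappa> \<le> m"
  obtains (unbounded) "\<And>N u. branch_top m N \<kappa> u = N" | (crit) e where "e < m" "\<And>N u. branch_top m N \<kappa> u = u e"
proof (cases "even (m + \<kappa>)")
  case True
  show ?thesis
  proof (cases "\<kappa> < m")
    assume "\<kappa> < m" then show ?thesis using crit[of \<kappa>] True by (simp add: branch_top_def)
  next
    assume "\<not> \<kappa> < m" then show ?thesis using unbounded True by (simp add: branch_top_def)
  qed
next
  case False
  show ?thesis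
  proof (cases "0 < \<kappa>")
    assume "0 < \<kappa>" then show ?thesis using crit[of "\<kappa> - 1"] False assms by (simp add: branch_top_def)
  next
    assume "\<not> 0 < \<kappa>" then show ?thesis using unbounded False by (simp add: branch_top_def)
  qed
qed

section \<open>Erasing and inserting a boundary point\<close>

definition skip :: "nat \<Rightarrow> nat \<Rightarrow> nat" where
  "skip a i = (if i < a then i else Suc i)"

definition unskip :: "nat \<Rightarrow> nat \<Rightarrow> nat" where
  "unskip a i = (if i < a then i else i - 1)"

lemma skip_simps [simp]: "skip a i \<noteq> a" "unskip a (skip a i) = i" "i \<noteq> a \<Longrightarrow> skip a (unskip a i) = i"
  by (auto simp: skip_def unskip_def)

lemma skip_eq_iff [simp]: "skip a i = skip a j \<longleftrightarrow> i = j"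
  by (metis skip_simps(2))

lemma skip_less: "a < Suc n \<Longrightarrow> i < n \<Longrightarrow> skip a i < Suc n"
  by (simp add: skip_def)

lemma unskip_less: "i < Suc n \<Longrightarrow> i \<noteq> a \<Longrightarrow> a < Suc n \<Longrightarrow> unskip a i < n"
  by (cases "i < a") (auto simp: unskip_def)

lemma skip_shift: "skip (m + j) (m + i) = m + skip j i"
  by (simp add: skip_def)

lemma skip_id: "t < a \<Longrightarrow> skip a t = t" "t < a \<Longrightarrow> unskip a t = t"
  by (simp_all add: skip_def unskip_def)

text \<open>A boundary point whose value lies immediately below the top of its branch can be erased, and
  conversely it is inserted there in a unique way.\<close>

lemma card_insert_boundary:
  assumes j: "j < Suc l" and \<kappa>: "\<kappa> \<le> m"
  shows "card {\<tau> \<in> types m (Suc l). fst \<tau> j = \<kappa> \<and> Suc (snd \<tau> (m + j)) = branch_top m (m + Suc l) \<kappa> (snd \<tau>)} =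
    card (types m l)" (is "card ?B = card ?T")
proof (rule bij_betw_same_card)
  let ?N = "m + Suc l" and ?a = "m + j"
  \<comment> \<open>Doubling makes room: old entries become odd and the new one even, just below the
    top \<open>2 * u e + 1\<close> of its branch. For an unbounded branch the value
    \<open>2 * (m + l)\<close> exceeds every old entry.\<close>
  define w where "w u t = (if t = ?a then 2 * branch_top m (m + l) \<kappa> u else 2 * u (unskip ?a t) + 1)"
    for u :: "nat \<Rightarrow> nat" and t
  define er where "er = (\<lambda>(k :: nat \<Rightarrow> nat, u :: nat \<Rightarrow> nat).
      (restrict (\<lambda>i. k (skip j i)) {..<l}, ranking (m + l) (\<lambda>t. u (skip ?a t))))"
  define ins where "ins = (\<lambda>(k :: nat \<Rightarrow> nat, u :: nat \<Rightarrow> nat).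
      (restrict (\<lambda>i. if i = j then \<kappa> else k (unskip j i)) {..<Suc l}, ranking ?N (w u)))"
  have aN: "?a < Suc (m + l)" using j by simp
  have inj_skip: "inj_on (\<lambda>t. u (skip ?a t)) {..<m + l}" if "(k, u) \<in> types m (Suc l)" for k u
  proof (rule inj_onI)
    fix s t assume "s \<in> {..<m + l}" "t \<in> {..<m + l}" "u (skip ?a s) = u (skip ?a t)"
    then show "s = t" using types_eq_iff[OF that, of "skip ?a s" "skip ?a t"] skip_less[OF aN] by simp
  qed
  have er_in: "er (k, u) \<in> ?T" if T: "(k, u) \<in> types m (Suc l)" for k u
  proof -
    note z = typesD(4)[OF T]
    let ?k = "restrict (\<lambda>i. k (skip j i)) {..<l}"
    have "zigzag m l ?k (\<lambda>t. u (skip ?a t))"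
      unfolding zigzag_def
    proof (intro conjI allI impI)
      fix i assume i: "Suc i < m"
      then show "lt (even (m + Suc i)) (u (skip ?a i)) (u (skip ?a (Suc i)))"
        using zigzagD(1)[OF z i] by (simp add: skip_id)
    next
      fix i assume i: "i < l"
      have si: "skip j i < Suc l" by (rule skip_less[OF j i])
      show "?k i \<le> m" using zigzagD(2)[OF z si] i by simp
      show "lt (even (m + ?k i)) (u (skip ?a (?k i - 1))) (u (skip ?a (m + i)))" if "0 < ?k i"
      proof -
        have "?k i - 1 < ?a" using \<open>?k i \<le> m\<close> that by simp
        then show ?thesis using zigzagD(3)[OF z si] that i by (simp add: skip_id skip_shift)
      qed
      show "lt (even (m + ?k i)) (u (skip ?a (m + i))) (u (skip ?a (?k i)))" if "?k i < m"
        using zigzagD(4)[OF z si] that i by (simp add: skip_id skip_shift)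
    qed
    moreover have "?k \<in> {..<l} \<rightarrow>\<^sub>E {..m}"
      using zigzagD(2)[OF z skip_less[OF j]] by auto
    ultimately show ?thesis
      unfolding er_def prod.case using inj_skip[OF T] by (intro ranking_in_types)
  qed
  have inj_w: "inj_on (w u) {..<?N}" if T: "(k, u) \<in> ?T" for k u
  proof (rule inj_onI)
    fix s t assume st: "s \<in> {..<?N}" "t \<in> {..<?N}" "w u s = w u t"
    have odd: "2 * x \<noteq> 2 * y + 1" "2 * y + 1 \<noteq> 2 * x" for x y :: nat by presburger+
    show "s = t"
    proof (cases "s = ?a \<or> t = ?a")
      case True
      then show ?thesis using st(3) odd by (auto simp: w_def split: if_splits)
    next
      case False
      then have "u (unskip ?a s) = u (unskip ?a t)" using st(3) by (simp add: w_def)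
      then have "unskip ?a s = unskip ?a t"
        using types_eq_iff[OF T, of "unskip ?a s" "unskip ?a t"] unskip_less[OF _ _ aN] st False by simp
      then show ?thesis using False skip_simps(3)[of s ?a] skip_simps(3)[of t ?a] by metis
    qed
  qed
  have wcrit: "w u i = 2 * u i + 1" if "i < m" for u i using that by (simp add: w_def skip_id)
  have zig_w: "zigzag m (Suc l) (fst (ins (k, u))) (w u)" if T: "(k, u) \<in> ?T" for k u
    unfolding zigzag_def
  proof (intro conjI allI impI)
    note z = typesD(4)[OF T]
    have uN: "i < m \<Longrightarrow> u i < m + l" for i using typesD(5)[OF T] by simp
    let ?k = "fst (ins (k, u))"
    fix i assume i: "Suc i < m"
    then show "lt (even (m + Suc i)) (w u i) (w u (Suc i))"
      using zigzagD(1)[OF z i] by (simp add: wcrit lt_def split: if_splits)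
  next
    note z = typesD(4)[OF T]
    have uN: "i < m \<Longrightarrow> u i < m + l" for i using typesD(5)[OF T] by simp
    let ?k = "fst (ins (k, u))"
    fix i assume i: "i < Suc l"
    show "?k i \<le> m" and "0 < ?k i \<Longrightarrow> lt (even (m + ?k i)) (w u (?k i - 1)) (w u (m + i))"
      and "?k i < m \<Longrightarrow> lt (even (m + ?k i)) (w u (m + i)) (w u (?k i))"
    proof (atomize (full), cases "i = j")
      case True
      then have ki: "?k i = \<kappa>" using j by (simp add: ins_def)
      have wa: "w u (m + i) = 2 * branch_top m (m + l) \<kappa> u" using True by (simp add: w_def)
      have mid: "lt (even (m + \<kappa>)) (u (\<kappa> - 1)) (u \<kappa>)" if "0 < \<kappa>" "\<kappa> < m"
        using zigzagD(1)[OF z, of "\<kappa> - 1"] that by simp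
      have "lt (even (m + \<kappa>)) (w u (\<kappa> - 1)) (w u (m + i))" if "0 < \<kappa>"
      proof (cases "even (m + \<kappa>)")
        case True
        then have "u (\<kappa> - 1) < branch_top m (m + l) \<kappa> u"
          using mid uN[of "\<kappa> - 1"] that \<kappa> by (auto simp: branch_top_def lt_def)
        then show ?thesis using True that \<kappa> unfolding wa by (simp add: wcrit lt_def)
      next
        case False
        then show ?thesis using that \<kappa> unfolding wa by (simp add: wcrit lt_def branch_top_def)
      qed
      moreover have "lt (even (m + \<kappa>)) (w u (m + i)) (w u \<kappa>)" if "\<kappa> < m"
      proof (cases "even (m + \<kappa>)")
        case True
        then show ?thesis using that unfolding wa by (simp add: wcrit lt_def branch_top_def)
      next
        case False
        then have "u \<kappa> < branch_top m (m + l) \<kappa> u"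
          using mid uN[of \<kappa>] that by (auto simp: branch_top_def lt_def)
        then show ?thesis using False that unfolding wa by (simp add: wcrit lt_def)
      qed
      ultimately show "?k i \<le> m \<and> (0 < ?k i \<longrightarrow> lt (even (m + ?k i)) (w u (?k i - 1)) (w u (m + i))) \<and>
          (?k i < m \<longrightarrow> lt (even (m + ?k i)) (w u (m + i)) (w u (?k i)))"
        unfolding ki using \<kappa> by blast
    next
      case False
      define i' where "i' = unskip j i"
      have i': "i' < l" unfolding i'_def by (rule unskip_less[OF i False j])
      have ki: "?k i = k i'" using i False by (simp add: ins_def i'_def)
      have "unskip ?a (m + i) = m + i'" by (simp add: unskip_def i'_def) (use False in auto)
      then have wi: "w u (m + i) = 2 * u (m + i') + 1" using False by (simp add: w_def)
      have "lt (even (m + k i')) (w u (k i' - 1)) (w u (m + i))" if "0 < k i'"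
        using zigzagD(3)[OF z i' that] zigzagD(2)[OF z i'] that by (simp add: wcrit wi lt_def split: if_splits)
      moreover have "lt (even (m + k i')) (w u (m + i)) (w u (k i'))" if "k i' < m"
        using zigzagD(4)[OF z i' that] that by (simp add: wcrit wi lt_def split: if_splits)
      ultimately show "?k i \<le> m \<and> (0 < ?k i \<longrightarrow> lt (even (m + ?k i)) (w u (?k i - 1)) (w u (m + i))) \<and>
          (?k i < m \<longrightarrow> lt (even (m + ?k i)) (w u (m + i)) (w u (?k i)))"
        unfolding ki using zigzagD(2)[OF z i'] by blast
    qed
  qed
  have ins_in: "ins (k, u) \<in> ?B" if T: "(k, u) \<in> ?T" for k u
  proof -
    have "fst (ins (k, u)) \<in> {..<Suc l} \<rightarrow>\<^sub>E {..m}"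
      using zigzagD(2)[OF zig_w[OF T]] by (auto simp: ins_def)
    then have "(fst (ins (k, u)), ranking ?N (w u)) \<in> types m (Suc l)"
      by (rule ranking_in_types[OF zig_w[OF T] inj_w[OF T]])
    moreover have "Suc (ranking ?N (w u) ?a) = branch_top m ?N \<kappa> (ranking ?N (w u))"
      using \<kappa>
    proof (cases rule: branch_top_cases)
      case unbounded
      have "\<not> w u ?a < w u t" if "t < ?N" for t
      proof (cases "t = ?a")
        case False
        then have "u (unskip ?a t) < m + l" using typesD(5)[OF T unskip_less[OF _ False aN]] that by simp
        then show ?thesis using False by (simp add: w_def unbounded)
      qed simp
      then show ?thesis unfolding unbounded using j by (intro ranking_top inj_w[OF T]) auto
    next
      case (crit e)
      have "w u ?a = 2 * u e" by (simp add: w_def crit)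
      moreover have "w u e = 2 * u e + 1" by (rule wcrit[OF crit(1)])
      ultimately show ?thesis unfolding crit using j crit(1) by (intro ranking_Suc inj_w[OF T]) auto
    qed
    ultimately show ?thesis using j by (simp add: ins_def)
  qed
  show "bij_betw er ?B ?T"
  proof (rule bij_betw_byWitness[where f' = ins])
    show "er ` ?B \<subseteq> ?T"
    proof (rule image_subsetI)
      fix \<tau> assume "\<tau> \<in> ?B"
      then show "er \<tau> \<in> ?T" using er_in[of "fst \<tau>" "snd \<tau>"] by simp
    qed
    show "ins ` ?T \<subseteq> ?B"
    proof (rule image_subsetI)
      fix \<tau> assume "\<tau> \<in> ?T"
      then show "ins \<tau> \<in> ?B" using ins_in[of "fst \<tau>" "snd \<tau>"] by simp
    qed
    show "\<forall>\<tau>\<in>?T. er (ins \<tau>) = \<tau>"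
    proof
      fix \<tau> assume "\<tau> \<in> ?T"
      then obtain k u where \<tau>: "\<tau> = (k, u)" and T: "(k, u) \<in> ?T" by (cases \<tau>) auto
      have "(\<lambda>i. (fst (ins (k, u))) (skip j i)) i = k i" if "i < l" for i
        using skip_less[OF j that] by (simp add: ins_def)
      then have "restrict (\<lambda>i. (fst (ins (k, u))) (skip j i)) {..<l} = restrict k {..<l}"
        by (intro restrict_ext) simp
      also have "\<dots> = k" using typesD(1)[OF T] by (simp add: PiE_def extensional_restrict)
      finally have 1: "restrict (\<lambda>i. (fst (ins (k, u))) (skip j i)) {..<l} = k" .
      have "ranking (m + l) (\<lambda>t. ranking ?N (w u) (skip ?a t)) = ranking (m + l) u"
      proof (rule ranking_cong)
        fix s t assume "s < m + l" "t < m + l"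
        then have "ranking ?N (w u) (skip ?a s) < ranking ?N (w u) (skip ?a t) \<longleftrightarrow> w u (skip ?a s) < w u (skip ?a t)"
          using skip_less[OF aN] by (intro ranking_less_iff inj_w[OF T]) simp_all
        then show "ranking ?N (w u) (skip ?a s) < ranking ?N (w u) (skip ?a t) \<longleftrightarrow> u s < u t"
          by (simp add: w_def)
      qed
      then have 2: "ranking (m + l) (\<lambda>t. ranking ?N (w u) (skip ?a t)) = u" by (simp add: ranking_types[OF T])
      show "er (ins \<tau>) = \<tau>" using 1 2 by (simp add: \<tau> er_def ins_def)
    qed
    show "\<forall>\<tau>\<in>?B. ins (er \<tau>) = \<tau>"
    proof
      fix \<tau> assume "\<tau> \<in> ?B"
      then obtain k u where \<tau>: "\<tau> = (k, u)" and T: "(k, u) \<in> types m (Suc l)" and kj: "k j = \<kappa>"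
        and top: "Suc (u ?a) = branch_top m ?N \<kappa> u" by (cases \<tau>) auto
      define k' where "k' = restrict (\<lambda>i. k (skip j i)) {..<l}"
      define u' where "u' = ranking (m + l) (\<lambda>t. u (skip ?a t))"
      have er: "er \<tau> = (k', u')" by (simp add: \<tau> er_def k'_def u'_def)
      have "(if i = j then \<kappa> else k' (unskip j i)) = k i" if "i < Suc l" for i
        using unskip_less[OF that _ j] kj by (simp add: k'_def)
      then have "restrict (\<lambda>i. if i = j then \<kappa> else k' (unskip j i)) {..<Suc l} = restrict k {..<Suc l}"
        by (intro restrict_ext) simp
      also have "\<dots> = k" using typesD(1)[OF T] by (simp add: PiE_def extensional_restrict)
      finally have 1: "restrict (\<lambda>i. if i = j then \<kappa> else k' (unskip j i)) {..<Suc l} = k" .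
      have u': "u' (unskip ?a s) < u' (unskip ?a t) \<longleftrightarrow> u s < u t" if "s < ?N" "t < ?N" "s \<noteq> ?a" "t \<noteq> ?a" for s t
        unfolding u'_def using that unskip_less[OF _ _ aN]
        by (subst ranking_less_iff[OF inj_skip[OF T]]) simp_all
      have u'N: "u' s < m + l" if "s < m + l" for s
        using that by (simp add: u'_def ranking_def rank_in_less)
      have uN: "u s < ?N" if "s < ?N" for s using typesD(5)[OF T that] .
      have ne: "u s \<noteq> u ?a" if "s < ?N" "s \<noteq> ?a" for s using types_eq_iff[OF T that(1), of ?a] that j by simp
      \<comment> \<open>Since entry \<open>?a\<close> is immediately below the top, the entries
        above it are exactly those not below the top. This locates the reinserted point
        uniquely.\<close>
      have cmp: "branch_top m (m + l) \<kappa> u' \<le> u' (unskip ?a t) \<longleftrightarrow> u ?a < u t" if t: "t < ?N" "t \<noteq> ?a" for t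
        using \<kappa>
      proof (cases rule: branch_top_cases)
        case unbounded
        then show ?thesis
          using u'N[OF unskip_less[OF _ t(2) aN]] uN[OF t(1)] top t(1) by simp
      next
        case (crit e)
        have "u' e \<le> u' (unskip ?a t) \<longleftrightarrow> u e \<le> u t"
          using u'[of t e] t crit(1) by (auto simp: skip_id not_less[symmetric])
        then show ?thesis using top unfolding crit by auto
      qed
      have "ranking ?N (w u') = ranking ?N u"
      proof (rule ranking_cong)
        fix s t assume st: "s < ?N" "t < ?N"
        consider "s = ?a" "t = ?a" | "s = ?a" "t \<noteq> ?a" | "s \<noteq> ?a" "t = ?a" | "s \<noteq> ?a" "t \<noteq> ?a" by blast
        then show "w u' s < w u' t \<longleftrightarrow> u s < u t"
        proof cases
          case 2
          then show ?thesis using cmp[OF st(2)] by (simp add: w_def) linarith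
        next
          case 3
          then show ?thesis using cmp[OF st(1)] ne[OF st(1)] by (simp add: w_def) linarith
        next
          case 4
          then show ?thesis using u'[OF st] by (simp add: w_def)
        qed simp
      qed
      then have 2: "ranking ?N (w u') = u" using ranking_types[OF T] by simp
      show "ins (er \<tau>) = \<tau>" unfolding er unfolding ins_def prod.case 1 2 \<tau> ..
    qed
  qed
qed

text \<open>Two adjacent critical points with consecutive values cancel, leaving a regular point on a
  monotone branch; conversely a boundary point can be replaced by such a pair.\<close>

lemma card_merge_critical:
  assumes i: "i \<le> m"
  shows "card {\<tau> \<in> types (Suc (Suc m)) l. consecutive (snd \<tau>) i} = card {\<tau> \<in> types m (Suc l). fst \<tau> l = i}"
    (is "card ?C = card ?D")
proof (rule bij_betw_same_card)
  let ?M = "Suc (Suc m)"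
  let ?N = "?M + l" and ?N' = "m + Suc l" and ?b = "m + l"
  define e where "e = even (m + i)"
  \<comment> \<open>Old index of each new entry: the new boundary point, which gets the last label,
    is represented by \<open>i\<close>, and from \<open>i\<close> on all indices skip the cancelled
    pair.\<close>
  define sg where "sg t = (if t = ?b then i else if t < i then t else Suc (Suc t))" for t
  \<comment> \<open>Inverse of \<open>sg\<close> away from the pair \<open>i\<close>,
    \<open>Suc i\<close>.\<close>
  define rs where "rs s = (if s < i then s else s - 2)" for s :: nat
  \<comment> \<open>The value at \<open>?b\<close> is doubled and split into two consecutive values
    for the pair. The upper one goes to \<open>i\<close> exactly when \<open>i\<close> is a local
    maximum, that is, when \<open>e\<close> holds.\<close>
  define w where "w u s = (if s = i then 2 * u ?b + (if e then 1 else 0) else if s = Suc i then 2 * u ?b + (if e then 0 else 1)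
      else 2 * u (rs s))" for u :: "nat \<Rightarrow> nat" and s
  \<comment> \<open>Cancelling the pair joins the branches \<open>i\<close>, \<open>Suc i\<close>
    and \<open>Suc (Suc i)\<close> into branch \<open>i\<close>; the middle one carries no boundary
    point.\<close>
  define kc where "kc k j = (if j = l then i else if k j \<le> i then k j else k j - 2)" for k :: "nat \<Rightarrow> nat" and j
  \<comment> \<open>Conversely, a boundary point on branch \<open>i\<close> lies before or after the
    inserted pair according to whether its value comes before or after that of \<open>?b\<close> in
    the direction \<open>e\<close> of the branch.\<close>
  define ke where "ke k u j = (if k j < i then k j else if i < k j then Suc (Suc (k j))
      else if e \<longleftrightarrow> u (m + j) < u ?b then i else Suc (Suc i))" for k u :: "nat \<Rightarrow> nat" and j
  define mer where "mer = (\<lambda>(k :: nat \<Rightarrow> nat, u :: nat \<Rightarrow> nat). (restrict (kc k) {..<Suc l}, ranking ?N' (\<lambda>t. u (sg t))))"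
  define spl where "spl = (\<lambda>(k :: nat \<Rightarrow> nat, u :: nat \<Rightarrow> nat). (restrict (ke k u) {..<l}, ranking ?N (w u)))"
  have sg_crit: "sg t = (if t < i then t else Suc (Suc t))" if "t < m" for t using that by (simp add: sg_def)
  have sg_bd: "sg (m + j) = ?M + j" if "j < l" for j using that i by (simp add: sg_def)
  have sg_new: "sg ?b = i" by (simp add: sg_def)
  have sg_less: "sg t < ?N" if "t < ?N'" for t using that i by (auto simp: sg_def)
  have sg_ne: "t \<noteq> ?b \<Longrightarrow> sg t \<noteq> i" "sg t \<noteq> Suc i" "t \<noteq> ?b \<Longrightarrow> rs (sg t) = t" for t
    using i by (auto simp: sg_def rs_def)
  have sg_inj: "sg s = sg t \<longleftrightarrow> s = t" for s t
    using sg_ne(1,3) sg_new by metis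
  have rs: "rs s < ?N'" "rs s \<noteq> ?b" "sg (rs s) = s" if "s < ?N" "s \<noteq> i" "s \<noteq> Suc i" for s
    using that i by (auto simp: sg_def rs_def)
  have par: "even (?M + t) \<longleftrightarrow> even (m + t)" for t by simp

  have pair: "u (Suc i) < u t \<longleftrightarrow> u i < u t" "u t < u (Suc i) \<longleftrightarrow> u t < u i"
    if T: "(k, u) \<in> types ?M l" and con: "consecutive u i" and t: "t < ?N" "t \<noteq> i" "t \<noteq> Suc i" for k u t
  proof -
    have "u t \<noteq> u i" "u t \<noteq> u (Suc i)"
      using types_eq_iff[OF T t(1), of i] types_eq_iff[OF T t(1), of "Suc i"] t i by simp_all
    then show "u (Suc i) < u t \<longleftrightarrow> u i < u t" "u t < u (Suc i) \<longleftrightarrow> u t < u i"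
      using con unfolding consecutive_def by linarith+
  qed
  have pair_lt: "lt b (u (Suc i)) (u t) \<longleftrightarrow> lt b (u i) (u t)" "lt b (u t) (u (Suc i)) \<longleftrightarrow> lt b (u t) (u i)"
    if "(k, u) \<in> types ?M l" "consecutive u i" "t < ?N" "t \<noteq> i" "t \<noteq> Suc i" for k u t b
    using pair[OF that] by (simp_all add: lt_def)
  have inj_sg: "inj_on (\<lambda>t. u (sg t)) {..<?N'}" if T: "(k, u) \<in> types ?M l" for k u
  proof (rule inj_onI)
    fix s t assume st: "s \<in> {..<?N'}" "t \<in> {..<?N'}" "u (sg s) = u (sg t)"
    then have "sg s = sg t" using types_eq_iff[OF T sg_less sg_less, of s t] by simp
    then show "s = t" by (simp add: sg_inj)
  qed
  \<comment> \<open>A boundary value on the branch between the pair would lie strictly between two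
    consecutive ranks.\<close>
  have kne: "k j \<noteq> Suc i" if T: "(k, u) \<in> types ?M l" and con: "consecutive u i" and j: "j < l" for k u j
  proof
    assume kj: "k j = Suc i"
    have "lt (even (?M + k j)) (u i) (u (?M + j))" "lt (even (?M + k j)) (u (?M + j)) (u (Suc i))"
      using zigzagD(3)[OF typesD(4)[OF T] j] zigzagD(4)[OF typesD(4)[OF T] j] kj i by simp_all
    then show False
      using pair_lt(2)[OF T con, of "?M + j"] j i by (auto simp: lt_def split: if_splits)
  qed
  have zig_mer: "zigzag m (Suc l) (restrict (kc k) {..<Suc l}) (\<lambda>t. u (sg t))"
    if T: "(k, u) \<in> types ?M l" and con: "consecutive u i" for k u
    unfolding zigzag_def
  proof (intro conjI allI impI)
    note z = typesD(4)[OF T]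
    fix a assume a: "Suc a < m"
    have "lt (even (m + Suc a)) (u (if a < i then a else Suc (Suc a))) (u (if Suc a < i then Suc a else Suc (Suc (Suc a))))"
    proof -
      consider "Suc a < i" | "Suc a = i" | "i \<le> a" by linarith
      then show ?thesis
      proof cases
        case 1 then show ?thesis using zigzagD(1)[OF z, of a] a by simp
      next
        case 2
        then have *: "lt (even (m + i)) (u a) (u i)" "lt (even (m + i)) (u (Suc i)) (u (Suc (Suc i)))"
          using zigzagD(1)[OF z, of a] zigzagD(1)[OF z, of "Suc i"] a by simp_all
        then have "lt (even (m + i)) (u i) (u (Suc (Suc i)))"
          using pair_lt(1)[OF T con, of "Suc (Suc i)"] 2 a by simp
        then show ?thesis using *(1) 2 by (auto simp: lt_def split: if_splits)
      next
        case 3 then show ?thesis using zigzagD(1)[OF z, of "Suc (Suc a)"] a by simp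
      qed
    qed
    then show "lt (even (m + Suc a)) (u (sg a)) (u (sg (Suc a)))" using a by (simp add: sg_crit)
  next
    note z = typesD(4)[OF T]
    fix j assume j: "j < Suc l"
    let ?k = "restrict (kc k) {..<Suc l}"
    have up: "lt e (u i) (u (Suc (Suc i)))" if "i < m"
      using zigzagD(1)[OF z, of "Suc i"] pair_lt(1)[OF T con, of "Suc (Suc i)"] that by (simp add: e_def)
    have dn: "lt e (u (i - 1)) (u i)" if "0 < i"
      using zigzagD(1)[OF z, of "i - 1"] that i by (simp add: e_def)
    show "?k j \<le> m" and "0 < ?k j \<Longrightarrow> lt (even (m + ?k j)) (u (sg (?k j - 1))) (u (sg (m + j)))"
      and "?k j < m \<Longrightarrow> lt (even (m + ?k j)) (u (sg (m + j))) (u (sg (?k j)))"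
    proof (atomize (full), cases "j = l")
      case True
      then have "?k j = i" by (simp add: kc_def)
      then show "?k j \<le> m \<and> (0 < ?k j \<longrightarrow> lt (even (m + ?k j)) (u (sg (?k j - 1))) (u (sg (m + j)))) \<and>
        (?k j < m \<longrightarrow> lt (even (m + ?k j)) (u (sg (m + j))) (u (sg (?k j))))"
        using True up dn i by (simp add: sg_new sg_crit e_def)
    next
      case False
      then have jl: "j < l" using j by simp
      have kj: "?k j = (if k j \<le> i then k j else k j - 2)" using jl by (simp add: kc_def)
      have kM: "k j \<le> ?M" by (rule zigzagD(2)[OF z jl])
      note lo = zigzagD(3)[OF z jl] and hi = zigzagD(4)[OF z jl]
      consider "k j < i" | "k j = i" | "k j = Suc (Suc i)" | "Suc (Suc i) < k j"
        using kne[OF T con jl] by linarith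
      then show "?k j \<le> m \<and> (0 < ?k j \<longrightarrow> lt (even (m + ?k j)) (u (sg (?k j - 1))) (u (sg (m + j)))) \<and>
        (?k j < m \<longrightarrow> lt (even (m + ?k j)) (u (sg (m + j))) (u (sg (?k j))))"
      proof cases
        case 1
        then show ?thesis using lo hi i unfolding kj sg_bd[OF jl] by (auto simp: sg_crit)
      next
        case 2
        have "lt e (u (?M + j)) (u i)" using hi 2 i by (simp add: e_def)
        then have "i < m \<Longrightarrow> lt e (u (?M + j)) (u (Suc (Suc i)))" using up by (auto simp: lt_def split: if_splits)
        then show ?thesis using lo 2 i unfolding kj sg_bd[OF jl] by (auto simp: sg_crit e_def)
      next
        case 3
        have "lt e (u i) (u (?M + j))"
          using lo 3 pair_lt(1)[OF T con, of "?M + j"] jl i by (simp add: e_def)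
        then have "0 < i \<Longrightarrow> lt e (u (i - 1)) (u (?M + j))" using dn by (auto simp: lt_def split: if_splits)
        then show ?thesis using hi 3 i unfolding kj sg_bd[OF jl] by (auto simp: sg_crit e_def)
      next
        case 4
        define c where "c = k j - 3"
        have c: "k j = Suc (Suc (Suc c))" "i \<le> c" using 4 by (simp_all add: c_def)
        show ?thesis using lo hi c kM unfolding kj sg_bd[OF jl] by (simp add: sg_crit)
      qed
    qed
  qed
  have mer_in: "mer (k, u) \<in> ?D" if T: "(k, u) \<in> types ?M l" and con: "consecutive u i" for k u
  proof -
    have "restrict (kc k) {..<Suc l} \<in> {..<Suc l} \<rightarrow>\<^sub>E {..m}"
      using zigzagD(2)[OF zig_mer[OF T con]] by auto
    then have "mer (k, u) \<in> types m (Suc l)"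
      unfolding mer_def prod.case by (rule ranking_in_types[OF zig_mer[OF T con] inj_sg[OF T]])
    then show ?thesis by (simp add: mer_def kc_def)
  qed

  have w_other: "w u s = 2 * u (rs s)" if "s \<noteq> i" "s \<noteq> Suc i" for u s using that by (simp add: w_def)
  have w_sg: "w u (sg t) = 2 * u t" if "t \<noteq> ?b" for u t using sg_ne[of t] that by (simp add: w_def)
  have w_pair: "w u i = 2 * u ?b + (if e then 1 else 0)" "w u (Suc i) = 2 * u ?b + (if e then 0 else 1)" for u
    by (simp_all add: w_def)
  have une: "u t \<noteq> u ?b" if "(k, u) \<in> types m (Suc l)" "t < ?N'" "t \<noteq> ?b" for k u t
    using types_eq_iff[OF that(1,2), of ?b] that by simp
  have w_cmp: "w u s < w u t \<longleftrightarrow> u ?b < u (rs t)" "w u t < w u s \<longleftrightarrow> u (rs t) < u ?b"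
    if T: "(k, u) \<in> types m (Suc l)" and s: "s = i \<or> s = Suc i" and t: "t < ?N" "t \<noteq> i" "t \<noteq> Suc i" for k u s t
  proof -
    have "u (rs t) \<noteq> u ?b" using une[OF T rs(1,2)[OF t]] .
    moreover have "w u s = 2 * u ?b \<or> w u s = 2 * u ?b + 1" using s w_pair by (cases e) auto
    ultimately show "w u s < w u t \<longleftrightarrow> u ?b < u (rs t)" "w u t < w u s \<longleftrightarrow> u (rs t) < u ?b"
      unfolding w_other[OF t(2,3)] by linarith+
  qed
  have w_lt: "lt b (w u s) (w u t) \<longleftrightarrow> lt b (u ?b) (u (rs t))" "lt b (w u t) (w u s) \<longleftrightarrow> lt b (u (rs t)) (u ?b)"
    if "(k, u) \<in> types m (Suc l)" "s = i \<or> s = Suc i" "t < ?N" "t \<noteq> i" "t \<noteq> Suc i" for k u s t b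
    using w_cmp[OF that] by (simp_all add: lt_def)
  have w_lt2: "lt b (w u s) (w u t) \<longleftrightarrow> lt b (u (rs s)) (u (rs t))"
    if "s \<noteq> i" "s \<noteq> Suc i" "t \<noteq> i" "t \<noteq> Suc i" for u s t b
    using that by (simp add: lt_def w_other)
  have inj_w: "inj_on (w u) {..<?N}" if T: "(k, u) \<in> types m (Suc l)" for k u
  proof (rule linorder_inj_onI)
    fix s t assume st: "s < t" "s \<in> {..<?N}" "t \<in> {..<?N}"
    consider "s = i \<and> t = Suc i" | "s = i \<or> s = Suc i" "t \<noteq> i" "t \<noteq> Suc i"
      | "t = i \<or> t = Suc i" "s \<noteq> i" "s \<noteq> Suc i" | "s \<noteq> i" "s \<noteq> Suc i" "t \<noteq> i" "t \<noteq> Suc i"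
    proof -
      have "\<not> (s = Suc i \<and> t = i)" "\<not> (s = i \<and> t = i)" "\<not> (s = Suc i \<and> t = Suc i)" using st(1) by auto
      then show ?thesis using that by blast
    qed
    then show "w u s \<noteq> w u t"
    proof cases
      case 1 then show ?thesis using w_pair by auto
    next
      case 2
      then have "u (rs t) \<noteq> u ?b" using une[OF T rs(1,2)] st by simp
      then show ?thesis using w_cmp[OF T 2(1) _ 2(2,3)] st by force
    next
      case 3
      then have "u (rs s) \<noteq> u ?b" using une[OF T rs(1,2)] st by simp
      then show ?thesis using w_cmp[OF T 3(1) _ 3(2,3)] st by force
    next
      case 4
      have "rs s \<noteq> rs t" using rs(3)[of s] rs(3)[of t] 4 st by (metis lessThan_iff less_irrefl)
      then show ?thesis using types_eq_iff[OF T rs(1) rs(1), of s t] 4 st by (simp add: w_other)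
    qed
  qed auto
  have rs_lo: "rs s = s" if "s < i" for s using that by (simp add: rs_def)
  have rs_hi: "rs (Suc (Suc s)) = s" if "i \<le> s" for s using that by (simp add: rs_def)
  have rs_bd: "rs (?M + j) = m + j" "rs (Suc (Suc (m + j))) = m + j" for j using i by (simp_all add: rs_def)
  have zig_spl: "zigzag ?M l (restrict (ke k u) {..<l}) (w u)"
    if T: "(k, u) \<in> types m (Suc l)" and kl: "k l = i" for k u
    unfolding zigzag_def
  proof (intro conjI allI impI)
    note z = typesD(4)[OF T]
    fix a assume a: "Suc a < ?M"
    have dn: "lt e (u (i - 1)) (u ?b)" if "0 < i" using zigzagD(3)[OF z, of l] kl that by (simp add: e_def)
    have up: "lt e (u ?b) (u i)" if "i < m" using zigzagD(4)[OF z, of l] kl that by (simp add: e_def)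
    consider "Suc a < i" | "Suc a = i" | "a = i" | "a = Suc i" | "Suc (Suc i) \<le> a"
      by linarith
    then show "lt (even (?M + Suc a)) (w u a) (w u (Suc a))"
    proof cases
      case 1
      then show ?thesis using zigzagD(1)[OF z, of a] i by (simp add: w_lt2 rs_lo)
    next
      case 2
      then have "rs a = i - 1" "a < ?N" "a \<noteq> i" "a \<noteq> Suc i" using i by (auto simp: rs_def)
      then show ?thesis using w_lt(2)[OF T, of i a] dn 2 by (simp add: e_def)
    next
      case 3
      then show ?thesis using w_pair by (auto simp: lt_def e_def)
    next
      case 4
      then show ?thesis using w_lt(1)[OF T, of "Suc i" "Suc (Suc i)"] up a by (simp add: rs_hi e_def)
    next
      case 5
      define c where "c = a - 2"
      have "a = Suc (Suc c)" "i \<le> c" using 5 by (simp_all add: c_def)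
      then show ?thesis using zigzagD(1)[OF z, of c] a by (simp add: w_lt2 rs_hi)
    qed
  next
    note z = typesD(4)[OF T]
    fix j assume j: "j < l"
    let ?k = "restrict (ke k u) {..<l}"
    have dn: "lt e (u (i - 1)) (u ?b)" if "0 < i" using zigzagD(3)[OF z, of l] kl that by (simp add: e_def)
    have up: "lt e (u ?b) (u i)" if "i < m" using zigzagD(4)[OF z, of l] kl that by (simp add: e_def)
    have j': "j < Suc l" using j by simp
    note lo = zigzagD(3)[OF z j'] and hi = zigzagD(4)[OF z j'] and km = zigzagD(2)[OF z j']
    have bd: "?M + j < ?N" "?M + j \<noteq> i" "?M + j \<noteq> Suc i" using j i by simp_all
    have bne: "u (m + j) \<noteq> u ?b" using une[OF T, of "m + j"] j by simp
    have kj: "?k j = ke k u j" using j by simp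
    show "?k j \<le> ?M" and "0 < ?k j \<Longrightarrow> lt (even (?M + ?k j)) (w u (?k j - 1)) (w u (?M + j))"
      and "?k j < ?M \<Longrightarrow> lt (even (?M + ?k j)) (w u (?M + j)) (w u (?k j))"
    proof (atomize (full))
      consider "k j < i" | "i < k j" | "k j = i" "e \<longleftrightarrow> u (m + j) < u ?b" | "k j = i" "\<not> (e \<longleftrightarrow> u (m + j) < u ?b)"
        by linarith
      then show "?k j \<le> ?M \<and> (0 < ?k j \<longrightarrow> lt (even (?M + ?k j)) (w u (?k j - 1)) (w u (?M + j))) \<and>
        (?k j < ?M \<longrightarrow> lt (even (?M + ?k j)) (w u (?M + j)) (w u (?k j)))"
      proof cases
        case 1
        then have k: "ke k u j = k j" by (simp add: ke_def)
        have "lt (even (m + k j)) (w u (k j - 1)) (w u (?M + j))" if "0 < k j"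
          using lo[OF that] 1 bd by (subst w_lt2) (simp_all add: rs_lo rs_bd)
        moreover have "lt (even (m + k j)) (w u (?M + j)) (w u (k j))"
          using hi 1 i bd by (subst w_lt2) (simp_all add: rs_lo rs_bd)
        ultimately show ?thesis using km unfolding kj k by simp
      next
        case 2
        then have k: "ke k u j = Suc (Suc (k j))" by (simp add: ke_def)
        define c where "c = k j - 1"
        have c: "k j = Suc c" "i \<le> c" using 2 by (simp_all add: c_def)
        have "lt (even (m + k j)) (w u (Suc (k j))) (w u (?M + j))"
          using lo c bd by (subst w_lt2) (simp_all add: rs_hi rs_bd)
        moreover have "lt (even (m + k j)) (w u (?M + j)) (w u (Suc (Suc (k j))))" if "k j < m"
          using hi[OF that] 2 bd by (subst w_lt2) (simp_all add: rs_hi rs_bd)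
        ultimately show ?thesis using km unfolding kj k by simp
      next
        case 3
        then have k: "ke k u j = i" by (simp add: ke_def)
        have "lt e (w u (i - 1)) (w u (?M + j))" if "0 < i"
          using lo 3 bd that by (subst w_lt2) (simp_all add: rs_lo rs_bd e_def)
        moreover have "lt e (u (m + j)) (u ?b)" using 3(2) bne by (auto simp: lt_def)
        then have "lt e (w u (?M + j)) (w u i)" using w_lt(2)[OF T, of i "?M + j"] bd by (simp add: rs_bd)
        ultimately show ?thesis using i unfolding kj k by (simp add: e_def)
      next
        case 4
        then have k: "ke k u j = Suc (Suc i)" by (simp add: ke_def)
        have "lt e (u ?b) (u (m + j))" using 4(2) bne by (auto simp: lt_def)
        then have "lt e (w u (Suc i)) (w u (?M + j))" using w_lt(1)[OF T, of "Suc i" "?M + j"] bd by (simp add: rs_bd)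
        moreover have "lt e (w u (?M + j)) (w u (Suc (Suc i)))" if "i < m"
          using hi 4 bd that by (subst w_lt2) (simp_all add: rs_hi rs_bd e_def)
        ultimately show ?thesis using i unfolding kj k by (simp add: e_def)
      qed
    qed
  qed
  have spl_in: "spl (k, u) \<in> ?C" if T: "(k, u) \<in> types m (Suc l)" and kl: "k l = i" for k u
  proof -
    have "restrict (ke k u) {..<l} \<in> {..<l} \<rightarrow>\<^sub>E {..?M}"
      using zigzagD(2)[OF zig_spl[OF T kl]] by auto
    then have "spl (k, u) \<in> types ?M l"
      unfolding spl_def prod.case by (rule ranking_in_types[OF zig_spl[OF T kl] inj_w[OF T]])
    moreover have "consecutive (ranking ?N (w u)) i"
    proof (cases e)
      case True
      then have "Suc (ranking ?N (w u) (Suc i)) = ranking ?N (w u) i"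
        using i w_pair[of u] by (intro ranking_Suc inj_w[OF T]) auto
      then show ?thesis by (simp add: consecutive_def)
    next
      case False
      then have "Suc (ranking ?N (w u) i) = ranking ?N (w u) (Suc i)"
        using i w_pair[of u] by (intro ranking_Suc inj_w[OF T]) auto
      then show ?thesis by (simp add: consecutive_def)
    qed
    ultimately show ?thesis by (simp add: spl_def)
  qed
  show "bij_betw mer ?C ?D"
  proof (rule bij_betw_byWitness[where f' = spl])
    show "mer ` ?C \<subseteq> ?D"
    proof (rule image_subsetI)
      fix \<tau> assume "\<tau> \<in> ?C"
      then show "mer \<tau> \<in> ?D" using mer_in[of "fst \<tau>" "snd \<tau>"] by simp
    qed
    show "spl ` ?D \<subseteq> ?C"
    proof (rule image_subsetI)
      fix \<tau> assume "\<tau> \<in> ?D"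
      then show "spl \<tau> \<in> ?C" using spl_in[of "fst \<tau>" "snd \<tau>"] by simp
    qed
    show "\<forall>\<tau>\<in>?D. mer (spl \<tau>) = \<tau>"
    proof
      fix \<tau> assume "\<tau> \<in> ?D"
      then obtain k u where \<tau>: "\<tau> = (k, u)" and T: "(k, u) \<in> types m (Suc l)" and kl: "k l = i" by (cases \<tau>) auto
      have "kc (restrict (ke k u) {..<l}) j = k j" if "j < Suc l" for j
        using that kl by (cases "j = l") (auto simp: kc_def ke_def)
      then have "restrict (kc (restrict (ke k u) {..<l})) {..<Suc l} = restrict k {..<Suc l}"
        by (intro restrict_ext) simp
      also have "\<dots> = k" using typesD(1)[OF T] by (simp add: PiE_def extensional_restrict)
      finally have 1: "restrict (kc (restrict (ke k u) {..<l})) {..<Suc l} = k" .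
      have "ranking ?N' (\<lambda>t. ranking ?N (w u) (sg t)) = ranking ?N' u"
      proof (rule ranking_cong)
        fix s t assume st: "s < ?N'" "t < ?N'"
        have "ranking ?N (w u) (sg s) < ranking ?N (w u) (sg t) \<longleftrightarrow> w u (sg s) < w u (sg t)"
          by (rule ranking_less_iff[OF inj_w[OF T] sg_less[OF st(1)] sg_less[OF st(2)]])
        also have "\<dots> \<longleftrightarrow> u s < u t"
        proof -
          consider "s = ?b" "t = ?b" | "s = ?b" "t \<noteq> ?b" | "s \<noteq> ?b" "t = ?b" | "s \<noteq> ?b" "t \<noteq> ?b" by blast
          then show ?thesis
          proof cases
            case 2
            then show ?thesis using w_cmp(1)[OF T, of i "sg t"] sg_less[OF st(2)] sg_ne[of t] by (simp add: sg_new)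
          next
            case 3
            then show ?thesis using w_cmp(2)[OF T, of i "sg s"] sg_less[OF st(1)] sg_ne[of s] by (simp add: sg_new)
          next
            case 4
            then show ?thesis by (simp add: w_sg)
          qed simp
        qed
        finally show "ranking ?N (w u) (sg s) < ranking ?N (w u) (sg t) \<longleftrightarrow> u s < u t" .
      qed
      then have 2: "ranking ?N' (\<lambda>t. ranking ?N (w u) (sg t)) = u" using ranking_types[OF T] by simp
      show "mer (spl \<tau>) = \<tau>" unfolding \<tau> spl_def mer_def prod.case 1 2 ..
    qed
    show "\<forall>\<tau>\<in>?C. spl (mer \<tau>) = \<tau>"
    proof
      fix \<tau> assume "\<tau> \<in> ?C"
      then obtain k u where \<tau>: "\<tau> = (k, u)" and T: "(k, u) \<in> types ?M l" and con: "consecutive u i" by (cases \<tau>) auto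
      note z = typesD(4)[OF T]
      define k' where "k' = restrict (kc k) {..<Suc l}"
      define u' where "u' = ranking ?N' (\<lambda>t. u (sg t))"
      have T': "(k', u') \<in> types m (Suc l)" using mer_in[OF T con] by (simp add: mer_def k'_def u'_def)
      have u': "u' s < u' t \<longleftrightarrow> u (sg s) < u (sg t)" if "s < ?N'" "t < ?N'" for s t
        unfolding u'_def by (rule ranking_less_iff[OF inj_sg[OF T] that])
      have "ke k' u' j = k j" if j: "j < l" for j
      proof -
        have c: "u' (m + j) < u' ?b \<longleftrightarrow> u (?M + j) < u i" using u'[of "m + j" ?b] j by (simp add: sg_bd sg_new)
        have kj: "k' j = (if k j \<le> i then k j else k j - 2)" using j by (simp add: k'_def kc_def)
        consider "k j < i" | "k j = i" | "k j = Suc (Suc i)" | "Suc (Suc i) < k j"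
          using kne[OF T con j] by linarith
        then show ?thesis
        proof cases
          case 2
          have "lt e (u (?M + j)) (u i)" using zigzagD(4)[OF z j] 2 i by (simp add: e_def)
          then have "e \<longleftrightarrow> u' (m + j) < u' ?b" unfolding c by (auto simp: lt_def split: if_splits)
          then show ?thesis using 2 by (simp add: ke_def kj)
        next
          case 3
          have "lt e (u i) (u (?M + j))"
            using zigzagD(3)[OF z j] 3 pair_lt(1)[OF T con, of "?M + j"] j i by (simp add: e_def)
          then have "\<not> (e \<longleftrightarrow> u' (m + j) < u' ?b)" unfolding c by (auto simp: lt_def split: if_splits)
          then show ?thesis using 3 by (simp add: ke_def kj)
        qed (auto simp: ke_def kj)
      qed
      then have "restrict (ke k' u') {..<l} = restrict k {..<l}" by (intro restrict_ext) simp
      also have "\<dots> = k" using typesD(1)[OF T] by (simp add: PiE_def extensional_restrict)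
      finally have 1: "restrict (ke k' u') {..<l} = k" .
      have bN: "?b < ?N'" by simp
      have "ranking ?N (w u') = ranking ?N u"
      proof (rule ranking_cong)
        fix s t assume st: "s < ?N" "t < ?N"
        have e: "(if e then u (Suc i) < u i else u i < u (Suc i))"
          using zigzagD(1)[OF z, of i] i by (auto simp: e_def lt_def split: if_splits)
        have out: "w u' a < w u' c \<longleftrightarrow> u a < u c" "w u' c < w u' a \<longleftrightarrow> u c < u a"
          if "a = i \<or> a = Suc i" "c < ?N" "c \<noteq> i" "c \<noteq> Suc i" for a c
          using w_cmp[OF T' that] u'[OF bN rs(1)[OF that(2-4)]] u'[OF rs(1)[OF that(2-4)] bN]
            pair[OF T con that(2-4)] that(1) rs(3)[OF that(2-4)] by (auto simp: sg_new)
        consider "s = t" | "s = i" "t = Suc i" | "s = Suc i" "t = i" | "s = i \<or> s = Suc i" "t \<noteq> i" "t \<noteq> Suc i"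
          | "t = i \<or> t = Suc i" "s \<noteq> i" "s \<noteq> Suc i" | "s \<noteq> i" "s \<noteq> Suc i" "t \<noteq> i" "t \<noteq> Suc i"
          by blast
        then show "w u' s < w u' t \<longleftrightarrow> u s < u t"
        proof cases
          case 2 then show ?thesis using e w_pair[of u'] by (auto split: if_splits)
        next
          case 3 then show ?thesis using e w_pair[of u'] by (auto split: if_splits)
        next
          case 4 then show ?thesis using out(1)[OF 4(1) st(2) 4(2,3)] by simp
        next
          case 5 then show ?thesis using out(2)[OF 5(1) st(1) 5(2,3)] by simp
        next
          case 6
          then show ?thesis
            using u'[OF rs(1)[OF st(1)] rs(1)[OF st(2)]] rs(3)[OF st(1)] rs(3)[OF st(2)] by (simp add: w_other)
        qed simp
      qed
      then have 2: "ranking ?N (w u') = u" using ranking_types[OF T] by simp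
      have "mer \<tau> = (k', u')" by (simp add: \<tau> mer_def k'_def u'_def)
      then show "spl (mer \<tau>) = \<tau>" unfolding spl_def by (simp only: prod.case 1 2 \<tau>)
    qed
  qed
qed

section \<open>Assembling the recursion\<close>

lemma sum_card_fibers:
  assumes "finite A" "finite I" "\<And>a. a \<in> A \<Longrightarrow> f a \<in> I"
  shows "(\<Sum>i\<in>I. card {a \<in> A. f a = i \<and> P a i}) = card {a \<in> A. P a (f a)}"
proof -
  have "(\<Sum>i\<in>I. card {a \<in> A. f a = i \<and> P a i}) = (\<Sum>a\<in>A. card {i \<in> I. f a = i \<and> P a i})"
    by (rule sum_card_swap[OF assms(2,1)])
  also have "\<dots> = (\<Sum>a\<in>A. if P a (f a) then 1 else 0)"
  proof (rule sum.cong)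
    fix a assume "a \<in> A"
    then have "{i \<in> I. f a = i \<and> P a i} = (if P a (f a) then {f a} else {})" using assms(3) by auto
    then show "card {i \<in> I. f a = i \<and> P a i} = (if P a (f a) then 1 else 0)" by simp
  qed simp
  also have "\<dots> = card {a \<in> A. P a (f a)}"
    using assms(1) by (simp add: sum.If_cases Collect_conj_eq)
  finally show ?thesis .
qed

text \<open>The position \<open>i\<close> of a cancelling pair becomes the branch of the new
  boundary point, so summing over the \<open>m + 1\<close> positions exhausts the types with
  \<open>m\<close> critical points and \<open>l + 1\<close> boundary points. In the other sum each
  of the \<open>l\<close> points can sit on any of \<open>Suc ?M\<close> branches, and by
  \<open>card_insert_boundary\<close> every choice contributes the same number.\<close>

theorem card_types_recursion:
  "card (types (Suc (Suc m)) l) =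
    card (types m (Suc l)) + (if l = 0 then 0 else Suc (Suc (Suc m)) * l * card (types (Suc (Suc m)) (l - 1)))"
proof -
  let ?M = "Suc (Suc m)"
  have fst_le: "fst \<tau> j \<in> {..m'}" if "\<tau> \<in> types m' l'" "j < l'" for \<tau> m' l' j
    using typesD(1)[of "fst \<tau>" "snd \<tau>" m' l'] that by auto
  have "(\<Sum>i<?M - 1. card {\<tau> \<in> types ?M l. consecutive (snd \<tau>) i}) =
      (\<Sum>i\<in>{..m}. card {\<tau> \<in> types m (Suc l). fst \<tau> l = i \<and> True})"
    by (rule sum.cong) (auto simp: card_merge_critical)
  also have "\<dots> = card {\<tau> \<in> types m (Suc l). True}"
    by (rule sum_card_fibers) (auto simp: finite_types intro: fst_le[unfolded atMost_iff])
  finally have 1: "(\<Sum>i<?M - 1. card {\<tau> \<in> types ?M l. consecutive (snd \<tau>) i}) = card (types m (Suc l))"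
    by simp
  have 2: "(\<Sum>j<l. card {\<tau> \<in> types ?M l. Suc (snd \<tau> (?M + j)) = branch_top ?M (?M + l) (fst \<tau> j) (snd \<tau>)}) =
      (if l = 0 then 0 else Suc ?M * l * card (types ?M (l - 1)))"
  proof (cases l)
    case (Suc l')
    have "card {\<tau> \<in> types ?M l. Suc (snd \<tau> (?M + j)) = branch_top ?M (?M + l) (fst \<tau> j) (snd \<tau>)} =
        Suc ?M * card (types ?M l')" if j: "j < l" for j
    proof -
      have "card {\<tau> \<in> types ?M l. Suc (snd \<tau> (?M + j)) = branch_top ?M (?M + l) (fst \<tau> j) (snd \<tau>)} =
          (\<Sum>\<kappa>\<in>{..?M}. card {\<tau> \<in> types ?M l. fst \<tau> j = \<kappa> \<and> Suc (snd \<tau> (?M + j)) = branch_top ?M (?M + l) \<kappa> (snd \<tau>)})"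
        by (rule sum_card_fibers[symmetric]) (simp_all only: finite_types finite_atMost fst_le[OF _ j])
      also have "\<dots> = (\<Sum>\<kappa>\<in>{..?M}. card (types ?M l'))"
      proof (rule sum.cong)
        fix \<kappa> assume "\<kappa> \<in> {..?M}"
        then show "card {\<tau> \<in> types ?M l. fst \<tau> j = \<kappa> \<and> Suc (snd \<tau> (?M + j)) = branch_top ?M (?M + l) \<kappa> (snd \<tau>)} =
            card (types ?M l')"
          using j unfolding Suc atMost_iff by (intro card_insert_boundary)
      qed simp
      finally show ?thesis by simp
    qed
    then have "(\<Sum>j<l. card {\<tau> \<in> types ?M l. Suc (snd \<tau> (?M + j)) = branch_top ?M (?M + l) (fst \<tau> j) (snd \<tau>)}) =
        (\<Sum>j<l. Suc ?M * card (types ?M l'))" by (intro sum.cong) simp_all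
    also have "\<dots> = l * (Suc ?M * card (types ?M l'))" by simp
    finally show ?thesis using Suc by (simp only: mult_ac diff_Suc_1 nat.distinct if_False)
  qed simp
  show ?thesis using card_types_eq[of ?M l] 1 2 by simp
qed

theorem mainTheorem1:
  fixes n l :: nat
  assumes "n \<ge> 3"
  shows "int (K (n - 2) (l + 1)) =
           int (K n l) - (if l = 0 then 0 else int n * int l * int (K n (l - 1)))"
proof -
  obtain m where n: "n = Suc (Suc (Suc m))"
    using assms by (metis Suc_le_D eval_nat_numeral(3) numeral_2_eq_2 Suc_le_mono)
  have "K n l = K (n - 2) (l + 1) + (if l = 0 then 0 else n * l * K n (l - 1))"
    unfolding n using card_types_recursion[of m l] by (simp add: K_eq_card_types del: mult_Suc)
  then show ?thesis by (cases "l = 0") simp_all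
qed

end
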